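(* Let $\Gamma$ be a discrete countable group with a nonelementary and essential action $\Gamma\to\mathrm{Aut}(X)$ on a finite dimensional CAT(0) cube complex $X$, and let $\lambda_\pm$ be quasi-$\Gamma$-invariant probability measures on $\partial X$ such that the diagonal $\Gamma$-action on $(\partial X\times\partial X,\lambda_-\otimes\lambda_+)$ is isometrically ergodic. Then $\lambda_-\otimes\lambda_+(\partial_rX\times\partial_rX)=1$ and $\lambda_-\otimes\lambda_+(\Delta)=0$.
   Context: Conventions. $X$ is a finite-dimensional, second countable CAT(0) cube complex, identified with its vertex set and with combinatorial metric $d$. $\mathfrak H$ is the set of half-spaces, $h^*=X\setminus h$; $U_v=\{h:v\in h\}$; the Roller compactification $\overline X$ is the closure of $\{U_v\}$ in $2^{\mathfrak H}$, $\partial X=\overline X\setminus X$; each $\xi\in\overline X$ is a set $U_\xi\subset\mathfrak H$ and $h$ is also regarded as $\{\xi\in\overline X:h\in U_\xi\}$. Two half-spaces $h,k$ are transverse if $h\cap k,h\cap k^*,h^*\cap k,h^*\cap k^*$ are all nonempty; strongly separated if no half-space is transverse to both. $X$ decomposes uniquely as a product $X_1\times\cdots\times X_n$ of irreducible (not nontrivially decomposable) factors, with $\mathfrak H=\mathfrak H_1\sqcup\cdots\sqcup\mathfrak H_n$ and $\overline X=\overline X_1\times\cdots\times\overline X_n$. Regular points: for irreducible $X$, $\partial_rX$ is the set of $\xi\in\partial X$ such that for all $h_1,h_2\in U_\xi$ there is $k\in U_\xi$ with $k\subset h_1\cap h_2$, strongly separated from $h_1$ and from $h_2$; in general $\partial_rX=\partial_rX_1\times\cdots\times\partial_rX_n$.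 The fat diagonal $\Delta\subset\partial_rX\times\partial_rX$ is the set of pairs $((\xi_1^1,\dots,\xi_1^n),(\xi_2^1,\dots,\xi_2^n))$ with $\xi_1^i=\xi_2^i$ for some $i$. Nonelementary: no finite orbit in $X$ or in the visual boundary. Essential: for every $h\in\mathfrak H$, both $h$ and $h^*$ are $\Gamma$-deep, where $h$ is $\Gamma$-deep if for some (every) $x\in X$ the points of $\Gamma x\cap h$ are at unbounded distance from $h^*$. A measure $\lambda$ is quasi-$\Gamma$-invariant if $\lambda(E)>0$ implies $\lambda(\gamma E)>0$. An action on a measure space $(E,\nu)$ is isometrically ergodic if for every separable metric space $(M,d)$ with an isometric $\Gamma$-action, every measurable $\Gamma$-equivariant map $E\to M$ is essentially constant. *)

theory Defs
  imports "HOL-Probability.Probability" "HOL-Algebra.Group_Action"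
begin

section \<open>The CAT(0) cube complex, via its 1-skeleton (a median graph)\<close>

definition walk :: "'a set \<Rightarrow> ('a \<Rightarrow> 'a \<Rightarrow> bool) \<Rightarrow> nat \<Rightarrow> 'a \<Rightarrow> 'a \<Rightarrow> bool" where
  "walk V E n x y \<longleftrightarrow> (\<exists>f::nat \<Rightarrow> 'a. f 0 = x \<and> f n = y \<and> (\<forall>i\<le>n. f i \<in> V)
                         \<and> (\<forall>i<n. E (f i) (f (Suc i))))"

definition gdist :: "'a set \<Rightarrow> ('a \<Rightarrow> 'a \<Rightarrow> bool) \<Rightarrow> 'a \<Rightarrow> 'a \<Rightarrow> nat" where
  "gdist V E x y = (LEAST n. walk V E n x y)"

definition interval :: "'a set \<Rightarrow> ('a \<Rightarrow> 'a \<Rightarrow> bool) \<Rightarrow> 'a \<Rightarrow> 'a \<Rightarrow> 'a set" where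
  "interval V E x y = {z \<in> V. gdist V E x z + gdist V E z y = gdist V E x y}"

text \<open>Median graphs = 1-skeleta of CAT(0) cube complexes (Chepoi, Roller, Gerasimov).\<close>
definition median_graph :: "'a set \<Rightarrow> ('a \<Rightarrow> 'a \<Rightarrow> bool) \<Rightarrow> bool" where
  "median_graph V E \<longleftrightarrow> V \<noteq> {}
     \<and> (\<forall>x y. E x y \<longrightarrow> x \<in> V \<and> y \<in> V \<and> E y x \<and> x \<noteq> y)
     \<and> (\<forall>x\<in>V. \<forall>y\<in>V. \<exists>n. walk V E n x y)
     \<and> (\<forall>x\<in>V. \<forall>y\<in>V. \<forall>z\<in>V. \<exists>!m. m \<in> interval V E x y \<inter> interval V E y z \<inter> interval V E x z)"

definition gconvex :: "'a set \<Rightarrow> ('a \<Rightarrow> 'a \<Rightarrow> bool) \<Rightarrow> 'a set \<Rightarrow> bool" where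
  "gconvex V E S \<longleftrightarrow> S \<subseteq> V \<and> (\<forall>x\<in>S. \<forall>y\<in>S. interval V E x y \<subseteq> S)"

definition halfspaces :: "'a set \<Rightarrow> ('a \<Rightarrow> 'a \<Rightarrow> bool) \<Rightarrow> 'a set set" where
  "halfspaces V E = {h. h \<noteq> {} \<and> h \<subset> V \<and> gconvex V E h \<and> gconvex V E (V - h)}"

definition Uv :: "'a set \<Rightarrow> ('a \<Rightarrow> 'a \<Rightarrow> bool) \<Rightarrow> 'a \<Rightarrow> 'a set set" where
  "Uv V E v = {h \<in> halfspaces V E. v \<in> h}"

text \<open>A cube: a base vertex v and a finite complement-closed set W of half-spaces (the
  hyperplanes spanning it) such that every way of flipping v across the hyperplanes in W is a
  vertex.  Its dimension is card W / 2.\<close>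
definition is_cube :: "'a set \<Rightarrow> ('a \<Rightarrow> 'a \<Rightarrow> bool) \<Rightarrow> 'a \<Rightarrow> 'a set set \<Rightarrow> bool" where
  "is_cube V E v W \<longleftrightarrow> v \<in> V \<and> finite W \<and> W \<subseteq> halfspaces V E \<and> (\<forall>h\<in>W. V - h \<in> W)
     \<and> (\<forall>R. R \<subseteq> halfspaces V E \<and> (\<forall>h\<in>halfspaces V E - W. h \<in> R \<longleftrightarrow> v \<in> h)
            \<and> (\<forall>h\<in>W. h \<in> R \<longleftrightarrow> V - h \<notin> R) \<longrightarrow> (\<exists>u\<in>V. R = Uv V E u))"

definition finite_dimensional :: "'a set \<Rightarrow> ('a \<Rightarrow> 'a \<Rightarrow> bool) \<Rightarrow> bool" where
  "finite_dimensional V E \<longleftrightarrow> (\<exists>N::nat. \<forall>v W. is_cube V E v W \<longrightarrow> card W \<le> 2 * N)"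

text \<open>A point of a cube (v,W) is a function p on half-spaces with p h \<in> [0,1] measuring
  "how far into h" the point is, p(h*) = 1 - p h, and p h = [v \<in> h] off W.\<close>
definition cube_points :: "'a set \<Rightarrow> ('a \<Rightarrow> 'a \<Rightarrow> bool) \<Rightarrow> 'a \<Rightarrow> 'a set set \<Rightarrow> ('a set \<Rightarrow> real) set" where
  "cube_points V E v W = {p. (\<forall>h. h \<notin> halfspaces V E \<longrightarrow> p h = 0)
     \<and> (\<forall>h\<in>halfspaces V E. 0 \<le> p h \<and> p h \<le> 1 \<and> p (V - h) = 1 - p h)
     \<and> (\<forall>h\<in>halfspaces V E - W. p h = (if v \<in> h then 1 else 0))}"

definition realization :: "'a set \<Rightarrow> ('a \<Rightarrow> 'a \<Rightarrow> bool) \<Rightarrow> ('a set \<Rightarrow> real) set" where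
  "realization V E = (\<Union>{cube_points V E v W | v W. is_cube V E v W})"

definition common_cube :: "'a set \<Rightarrow> ('a \<Rightarrow> 'a \<Rightarrow> bool) \<Rightarrow> ('a set \<Rightarrow> real) \<Rightarrow> ('a set \<Rightarrow> real) \<Rightarrow> bool" where
  "common_cube V E p q \<longleftrightarrow> (\<exists>v W. is_cube V E v W \<and> p \<in> cube_points V E v W \<and> q \<in> cube_points V E v W)"

text \<open>Euclidean distance inside a common (unit) cube; each hyperplane is counted twice in the
  sum over half-spaces, whence the factor 1/2.\<close>
definition local_dist :: "('a set \<Rightarrow> real) \<Rightarrow> ('a set \<Rightarrow> real) \<Rightarrow> real" where
  "local_dist p q = sqrt ((\<Sum>h\<in>{h. p h \<noteq> q h}. (p h - q h)^2) / 2)"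

definition cdist :: "'a set \<Rightarrow> ('a \<Rightarrow> 'a \<Rightarrow> bool) \<Rightarrow> ('a set \<Rightarrow> real) \<Rightarrow> ('a set \<Rightarrow> real) \<Rightarrow> real" where
  "cdist V E p q = Inf {(\<Sum>i<n. local_dist (c i) (c (Suc i))) | c n.
      c 0 = p \<and> c n = q \<and> (\<forall>i<n. common_cube V E (c i) (c (Suc i)))}"

definition geodesic_ray :: "'a set \<Rightarrow> ('a \<Rightarrow> 'a \<Rightarrow> bool) \<Rightarrow> (real \<Rightarrow> ('a set \<Rightarrow> real)) \<Rightarrow> bool" where
  "geodesic_ray V E c \<longleftrightarrow> (\<forall>t\<ge>0. c t \<in> realization V E)
      \<and> (\<forall>s\<ge>0. \<forall>t\<ge>0. cdist V E (c s) (c t) = \<bar>s - t\<bar>)"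

definition visual_point :: "'a set \<Rightarrow> ('a \<Rightarrow> 'a \<Rightarrow> bool) \<Rightarrow> (real \<Rightarrow> ('a set \<Rightarrow> real)) \<Rightarrow> (real \<Rightarrow> ('a set \<Rightarrow> real)) set" where
  "visual_point V E c = {c'. geodesic_ray V E c' \<and> (\<exists>B. \<forall>t\<ge>0. cdist V E (c t) (c' t) \<le> B)}"

text \<open>Action of Gamma on X by cubical automorphisms = graph automorphisms of the 1-skeleton.\<close>
definition aut_action :: "('g, 'b) monoid_scheme \<Rightarrow> 'a set \<Rightarrow> ('a \<Rightarrow> 'a \<Rightarrow> bool) \<Rightarrow> ('g \<Rightarrow> 'a \<Rightarrow> 'a) \<Rightarrow> bool" where
  "aut_action G V E \<phi> \<longleftrightarrow> group_action G V \<phi>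
     \<and> (\<forall>g\<in>carrier G. \<forall>x\<in>V. \<forall>y\<in>V. E (\<phi> g x) (\<phi> g y) \<longleftrightarrow> E x y)"

definition act_point :: "('g, 'b) monoid_scheme \<Rightarrow> 'a set \<Rightarrow> ('a \<Rightarrow> 'a \<Rightarrow> bool) \<Rightarrow> ('g \<Rightarrow> 'a \<Rightarrow> 'a) \<Rightarrow> 'g \<Rightarrow> ('a set \<Rightarrow> real) \<Rightarrow> ('a set \<Rightarrow> real)" where
  "act_point G V E \<phi> g p = (\<lambda>h. if h \<in> halfspaces V E then p (\<phi> (inv\<^bsub>G\<^esub> g) ` h) else 0)"

definition act_roller :: "('g \<Rightarrow> 'a \<Rightarrow> 'a) \<Rightarrow> 'g \<Rightarrow> 'a set set \<Rightarrow> 'a set set" where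
  "act_roller \<phi> g \<xi> = (\<lambda>h. \<phi> g ` h) ` \<xi>"

definition nonelementary :: "('g, 'b) monoid_scheme \<Rightarrow> 'a set \<Rightarrow> ('a \<Rightarrow> 'a \<Rightarrow> bool) \<Rightarrow> ('g \<Rightarrow> 'a \<Rightarrow> 'a) \<Rightarrow> bool" where
  "nonelementary G V E \<phi> \<longleftrightarrow>
     (\<forall>x\<in>V. infinite {\<phi> g x | g. g \<in> carrier G})
     \<and> (\<forall>c. geodesic_ray V E c \<longrightarrow>
           infinite {visual_point V E (\<lambda>t. act_point G V E \<phi> g (c t)) | g. g \<in> carrier G})"

definition deep :: "('g, 'b) monoid_scheme \<Rightarrow> 'a set \<Rightarrow> ('a \<Rightarrow> 'a \<Rightarrow> bool) \<Rightarrow> ('g \<Rightarrow> 'a \<Rightarrow> 'a) \<Rightarrow> 'a set \<Rightarrow> bool" where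
  "deep G V E \<phi> h \<longleftrightarrow> (\<exists>x\<in>V. \<forall>N::nat. \<exists>g\<in>carrier G. \<phi> g x \<in> h
        \<and> (\<forall>w\<in>V - h. gdist V E (\<phi> g x) w > N))"

definition essential :: "('g, 'b) monoid_scheme \<Rightarrow> 'a set \<Rightarrow> ('a \<Rightarrow> 'a \<Rightarrow> bool) \<Rightarrow> ('g \<Rightarrow> 'a \<Rightarrow> 'a) \<Rightarrow> bool" where
  "essential G V E \<phi> \<longleftrightarrow> (\<forall>h\<in>halfspaces V E. deep G V E \<phi> h \<and> deep G V E \<phi> (V - h))"

text \<open>Closure of {U_v} in 2^H (product topology), with H restricted to a set B of
  half-spaces (B = H gives the Roller compactification of X; B = H_i that of the factor X_i).\<close>
definition roller_closure :: "'a set \<Rightarrow> ('a \<Rightarrow> 'a \<Rightarrow> bool) \<Rightarrow> 'a set set \<Rightarrow> 'a set set set" where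
  "roller_closure V E B = {\<xi>. \<xi> \<subseteq> B \<and> (\<forall>F. finite F \<and> F \<subseteq> B \<longrightarrow> (\<exists>v\<in>V. Uv V E v \<inter> F = \<xi> \<inter> F))}"

definition roller_boundary :: "'a set \<Rightarrow> ('a \<Rightarrow> 'a \<Rightarrow> bool) \<Rightarrow> 'a set set \<Rightarrow> 'a set set set" where
  "roller_boundary V E B = roller_closure V E B - {Uv V E v \<inter> B | v. v \<in> V}"

definition transverse :: "'a set \<Rightarrow> 'a set \<Rightarrow> 'a set \<Rightarrow> bool" where
  "transverse V h k \<longleftrightarrow> h \<inter> k \<noteq> {} \<and> h \<inter> (V - k) \<noteq> {} \<and> (V - h) \<inter> k \<noteq> {} \<and> (V - h) \<inter> (V - k) \<noteq> {}"

definition strongly_separated :: "'a set \<Rightarrow> 'a set set \<Rightarrow> 'a set \<Rightarrow> 'a set \<Rightarrow> bool" where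
  "strongly_separated V B h k \<longleftrightarrow> \<not> (\<exists>j\<in>B. transverse V j h \<and> transverse V j k)"

text \<open>Irreducible decomposition X = X_1 x ... x X_n, encoded by the partition of the
  half-spaces H = H_1 \<union> ... \<union> H_n: half-spaces in distinct blocks are transverse, and no block
  splits further in this way.\<close>
definition irreducible_decomposition :: "'a set \<Rightarrow> ('a \<Rightarrow> 'a \<Rightarrow> bool) \<Rightarrow> 'a set set set \<Rightarrow> bool" where
  "irreducible_decomposition V E P \<longleftrightarrow>
     \<Union>P = halfspaces V E \<and> {} \<notin> P
     \<and> (\<forall>B\<in>P. \<forall>B'\<in>P. B \<noteq> B' \<longrightarrow> B \<inter> B' = {})
     \<and> (\<forall>B\<in>P. \<forall>h\<in>B. V - h \<in> B)
     \<and> (\<forall>B\<in>P. \<forall>B'\<in>P. B \<noteq> B' \<longrightarrow> (\<forall>h\<in>B. \<forall>k\<in>B'. transverse V h k))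
     \<and> (\<forall>B\<in>P. \<not> (\<exists>B1 B2. B1 \<noteq> {} \<and> B2 \<noteq> {} \<and> B1 \<union> B2 = B \<and> B1 \<inter> B2 = {}
            \<and> (\<forall>h\<in>B1. V - h \<in> B1) \<and> (\<forall>h\<in>B2. V - h \<in> B2)
            \<and> (\<forall>h\<in>B1. \<forall>k\<in>B2. transverse V h k)))"

definition factor_regular :: "'a set \<Rightarrow> ('a \<Rightarrow> 'a \<Rightarrow> bool) \<Rightarrow> 'a set set \<Rightarrow> 'a set set set" where
  "factor_regular V E B = {\<eta> \<in> roller_boundary V E B. \<forall>h1\<in>\<eta>. \<forall>h2\<in>\<eta>. \<exists>k\<in>\<eta>.
       k \<subseteq> h1 \<inter> h2 \<and> strongly_separated V B k h1 \<and> strongly_separated V B k h2}"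

text \<open>\<partial>_r X = \<partial>_r X_1 x ... x \<partial>_r X_n, via the identification of \<xi> with (\<xi> \<inter> H_i)_i.\<close>
definition regular_boundary :: "'a set \<Rightarrow> ('a \<Rightarrow> 'a \<Rightarrow> bool) \<Rightarrow> 'a set set set \<Rightarrow> 'a set set set" where
  "regular_boundary V E P = {\<xi> \<in> roller_boundary V E (halfspaces V E). \<forall>B\<in>P. \<xi> \<inter> B \<in> factor_regular V E B}"

definition fat_diagonal :: "'a set \<Rightarrow> ('a \<Rightarrow> 'a \<Rightarrow> bool) \<Rightarrow> 'a set set set \<Rightarrow> ('a set set \<times> 'a set set) set" where
  "fat_diagonal V E P = {(\<xi>1, \<xi>2). \<xi>1 \<in> regular_boundary V E P \<and> \<xi>2 \<in> regular_boundary V E P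
       \<and> (\<exists>B\<in>P. \<xi>1 \<inter> B = \<xi>2 \<inter> B)}"

text \<open>Borel sigma-algebra on \<partial>X for the (subspace) product topology of 2^H; since H is
  countable it is generated by the cylinder sets {\<xi>. h \<in> \<xi>}.\<close>
definition boundary_measurable :: "'a set \<Rightarrow> ('a \<Rightarrow> 'a \<Rightarrow> bool) \<Rightarrow> 'a set set measure" where
  "boundary_measurable V E = sigma (roller_boundary V E (halfspaces V E))
      {{\<xi> \<in> roller_boundary V E (halfspaces V E). h \<in> \<xi>} | h. h \<in> halfspaces V E}"

definition top_borel :: "'m topology \<Rightarrow> 'm measure" where
  "top_borel T = sigma (topspace T) {U. openin T U}"

definition quasi_invariant :: "('g, 'b) monoid_scheme \<Rightarrow> ('g \<Rightarrow> 'x \<Rightarrow> 'x) \<Rightarrow> 'x measure \<Rightarrow> bool" where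
  "quasi_invariant G \<alpha> \<mu> \<longleftrightarrow> (\<forall>g\<in>carrier G. \<forall>A\<in>sets \<mu>. emeasure \<mu> A > 0 \<longrightarrow> emeasure \<mu> (\<alpha> g ` A) > 0)"

text \<open>Isometric ergodicity.  Every separable metric space has cardinality at most that of the
  continuum, hence is isometric to one whose carrier is a subset of the reals; so quantifying over
  metric spaces (M,d) with M :: real set loses no generality.\<close>
definition isometrically_ergodic :: "('g, 'b) monoid_scheme \<Rightarrow> ('g \<Rightarrow> 'x \<Rightarrow> 'x) \<Rightarrow> 'x measure \<Rightarrow> bool" where
  "isometrically_ergodic G \<alpha> \<nu> \<longleftrightarrow>
     (\<forall>(M::real set) d (\<psi>::'g \<Rightarrow> real \<Rightarrow> real) f.
        Metric_space M d \<and> separable_space (Metric_space.mtopology M d)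
        \<and> group_action G M \<psi> \<and> (\<forall>g\<in>carrier G. \<forall>x\<in>M. \<forall>y\<in>M. d (\<psi> g x) (\<psi> g y) = d x y)
        \<and> f \<in> \<nu> \<rightarrow>\<^sub>M top_borel (Metric_space.mtopology M d)
        \<and> (\<forall>g\<in>carrier G. AE z in \<nu>. f (\<alpha> g z) = \<psi> g (f z))
      \<longrightarrow> (\<exists>c\<in>M. AE z in \<nu>. f z = c))"

end

theory Submission
  imports Defs
begin

text \<open>
  If some half-space had measure \<open>0\<close> for one of the two measures, or could not be flipped into its complement,
  there would be an invariant filter of pairwise intersecting half-spaces. Essentiality yields a group
  element skewering a member of the filter, and the half-spaces crossed along a suitably minimal axis form
  a corridor of bounded width inside the filter. A geodesic ray runs along the corridor, by compactness, and rays
  along corridors that agree up to finitely many half-spaces are asymptotic. Corridors in the filter which do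
  not agree are almost disjoint and their half-spaces are eventually transverse, so the dimension bounds
  their number and the ray has a finite orbit at infinity: a contradiction to nonelementarity.

  Hence all half-spaces have positive measure and can be flipped. As in the work of Caprace and Sageev, flips give double
  skewering and, in each irreducible factor, nested triples of strongly separated half-spaces. By ergodicity
  such triples separate almost every pair \<open>(\<eta>, \<xi>)\<close> in every factor. The minimal middle half-spaces of
  the triples of bounded gap separating \<open>\<eta>\<close> from \<open>\<xi>\<close> form a finite set depending equivariantly on the pair;
  it is almost surely constant, hence empty. So the triples descend to \<open>\<xi>\<close>, which makes \<open>\<xi>\<close> regular.
\<close>

section \<open>Median graphs\<close>

text \<open>Distances in the complex are controlled by two combinatorial estimates:
  \<open>dc\<close> is at most the number of half-spaces at which two points differ, and at least
  the total change of the coordinates along a nested family. The complex may be locally infinite, so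
  limits of geodesics need not exist. Corridors are shaped to repair this: setting the coordinates
  outside a corridor to those of \<open>v\<close> does not increase distances, and it lands in a set
  whose bounded parts involve only finitely many half-spaces. Isometric ergodicity is applied to
  countable targets with the discrete metric, namely sets of factors, which the group may permute,
  and finite sets of half-spaces. The triples have three members because the descent controls the
  outer two: once the middle one lies in a given half-space \<open>j\<close> of
  \<open>\<xi>\<close>, the inner one is strongly separated from \<open>j\<close>. The bound on the
  gap is needed because a descending sequence of middle half-spaces would otherwise leave the outer
  ones uncontrolled.\<close>

locale median_complex =
  fixes V :: "'a set" and E :: "'a \<Rightarrow> 'a \<Rightarrow> bool"
  assumes median: "median_graph V E"
begin

abbreviation "H \<equiv> halfspaces V E"
abbreviation "d \<equiv> gdist V E"

lemma edge_props: "E x y \<Longrightarrow> x \<in> V \<and> y \<in> V \<and> E y x \<and> x \<noteq> y"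
  using median unfolding median_graph_def by blast

lemma walk_0: "walk V E 0 x y \<longleftrightarrow> x = y \<and> x \<in> V"
  unfolding walk_def by auto

lemma walk_Suc: "walk V E (Suc n) x y \<longleftrightarrow> (\<exists>z. walk V E n x z \<and> E z y)"
proof
  assume "walk V E (Suc n) x y"
  then obtain f where f: "f 0 = x" "f (Suc n) = y" "\<forall>i\<le>Suc n. f i \<in> V" "\<forall>i<Suc n. E (f i) (f (Suc i))"
    unfolding walk_def by auto
  then have "walk V E n x (f n)" "E (f n) y" unfolding walk_def by (auto intro!: exI[of _ f])
  then show "\<exists>z. walk V E n x z \<and> E z y" by blast
next
  assume "\<exists>z. walk V E n x z \<and> E z y"
  then obtain z f where f: "f 0 = x" "f n = z" "\<forall>i\<le>n. f i \<in> V" "\<forall>i<n. E (f i) (f (Suc i))" and e: "E z y"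
    unfolding walk_def by blast
  have "y \<in> V" using edge_props e by blast
  let ?f = "f(Suc n := y)"
  have "?f 0 = x \<and> ?f (Suc n) = y \<and> (\<forall>i\<le>Suc n. ?f i \<in> V) \<and> (\<forall>i<Suc n. E (?f i) (?f (Suc i)))"
    using f e \<open>y \<in> V\<close> by (auto simp: less_Suc_eq le_Suc_eq)
  then show "walk V E (Suc n) x y" unfolding walk_def by blast
qed

lemma walk_append: "walk V E n x y \<Longrightarrow> walk V E m y z \<Longrightarrow> walk V E (n + m) x z"
  by (induction m arbitrary: z) (auto simp: walk_0 walk_Suc)

lemma walk_sym: "walk V E n x y \<Longrightarrow> walk V E n y x"
proof (induction n arbitrary: y)
  case 0 then show ?case by (auto simp: walk_0)
next
  case (Suc n)
  then obtain z where z: "walk V E n x z" "E z y" by (auto simp: walk_Suc)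
  have "walk V E (Suc 0) y z" using edge_props[OF z(2)] by (simp add: walk_Suc walk_0)
  from walk_append[OF this Suc.IH[OF z(1)]] show ?case by simp
qed

lemma ex_walk: "x \<in> V \<Longrightarrow> y \<in> V \<Longrightarrow> \<exists>n. walk V E n x y"
  using median unfolding median_graph_def by blast

lemma walk_gdist: "x \<in> V \<Longrightarrow> y \<in> V \<Longrightarrow> walk V E (d x y) x y"
  unfolding gdist_def using ex_walk by (meson LeastI)

lemma gdist_le: "walk V E n x y \<Longrightarrow> d x y \<le> n"
  unfolding gdist_def by (rule Least_le)

lemma gdist_sym: "x \<in> V \<Longrightarrow> y \<in> V \<Longrightarrow> d x y = d y x"
  by (meson antisym gdist_le walk_gdist walk_sym)

lemma gdist_triangle: "x \<in> V \<Longrightarrow> y \<in> V \<Longrightarrow> z \<in> V \<Longrightarrow> d x z \<le> d x y + d y z"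
  by (meson gdist_le walk_gdist walk_append)

lemma gdist_0: "x \<in> V \<Longrightarrow> y \<in> V \<Longrightarrow> d x y = 0 \<longleftrightarrow> x = y"
  using walk_gdist[of x y] gdist_le[of 0 x y] by (auto simp: walk_0)

lemma gdist_edge: "E x y \<Longrightarrow> d x y = 1"
proof -
  assume e: "E x y"
  then have "x \<in> V" "y \<in> V" "x \<noteq> y" using edge_props by auto
  moreover have "walk V E (Suc 0) x y" using e \<open>x \<in> V\<close> by (simp add: walk_Suc walk_0)
  ultimately show ?thesis using gdist_le[of "Suc 0" x y] gdist_0[of x y] by auto
qed

lemma interval_iff: "z \<in> interval V E x y \<longleftrightarrow> z \<in> V \<and> d x z + d z y = d x y"
  unfolding interval_def by simp

lemma ex_median:
  assumes "x \<in> V" "y \<in> V" "z \<in> V"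
  obtains m where "m \<in> interval V E x y" "m \<in> interval V E y z" "m \<in> interval V E x z"
proof -
  have "\<exists>!m. m \<in> interval V E x y \<inter> interval V E y z \<inter> interval V E x z"
    using median assms unfolding median_graph_def by blast
  then show ?thesis using that by blast
qed

text \<open>The median of \<open>x\<close>, \<open>y\<close>, \<open>z\<close> lies on the edge,
  hence is one of its ends, and that end is strictly nearer to \<open>z\<close>. This is why median
  graphs are bipartite.\<close>

lemma gdist_edge_neq:
  assumes "E x y" "z \<in> V" shows "d z x \<noteq> d z y"
proof
  assume eq: "d z x = d z y"
  have V: "x \<in> V" "y \<in> V" "x \<noteq> y" and xy: "d x y = 1" using edge_props gdist_edge assms by auto
  obtain m where m: "m \<in> interval V E x y" "m \<in> interval V E y z" "m \<in> interval V E x z"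
    using ex_median V assms by metis
  have "m \<in> V" "d x m = 0 \<or> d m y = 0" using m(1) xy by (auto simp: interval_iff)
  then have "m = x \<or> m = y" using gdist_0 V by auto
  then show False using m(2,3) xy eq V assms gdist_sym[of y x] gdist_sym[of z x] gdist_sym[of z y] 
    by (auto simp: interval_iff)
qed

section \<open>Half-spaces and the edges crossing them\<close>

lemma H_iff: "h \<in> H \<longleftrightarrow> h \<noteq> {} \<and> h \<subset> V \<and> gconvex V E h \<and> gconvex V E (V - h)"
  unfolding halfspaces_def by blast

lemma H_sub: "h \<in> H \<Longrightarrow> h \<subseteq> V" by (auto simp: H_iff)

lemma H_compl [simp]: "h \<in> H \<Longrightarrow> V - h \<in> H"
  unfolding H_iff by (auto simp: double_diff)

lemma H_dcompl [simp]: "h \<in> H \<Longrightarrow> V - (V - h) = h"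
  using H_sub by blast

lemma H_ne: "h \<in> H \<Longrightarrow> \<exists>v. v \<in> h \<and> v \<in> V" by (auto simp: H_iff)

lemma H_co_ne: "h \<in> H \<Longrightarrow> \<exists>v. v \<notin> h \<and> v \<in> V" by (auto simp: H_iff)

lemma H_compl_neq [simp]: "h \<in> H \<Longrightarrow> V - h \<noteq> h" "h \<in> H \<Longrightarrow> h \<noteq> V - h" using H_ne by blast+

lemma H_interval: "h \<in> H \<Longrightarrow> x \<in> h \<Longrightarrow> y \<in> h \<Longrightarrow> z \<in> interval V E x y \<Longrightarrow> z \<in> h"
  unfolding H_iff gconvex_def by blast

lemma H_interval_co:
  assumes "h \<in> H" "x \<in> V" "x \<notin> h" "y \<in> V" "y \<notin> h" "z \<in> interval V E x y" shows "z \<notin> h"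
  using H_interval[OF H_compl[OF assms(1)], of x y z] assms by blast

text \<open>Such a half-space consists of the vertices nearer to \<open>x\<close> than to
  \<open>y\<close>: if some \<open>z\<close> in \<open>h\<close> were nearer to \<open>y\<close>,
  then \<open>y\<close> would lie on a geodesic from \<open>z\<close> to \<open>x\<close>, inside
  the convex set \<open>h\<close>. So the edge determines it.\<close>

lemma edge_unique_halfspace:
  assumes e: "E x y" and h: "h \<in> H" "x \<in> h" "y \<notin> h" and k: "k \<in> H" "x \<in> k" "y \<notin> k"
  shows "h = k"
proof -
  have *: "h \<subseteq> k" if h: "h \<in> H" "x \<in> h" "y \<notin> h" and k: "k \<in> H" "x \<in> k" "y \<notin> k" for h k
  proof
    fix z assume z: "z \<in> h"
    have V: "x \<in> V" "y \<in> V" "z \<in> V" and xy: "d x y = 1" "d y x = 1" 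
      using edge_props gdist_edge e z H_sub h by auto blast
    have ne: "d z x \<noteq> d z y" using gdist_edge_neq e V by blast
    have a: "d z x \<le> d z y + 1" "d z y \<le> d z x + 1"
      using gdist_triangle[of z y x] gdist_triangle[of z x y] V xy by auto
    show "z \<in> k"
    proof (rule ccontr)
      assume nz: "z \<notin> k"
      show False
      proof (cases "d z y < d z x")
        case True
        then have "y \<in> interval V E z x" using a xy V by (auto simp: interval_iff)
        then show False using H_interval[OF h(1) z h(2)] h by blast
      next
        case False
        then have "x \<in> interval V E z y" using a ne xy V by (auto simp: interval_iff)
        then show False using H_interval_co[OF k(1) V(3) nz V(2)] k by blast
      qed
    qed
  qed
  show ?thesis using *[OF h k] *[OF k h] by blast
qed

text \<open>Each edge of a walk from \<open>x\<close> to \<open>y\<close> leaves at most one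
  half-space.\<close>

lemma finite_sep:
  assumes "x \<in> V" "y \<in> V" shows "finite {h \<in> H. x \<in> h \<and> y \<notin> h}"
proof -
  have "finite {h \<in> H. x \<in> h \<and> y \<notin> h}" if "walk V E n x y" for n y
    using that
  proof (induction n arbitrary: y)
    case 0
    then have "{h \<in> H. x \<in> h \<and> y \<notin> h} = {}" by (auto simp: walk_0)
    then show ?case by (metis finite.emptyI)
  next
    case (Suc n)
    then obtain z where z: "walk V E n x z" "E z y" by (auto simp: walk_Suc)
    have "finite {h \<in> H. z \<in> h \<and> y \<notin> h}"
    proof (cases "{h \<in> H. z \<in> h \<and> y \<notin> h} = {}")
      case False
      then obtain k where "k \<in> H" "z \<in> k" "y \<notin> k" by blast
      then have "{h \<in> H. z \<in> h \<and> y \<notin> h} \<subseteq> {k}" using edge_unique_halfspace[OF z(2)] by blast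
      then show ?thesis by (meson finite.simps finite_subset)
    qed (metis finite.emptyI)
    moreover have "{h \<in> H. x \<in> h \<and> y \<notin> h} \<subseteq> {h \<in> H. x \<in> h \<and> z \<notin> h} \<union> {h \<in> H. z \<in> h \<and> y \<notin> h}" by blast
    ultimately show ?case using Suc.IH[OF z(1)] by (meson finite_UnI finite_subset)
  qed
  then show ?thesis using ex_walk assms by blast
qed

lemma finite_between:
  assumes "k \<in> H" "h \<in> H" shows "finite {j \<in> H. k \<subseteq> j \<and> j \<subseteq> h}"
proof -
  obtain x y where "x \<in> k" "x \<in> V" "y \<notin> h" "y \<in> V" using H_ne H_co_ne assms by meson
  then show ?thesis using finite_sep[of x y] by (auto elim!: rev_finite_subset)
qed

lemma crossing_edge:
  assumes "h \<in> H" shows "\<exists>x y. E x y \<and> x \<in> h \<and> y \<notin> h"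
proof -
  obtain x y where xy: "x \<in> h" "x \<in> V" "y \<notin> h" "y \<in> V" using H_ne H_co_ne assms by meson
  obtain n where "walk V E n x y" using ex_walk xy by blast
  then show ?thesis using xy(3)
  proof (induction n arbitrary: y)
    case 0 then show ?case using xy by (auto simp: walk_0)
  next
    case (Suc n)
    then show ?case by (metis walk_Suc)
  qed
qed

text \<open>Any edge crossing a half-space, read from inside to outside, determines it, so
  half-spaces inject into \<open>V \<times> V\<close>.\<close>

lemma countable_H:
  assumes "countable V" shows "countable H"
proof -
  define f where "f h = (SOME e. E (fst e) (snd e) \<and> fst e \<in> h \<and> snd e \<notin> h)" for h
  have f: "E (fst (f h)) (snd (f h)) \<and> fst (f h) \<in> h \<and> snd (f h) \<notin> h" if "h \<in> H" for h
    unfolding f_def by (rule someI_ex) (use crossing_edge[OF that] in auto)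
  have "inj_on f H"
  proof (rule inj_onI)
    fix h k assume "h \<in> H" "k \<in> H" "f h = f k"
    then show "h = k" using f[of h] f[of k] edge_unique_halfspace by metis
  qed
  moreover have "f ` H \<subseteq> V \<times> V" 
  proof (rule image_subsetI)
    fix h assume "h \<in> H"
    then have "fst (f h) \<in> V \<and> snd (f h) \<in> V" using f[of h] edge_props[of "fst (f h)" "snd (f h)"] by blast
    then show "f h \<in> V \<times> V" by (simp add: mem_Times_iff)
  qed
  then have "countable (f ` H)" using assms by (meson countable_SIGMA countable_subset)
  ultimately show ?thesis using countable_image_inj_on by blast
qed

section \<open>The Helly property and gates of finite intersections\<close>

lemma gconvex_inter3:
  assumes "gconvex V E A" "gconvex V E B" "gconvex V E C" "A \<inter> B \<noteq> {}" "B \<inter> C \<noteq> {}" "A \<inter> C \<noteq> {}"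
  shows "A \<inter> B \<inter> C \<noteq> {}"
proof -
  obtain x y z where xyz: "x \<in> A \<inter> B" "y \<in> B \<inter> C" "z \<in> A \<inter> C" using assms by blast
  then have "x \<in> V" "y \<in> V" "z \<in> V" using assms unfolding gconvex_def by blast+
  then obtain m where "m \<in> interval V E x y" "m \<in> interval V E y z" "m \<in> interval V E x z"
    using ex_median by metis
  then have "m \<in> A \<inter> B \<inter> C" using xyz assms unfolding gconvex_def by blast
  then show ?thesis by blast
qed

lemma gconvex_Int: "gconvex V E A \<Longrightarrow> gconvex V E B \<Longrightarrow> gconvex V E (A \<inter> B)"
  unfolding gconvex_def by blast

text \<open>Intersect every set with the newly added one: by the case of three sets these
  intersections still meet pairwise.\<close>

lemma helly:
  assumes "finite I" "\<forall>i\<in>I. gconvex V E (A i)" "\<forall>i\<in>I. \<forall>j\<in>I. A i \<inter> A j \<noteq> {}"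
  shows "\<exists>x\<in>V. \<forall>i\<in>I. x \<in> A i"
  using assms
proof (induction I arbitrary: A)
  case empty
  then show ?case using median unfolding median_graph_def by blast
next
  case (insert i I)
  show ?case
  proof (cases "I = {}")
    case True
    have "A i \<noteq> {}" "A i \<subseteq> V" using insert.prems unfolding gconvex_def by auto
    then show ?thesis using True by auto
  next
    case False
    have c: "\<forall>j\<in>I. gconvex V E (A j \<inter> A i)" using insert.prems gconvex_Int by simp
    have "\<forall>j\<in>I. \<forall>l\<in>I. (A j \<inter> A i) \<inter> (A l \<inter> A i) \<noteq> {}"
    proof (intro ballI)
      fix j l assume jl: "j \<in> I" "l \<in> I"
      have "A j \<inter> A l \<inter> A i \<noteq> {}" by (rule gconvex_inter3) (use jl insert.prems in auto)
      then show "(A j \<inter> A i) \<inter> (A l \<inter> A i) \<noteq> {}" by blast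
    qed
    from insert.IH[OF c this] obtain x where "x \<in> V" "\<forall>j\<in>I. x \<in> A j \<inter> A i" by blast
    then show ?thesis using False by auto
  qed
qed

lemma halfspace_convex: "h \<in> H \<Longrightarrow> gconvex V E h" by (simp add: H_iff)

text \<open>\<open>u\<close> is a point of the intersection of \<open>T\<close> nearest to
  \<open>v\<close>. If \<open>j\<close> separated it from \<open>v\<close> and contained no member
  of \<open>T\<close>, Helly would give a point \<open>u'\<close> of the intersection outside
  \<open>j\<close>; the median of \<open>u\<close>, \<open>u'\<close>, \<open>v\<close> would stay
  in the intersection, leave \<open>j\<close> and be nearer to \<open>v\<close>.\<close>

lemma gate:
  assumes T: "finite T" "T \<subseteq> H" "\<forall>s\<in>T. \<forall>t\<in>T. s \<inter> t \<noteq> {}" and v: "v \<in> V"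
  obtains u where "u \<in> V" "\<forall>t\<in>T. u \<in> t" "\<And>j. j \<in> H \<Longrightarrow> u \<in> j \<Longrightarrow> v \<notin> j \<Longrightarrow> \<exists>t\<in>T. t \<subseteq> j"
proof -
  let ?C = "\<lambda>u. u \<in> V \<and> (\<forall>t\<in>T. u \<in> t)"
  have "\<exists>x\<in>V. \<forall>t\<in>T. x \<in> t" 
    by (rule helly) (use T halfspace_convex in auto)
  then obtain x where "?C x" by blast
  from ex_has_least_nat[of ?C, OF this, of "d v"]
  obtain u where u: "?C u" and least: "\<And>y. ?C y \<Longrightarrow> d v u \<le> d v y" by blast
  have "\<exists>t\<in>T. t \<subseteq> j" if j: "j \<in> H" "u \<in> j" "v \<notin> j" for j
  proof (rule ccontr)
    assume n: "\<not> (\<exists>t\<in>T. t \<subseteq> j)"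
    have "\<exists>x\<in>V. \<forall>i\<in>insert (V - j) T. x \<in> i"
    proof (rule helly)
      show "\<forall>i\<in>insert (V - j) T. gconvex V E i" 
        using halfspace_convex[OF H_compl[OF j(1)]] halfspace_convex T(2) by auto
      have "(V - j) \<inter> t \<noteq> {}" if "t \<in> T" for t
      proof -
        have "t \<subseteq> V" "\<not> t \<subseteq> j" using n that T(2) H_sub[of t] by auto
        then show ?thesis by blast
      qed
      then show "\<forall>i\<in>insert (V - j) T. \<forall>k\<in>insert (V - j) T. i \<inter> k \<noteq> {}"
        using T j v by (auto simp: Int_commute)
    qed (use T in auto)
    then obtain u' where u': "u' \<in> V" "u' \<notin> j" "\<forall>t\<in>T. u' \<in> t" by auto
    obtain m where m: "m \<in> interval V E u u'" "m \<in> interval V E u' v" "m \<in> interval V E u v"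
      using ex_median u u' v by metis
    have "m \<in> t" if "t \<in> T" for t using H_interval[of t u u' m] that T(2) u u' m(1) by blast
    then have "?C m" using m(1) by (simp add: interval_iff)
    have "m \<notin> j" using H_interval_co[OF j(1) u'(1,2) v j(3) m(2)] .
    then have "m \<noteq> u" using j by blast
    then have "d u m > 0" using gdist_0 u \<open>?C m\<close> by auto
    moreover have "d u m + d m v = d u v" using m(3) by (simp add: interval_iff)
    moreover have "d u v = d v u" "d m v = d v m" using gdist_sym u v \<open>?C m\<close> by auto
    ultimately have "d v m < d v u" by linarith
    then show False using least[OF \<open>?C m\<close>] by simp
  qed
  then show ?thesis using that u by blast
qed

text \<open>Sageev's description of vertices as consistent choices of sides. The vertex is the gate
  of \<open>v\<close> in the intersection of the finitely many members of \<open>R\<close> missing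
  \<open>v\<close>; any half-space crossed on the way contains one of these, so consistency puts it
  into \<open>R\<close>.\<close>

lemma orientation_vertex:
  assumes R: "R \<subseteq> H" "\<And>h. h \<in> H \<Longrightarrow> h \<in> R \<longleftrightarrow> V - h \<notin> R" 
    "\<And>h k. h \<in> R \<Longrightarrow> k \<in> R \<Longrightarrow> h \<inter> k \<noteq> {}"
    and v: "v \<in> V" "finite {h \<in> R. v \<notin> h}"
  obtains u where "u \<in> V" "R = Uv V E u"
proof -
  let ?A = "{h \<in> R. v \<notin> h}"
  obtain u where u: "u \<in> V" "\<forall>t\<in>?A. u \<in> t" and g: "\<And>j. j \<in> H \<Longrightarrow> u \<in> j \<Longrightarrow> v \<notin> j \<Longrightarrow> \<exists>t\<in>?A. t \<subseteq> j"
    using gate[of ?A v] R v by blast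
  have up: "j \<in> R" if "j \<in> H" "u \<in> j" "v \<notin> j" for j
  proof (rule ccontr)
    assume "j \<notin> R"
    then have "V - j \<in> R" using R(2)[of j] that by blast
    moreover have "\<exists>t\<in>?A. t \<subseteq> j" using g that by simp
    ultimately show False using R(3)[of _ "V - j"] by blast
  qed
  have "h \<in> R \<longleftrightarrow> u \<in> h" if h: "h \<in> H" for h
  proof (cases "v \<in> h")
    case False
    then show ?thesis using up h u by blast
  next
    case True
    have "u \<in> V - h" if "V - h \<in> R" 
    proof -
      have "V - h \<in> {h \<in> R. v \<notin> h}" using that True by simp
      then show ?thesis by (rule bspec[OF u(2)])
    qed
    moreover have "V - h \<in> R" if "u \<in> V - h" using up[OF H_compl[OF h] that] True by simp
    ultimately show ?thesis using R(2)[OF h] u(1) by blast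
  qed
  then have "R = Uv V E u" using R(1) unfolding Uv_def by blast
  then show ?thesis using that u by blast
qed

end

section \<open>Transverse half-spaces and the dimension bound\<close>

lemma transverse_sym: "transverse V h k \<longleftrightarrow> transverse V k h"
  unfolding transverse_def by (auto simp: Int_commute)

lemma transverse_compl: 
  "h \<subseteq> V \<Longrightarrow> transverse V (V - h) k \<longleftrightarrow> transverse V h k"
  "k \<subseteq> V \<Longrightarrow> transverse V h (V - k) \<longleftrightarrow> transverse V h k"
  unfolding transverse_def by (auto simp: double_diff)

lemma transverse_mono:
  assumes "transverse V j h" "transverse V j k" "h \<subseteq> x" "x \<subseteq> k"
  shows "transverse V j x"
  using assms unfolding transverse_def by blast

lemma transverse_not_sub:
  "transverse V h k \<Longrightarrow> \<not> h \<subseteq> k" "transverse V h k \<Longrightarrow> \<not> k \<subseteq> h" "transverse V h k \<Longrightarrow> h \<inter> k \<noteq> {}"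
  "transverse V h k \<Longrightarrow> h \<noteq> k" "transverse V h k \<Longrightarrow> h \<noteq> V - k" "transverse V h k \<Longrightarrow> k \<noteq> V - h"
  unfolding transverse_def by blast+

lemma transverseI:
  assumes "h \<subseteq> V" "k \<subseteq> V" "h \<inter> k \<noteq> {}" "\<not> h \<subseteq> k" "\<not> k \<subseteq> h" "v \<in> V" "v \<notin> h" "v \<notin> k"
  shows "transverse V h k"
  using assms unfolding transverse_def by blast

locale fin_dim_complex = median_complex +
  assumes fin_dim: "finite_dimensional V E"
begin

definition "D = (SOME N::nat. \<forall>v W. is_cube V E v W \<longrightarrow> card W \<le> 2 * N)"

lemma D: "is_cube V E v W \<Longrightarrow> card W \<le> 2 * D"
proof -
  have "\<forall>v W. is_cube V E v W \<longrightarrow> card W \<le> 2 * D" unfolding D_def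
    by (rule someI_ex) (use fin_dim finite_dimensional_def in blast)
  then show "is_cube V E v W \<Longrightarrow> card W \<le> 2 * D" by blast
qed

definition "transverse_family T \<longleftrightarrow> T \<subseteq> H \<and> (\<forall>h\<in>T. \<forall>k\<in>T. h \<noteq> k \<longrightarrow> transverse V h k)"

text \<open>The vertices of two opposite corners of the intersection at minimal distance span a cube
  whose hyperplanes are exactly those of the given family.\<close>

lemma card_transverse_family:
  assumes T: "transverse_family T" "finite T" shows "card T \<le> D"
proof -
  have TH: "T \<subseteq> H" and tr: "\<And>h k. h \<in> T \<Longrightarrow> k \<in> T \<Longrightarrow> h \<noteq> k \<Longrightarrow> transverse V h k" 
    using T unfolding transverse_family_def by auto
  let ?T' = "(\<lambda>h. V - h) ` T"
  have T': "finite ?T'" "?T' \<subseteq> H" using T TH by auto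
  have tr': "s \<inter> t \<noteq> {}" if "s \<in> T \<union> ?T'" "t \<in> T \<union> ?T'" "s \<noteq> V - t" for s t
  proof -
    have "\<exists>a. a \<in> T \<and> (s = a \<or> s = V - a)" "\<exists>b. b \<in> T \<and> (t = b \<or> t = V - b)" 
      using that by auto
    then obtain a b where a: "a \<in> T" "s = a \<or> s = V - a" and b: "b \<in> T" "t = b \<or> t = V - b" by blast
    show ?thesis
    proof (cases "a = b")
      case True
      then have "s = t" using that(3) a(2) b(2) H_dcompl[OF subsetD[OF TH a(1)]] by metis
      then show ?thesis using that T' TH H_ne[of t] by blast
    next
      case False
      then show ?thesis using tr[OF a(1) b(1)] a b unfolding transverse_def by blast
    qed
  qed
  obtain v0 where v0: "v0 \<in> V" using median unfolding median_graph_def by blast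
  have pwT: "\<forall>s\<in>T. \<forall>t\<in>T. s \<inter> t \<noteq> {}"
  proof (intro ballI)
    fix s t assume st: "s \<in> T" "t \<in> T"
    have "s \<noteq> V - t" using tr[of s t] st transverse_not_sub(5)[of V s t] TH H_compl_neq(2)[of t] by auto
    then show "s \<inter> t \<noteq> {}" using tr'[of s t] st by simp
  qed
  have pwT': "\<forall>s\<in>?T'. \<forall>t\<in>?T'. s \<inter> t \<noteq> {}"
  proof (intro ballI)
    fix s t assume st: "s \<in> ?T'" "t \<in> ?T'"
    then obtain a b where ab: "a \<in> T" "b \<in> T" "s = V - a" "t = V - b" by blast
    show "s \<inter> t \<noteq> {}" 
      using tr'[of s t] st ab tr[of a b] transverse_not_sub(5)[of V a b] TH 
      by (metis H_compl H_compl_neq(1) H_dcompl UnCI subsetD)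
  qed
  \<comment> \<open>\<open>z\<close> lies in the corner opposite to that of \<open>T\<close>;
    \<open>v\<close> is its gate in the corner of \<open>T\<close>, and \<open>u\<close> is the gate
    of \<open>v\<close> in the opposite corner. Projecting twice puts both ends of the cube at
    minimal distance.\<close>
  obtain z where z: "z \<in> V" "\<forall>t\<in>?T'. z \<in> t"
    using gate[OF T' pwT' v0] by metis
  obtain v where v: "v \<in> V" "\<forall>t\<in>T. v \<in> t" "\<And>j. j \<in> H \<Longrightarrow> v \<in> j \<Longrightarrow> z \<notin> j \<Longrightarrow> \<exists>t\<in>T. t \<subseteq> j"
    using gate[OF T(2) TH pwT z(1)] by metis
  obtain u where u: "u \<in> V" "\<forall>t\<in>?T'. u \<in> t" "\<And>j. j \<in> H \<Longrightarrow> u \<in> j \<Longrightarrow> v \<notin> j \<Longrightarrow> \<exists>t\<in>?T'. t \<subseteq> j"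
    using gate[OF T' pwT' v(1)] by metis
  \<comment> \<open>The gate property of \<open>u\<close> puts \<open>j\<close> inside some
    \<open>t\<close> in \<open>T\<close>, that of \<open>v\<close> puts it around some
    \<open>s\<close> in \<open>T\<close>; transversality forces \<open>s = t\<close>.\<close>
  have sep: "j \<in> T" if j: "j \<in> H" "v \<in> j" "u \<notin> j" for j
  proof -
    obtain t where t: "t \<in> T" "V - t \<subseteq> V - j" using u(3)[of "V - j"] j u(1) by auto
    then have jt: "j \<subseteq> t" using j H_sub by blast
    have "z \<notin> j" using jt z(2) t by blast
    then obtain s where s: "s \<in> T" "s \<subseteq> j" using v(3) j by blast
    have "s = t" using tr[OF s(1) t(1)] s jt transverse_not_sub(1) by blast
    then show ?thesis using s jt t by (metis subset_antisym)
  qed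
  let ?W = "T \<union> ?T'"
  have "is_cube V E v ?W" unfolding is_cube_def
  proof (intro conjI allI ballI impI)
    show "finite ?W" "?W \<subseteq> H" "v \<in> V" using T T' TH v(1) by simp_all
    show "V - h \<in> ?W" if hW: "h \<in> ?W" for h
    proof (cases "h \<in> T")
      case False
      then obtain a where a: "a \<in> T" "h = V - a" using hW by blast
      then show ?thesis using H_dcompl[OF subsetD[OF TH a(1)]] by simp
    qed simp
  next
    fix R assume "R \<subseteq> H \<and> (\<forall>h\<in>H - ?W. (h \<in> R) = (v \<in> h)) \<and> (\<forall>h\<in>?W. (h \<in> R) = (V - h \<notin> R))"
    then have R: "R \<subseteq> H" "\<And>h. h \<in> H \<Longrightarrow> h \<notin> ?W \<Longrightarrow> (h \<in> R) = (v \<in> h)" "\<And>h. h \<in> ?W \<Longrightarrow> (h \<in> R) = (V - h \<notin> R)"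
      by auto
    have cW: "V - h \<in> ?W \<longleftrightarrow> h \<in> ?W" if "h \<in> H" for h
    proof -
      have *: "V - k \<in> ?W" if kW: "k \<in> ?W" for k
      proof (cases "k \<in> T")
        case False
        then obtain a where a: "a \<in> T" "k = V - a" using kW by blast
        then show ?thesis using H_dcompl[OF subsetD[OF TH a(1)]] by simp
      qed simp
      show ?thesis using *[of h] *[of "V - h"] H_dcompl[OF that] by metis
    qed
    \<comment> \<open>Off the cube \<open>u\<close> and \<open>v\<close> are on the same side, so a
      side chosen there meets every half-space of \<open>?W\<close>.\<close>
    have uv: "u \<in> h" if "h \<in> H" "h \<notin> ?W" "v \<in> h" for h using sep that by blast
    obtain w where "w \<in> V" "R = Uv V E w"
    proof (rule orientation_vertex[of R v])
      show "R \<subseteq> H" by fact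
      show "h \<in> R \<longleftrightarrow> V - h \<notin> R" if "h \<in> H" for h
        using R(2)[of h] R(2)[of "V - h"] R(3)[of h] cW[OF that] that v(1) by (cases "h \<in> ?W") auto
      have "{h \<in> R. v \<notin> h} \<subseteq> ?W" using R by blast
      then show "finite {h \<in> R. v \<notin> h}" using T T' by (meson finite_UnI finite_subset)
      show "h \<inter> k \<noteq> {}" if hk: "h \<in> R" "k \<in> R" for h k
      proof -
        have mixed: "h \<inter> k \<noteq> {}" if "h \<in> ?W" "k \<notin> ?W" "k \<in> R" for h k
        proof -
          have "k \<in> H" "v \<in> k" using that R by auto
          then have "u \<in> k" using uv that by blast
          then show ?thesis using that(1) \<open>v \<in> k\<close> u(2) v(2) by (metis IntI UnE empty_iff)
        qed
        show ?thesis
        proof (cases "h \<in> ?W"; cases "k \<in> ?W")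
          assume hkW: "h \<in> ?W" "k \<in> ?W"
          have "h \<noteq> V - k" using R(3)[OF hkW(2)] hk by metis
          then show ?thesis by (rule tr'[OF hkW])
        next
          assume "h \<notin> ?W" "k \<notin> ?W"
          then have "v \<in> h" "v \<in> k" using R hk by auto
          then show ?thesis by blast
        next
          assume "h \<notin> ?W" "k \<in> ?W"
          then show ?thesis using mixed[of k h] hk(1) by (simp add: Int_commute)
        next
          assume "h \<in> ?W" "k \<notin> ?W"
          then show ?thesis using mixed[of h k] hk(2) by simp
        qed
      qed
    qed (use v in auto)
    then show "\<exists>u\<in>V. R = Uv V E u" by blast
  qed
  then have "card ?W \<le> 2 * D" by (rule D)
  moreover have "T \<inter> ?T' = {}"
  proof (rule ccontr)
    assume "T \<inter> ?T' \<noteq> {}"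
    then obtain a b where "a \<in> T" "b \<in> T" "a = V - b" by blast
    then show False using tr[of a b] transverse_not_sub(5)[of V a b] H_compl_neq(1)[of b] TH by auto
  qed
  moreover have "inj_on (\<lambda>h. V - h) T" 
    by (rule inj_on_inverseI[where g = "\<lambda>h. V - h"], rule H_dcompl, erule subsetD[OF TH])
  ultimately show ?thesis using T T' by (simp add: card_Un_disjoint card_image)
qed

lemma transverse_family_insert:
  assumes "transverse_family T" "j \<in> H" "\<And>t. t \<in> T \<Longrightarrow> transverse V t j" shows "transverse_family (insert j T)"
  unfolding transverse_family_def
proof (intro conjI ballI impI)
  show "insert j T \<subseteq> H" using assms(1,2) unfolding transverse_family_def by blast
  fix x y assume xy: "x \<in> insert j T" "y \<in> insert j T" "x \<noteq> y"
  then consider "x = j" "y \<in> T" | "y = j" "x \<in> T" | "x \<in> T" "y \<in> T" by blast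
  then show "transverse V x y"
  proof cases
    case 1
    then show ?thesis using assms(3)[of y] transverse_sym[of V x y] by simp
  next
    case 2
    then show ?thesis using assms(3)[of x] by simp
  next
    case 3
    then show ?thesis using assms(1) xy(3) unfolding transverse_family_def by simp
  qed
qed

lemma no_large_transverse_family:
  assumes "\<And>n. \<exists>T. transverse_family T \<and> finite T \<and> card T = n" shows False
  using assms[of "Suc D"] card_transverse_family by fastforce

lemma infinite_not_transverse_family:
  assumes "infinite T" shows "\<not> transverse_family T"
proof
  assume transverse_family: "transverse_family T"
  obtain T' where "T' \<subseteq> T" "finite T'" "card T' = Suc D" using infinite_arbitrarily_large[OF assms] by metis
  moreover have "transverse_family T'" using transverse_family \<open>T' \<subseteq> T\<close> unfolding transverse_family_def by (meson subset_iff)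
  ultimately show False using card_transverse_family[of T'] by simp
qed

end

section \<open>The action on half-spaces\<close>

locale cube_action = fin_dim_complex V E + group G
  for V :: "'a set" and E :: "'a \<Rightarrow> 'a \<Rightarrow> bool" and G :: "('g, 'b) monoid_scheme" (structure) +
  fixes \<phi> :: "'g \<Rightarrow> 'a \<Rightarrow> 'a"
  assumes act: "aut_action G V E \<phi>"
begin

abbreviation act_image (infixr "\<star>" 75) where "g \<star> h \<equiv> \<phi> g ` h"

lemma group_action: "group_action G V \<phi>"
  using act unfolding aut_action_def by blast

lemma act_bij: "g \<in> carrier G \<Longrightarrow> bij_betw (\<phi> g) V V"
  using group_action.bij_prop0[OF group_action] by (simp add: Bij_def)

lemma act_V: "g \<in> carrier G \<Longrightarrow> x \<in> V \<Longrightarrow> \<phi> g x \<in> V"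
  using act_bij bij_betwE by blast

lemma act_mult: "g \<in> carrier G \<Longrightarrow> k \<in> carrier G \<Longrightarrow> x \<in> V \<Longrightarrow> \<phi> (g \<otimes> k) x = \<phi> g (\<phi> k x)"
  using group_action.composition_rule[OF group_action] by blast

lemma act_one: "x \<in> V \<Longrightarrow> \<phi> \<one> x = x"
  using group_action.id_eq_one[OF group_action] by (metis restrict_apply')

lemma act_inv: "g \<in> carrier G \<Longrightarrow> x \<in> V \<Longrightarrow> \<phi> (inv g) (\<phi> g x) = x"
  by (metis act_mult act_one inv_closed l_inv)

lemma act_inv': "g \<in> carrier G \<Longrightarrow> x \<in> V \<Longrightarrow> \<phi> g (\<phi> (inv g) x) = x"
  by (metis act_mult act_one inv_closed r_inv)

lemma act_inj: "g \<in> carrier G \<Longrightarrow> inj_on (\<phi> g) V"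
  using act_bij bij_betw_def by blast

lemma image_mem: "g \<in> carrier G \<Longrightarrow> x \<in> V \<Longrightarrow> h \<subseteq> V \<Longrightarrow> \<phi> g x \<in> g \<star> h \<longleftrightarrow> x \<in> h"
  using act_inj by (meson inj_on_image_mem_iff)

lemma image_sub_V: "g \<in> carrier G \<Longrightarrow> h \<subseteq> V \<Longrightarrow> g \<star> h \<subseteq> V"
  using act_V by blast

lemma image_V: "g \<in> carrier G \<Longrightarrow> g \<star> V = V"
  using act_bij by (simp add: bij_betw_def)

lemma image_compl: "g \<in> carrier G \<Longrightarrow> h \<subseteq> V \<Longrightarrow> g \<star> (V - h) = V - g \<star> h"
  using inj_on_image_set_diff[OF act_inj, of g V h] image_V by simp

lemma image_Int: "g \<in> carrier G \<Longrightarrow> h \<subseteq> V \<Longrightarrow> k \<subseteq> V \<Longrightarrow> g \<star> (h \<inter> k) = g \<star> h \<inter> g \<star> k"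
  using inj_on_image_Int[OF act_inj] by simp

lemma image_one: "h \<subseteq> V \<Longrightarrow> \<one> \<star> h = h"
  using act_one by force

lemma image_mult: 
  assumes "g \<in> carrier G" "k \<in> carrier G" "h \<subseteq> V" shows "(g \<otimes> k) \<star> h = g \<star> k \<star> h"
proof -
  have "\<phi> (g \<otimes> k) x = \<phi> g (\<phi> k x)" if "x \<in> h" for x using act_mult assms that by blast
  then show ?thesis by (simp add: image_image)
qed

lemma image_inv: "g \<in> carrier G \<Longrightarrow> h \<subseteq> V \<Longrightarrow> inv g \<star> g \<star> h = h"
  using image_mult[of "inv g" g h] image_one by simp

lemma image_inv': "g \<in> carrier G \<Longrightarrow> h \<subseteq> V \<Longrightarrow> g \<star> inv g \<star> h = h"
  using image_mult[of g "inv g" h] image_one by simp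

lemma image_sub: "g \<in> carrier G \<Longrightarrow> h \<subseteq> V \<Longrightarrow> k \<subseteq> V \<Longrightarrow> g \<star> h \<subseteq> g \<star> k \<longleftrightarrow> h \<subseteq> k"
  using inj_on_image_subset_iff[OF act_inj] by blast

lemma image_eq: "g \<in> carrier G \<Longrightarrow> h \<subseteq> V \<Longrightarrow> k \<subseteq> V \<Longrightarrow> g \<star> h = g \<star> k \<longleftrightarrow> h = k"
  using inj_on_image_eq_iff[OF act_inj] by blast

lemma image_psub: "g \<in> carrier G \<Longrightarrow> h \<subseteq> V \<Longrightarrow> k \<subseteq> V \<Longrightarrow> g \<star> h \<subset> g \<star> k \<longleftrightarrow> h \<subset> k"
  by (simp add: psubset_eq image_sub image_eq)

lemma image_transverse:
  assumes "g \<in> carrier G" "h \<subseteq> V" "k \<subseteq> V" 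
  shows "transverse V (g \<star> h) (g \<star> k) \<longleftrightarrow> transverse V h k"
proof -
  have "g \<star> a \<inter> g \<star> b = {} \<longleftrightarrow> a \<inter> b = {}" if "a \<subseteq> V" "b \<subseteq> V" for a b
    using image_Int[OF assms(1) that] by (metis image_is_empty)
  then show ?thesis unfolding transverse_def
    using image_compl[OF assms(1), symmetric] assms(2,3) by simp
qed

lemma walk_act: "g \<in> carrier G \<Longrightarrow> walk V E n x y \<Longrightarrow> walk V E n (\<phi> g x) (\<phi> g y)"
proof (induction n arbitrary: y)
  case 0
  then show ?case using act_V by (auto simp: walk_0)
next
  case (Suc n)
  then obtain z where z: "walk V E n x z" "E z y" by (auto simp: walk_Suc)
  then have "E (\<phi> g z) (\<phi> g y)" using act Suc.prems edge_props unfolding aut_action_def by blast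
  then show ?case using Suc.IH[OF Suc.prems(1) z(1)] by (auto simp: walk_Suc)
qed

lemma gdist_act:
  assumes "g \<in> carrier G" "x \<in> V" "y \<in> V" shows "d (\<phi> g x) (\<phi> g y) = d x y"
proof (rule antisym)
  show "d (\<phi> g x) (\<phi> g y) \<le> d x y" using gdist_le walk_act walk_gdist assms by blast
  have "walk V E (d (\<phi> g x) (\<phi> g y)) (\<phi> (inv g) (\<phi> g x)) (\<phi> (inv g) (\<phi> g y))"
    using walk_act[of "inv g"] walk_gdist assms act_V by simp
  then show "d x y \<le> d (\<phi> g x) (\<phi> g y)" using gdist_le act_inv assms by simp
qed

lemma interval_act:
  assumes "g \<in> carrier G" "x \<in> V" "y \<in> V" "z \<in> interval V E (\<phi> g x) (\<phi> g y)"
  shows "\<phi> (inv g) z \<in> interval V E x y"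
proof -
  have z: "z \<in> V" "d (\<phi> g x) z + d z (\<phi> g y) = d (\<phi> g x) (\<phi> g y)" using assms(4) by (auto simp: interval_iff)
  have "d (\<phi> g x) (\<phi> g (\<phi> (inv g) z)) = d x (\<phi> (inv g) z)" "d (\<phi> g (\<phi> (inv g) z)) (\<phi> g y) = d (\<phi> (inv g) z) y"
    using gdist_act assms act_V z by auto
  then show ?thesis using z act_inv' assms gdist_act act_V by (auto simp: interval_iff)
qed

lemma gconvex_act:
  assumes "g \<in> carrier G" "gconvex V E S" shows "gconvex V E (g \<star> S)"
  unfolding gconvex_def
proof (intro conjI ballI)
  have S: "S \<subseteq> V" using assms(2) unfolding gconvex_def by blast
  show "g \<star> S \<subseteq> V" using image_sub_V assms(1) S by blast
  fix a b assume "a \<in> g \<star> S" "b \<in> g \<star> S"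
  then obtain x y where xy: "x \<in> S" "y \<in> S" "a = \<phi> g x" "b = \<phi> g y" by blast
  show "interval V E a b \<subseteq> g \<star> S"
  proof
    fix z assume z: "z \<in> interval V E a b"
    then have "\<phi> (inv g) z \<in> interval V E x y" using interval_act assms(1) xy S by blast
    then have "\<phi> (inv g) z \<in> S" using xy assms(2) unfolding gconvex_def by blast
    moreover have "z = \<phi> g (\<phi> (inv g) z)" using act_inv' assms(1) z by (simp add: interval_iff)
    ultimately show "z \<in> g \<star> S" by blast
  qed
qed

lemma H_act: 
  assumes "g \<in> carrier G" "h \<in> H" shows "g \<star> h \<in> H"
proof -
  have h: "h \<noteq> {}" "h \<subseteq> V" "V - h \<noteq> {}" "gconvex V E h" "gconvex V E (V - h)" using assms(2) by (auto simp: H_iff)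
  have "gconvex V E (g \<star> h)" "gconvex V E (V - g \<star> h)" "V - g \<star> h \<noteq> {}"
    using gconvex_act[OF assms(1)] h image_compl[OF assms(1) h(2)] by (simp, metis, metis image_is_empty)
  then show ?thesis using h image_sub_V[OF assms(1) h(2)] unfolding H_iff by blast
qed

lemma mem_image: "g \<in> carrier G \<Longrightarrow> x \<in> V \<Longrightarrow> h \<subseteq> V \<Longrightarrow> x \<in> g \<star> h \<longleftrightarrow> \<phi> (inv g) x \<in> h"
  using image_mem[of g "\<phi> (inv g) x" h] act_inv' act_V by simp

section \<open>Iterates of a half-space and skewering\<close>

abbreviation iter_image where "iter_image g n h \<equiv> (g [^] (n::nat)) \<star> h"

lemma iter_0: "h \<subseteq> V \<Longrightarrow> iter_image g 0 h = h"
  by (simp add: image_one)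

lemma iter_add: 
  "g \<in> carrier G \<Longrightarrow> h \<subseteq> V \<Longrightarrow> iter_image g m (iter_image g n h) = iter_image g (m + n) h"
  by (simp add: image_mult[symmetric] nat_pow_mult)

lemma iter_mono_start:
  assumes "g \<in> carrier G" "h \<subseteq> V" "iter_image g 1 h \<subseteq> h" "m \<le> n" 
  shows "iter_image g n h \<subseteq> iter_image g m h"
  using assms(4)
proof (induction n rule: dec_induct)
  case (step n)
  have "iter_image g (n + 1) h = iter_image g n (iter_image g 1 h)" using iter_add assms(1,2) by metis
  also have "\<dots> \<subseteq> iter_image g n h" using assms(3) by blast
  finally show ?case using step.IH by auto
qed simp

definition "skewers g h \<longleftrightarrow> g \<in> carrier G \<and> h \<in> H \<and> g \<star> h \<subset> h"

lemma skewersD: "skewers g h \<Longrightarrow> g \<in> carrier G" "skewers g h \<Longrightarrow> h \<in> H" "skewers g h \<Longrightarrow> h \<subseteq> V" "skewers g h \<Longrightarrow> g \<star> h \<subset> h"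
  using H_sub unfolding skewers_def by blast+

lemma iter_antimono: "skewers g h \<Longrightarrow> m \<le> n \<Longrightarrow> iter_image g n h \<subseteq> iter_image g m h"
proof -
  assume *: "skewers g h" "m \<le> n"
  note s = skewersD[OF *(1)]
  have "g [^] (1::nat) = g" using s by simp
  then have "iter_image g 1 h \<subseteq> h" using s(4) by (metis psubset_imp_subset)
  then show ?thesis by (rule iter_mono_start[OF s(1,3) _ *(2)])
qed

lemma iter_strict: 
  assumes "skewers g h" "m < n" shows "iter_image g n h \<subset> iter_image g m h"
proof -
  note s = skewersD[OF assms(1)]
  have "iter_image g (Suc m) h = iter_image g m (iter_image g 1 h)" using iter_add s by (metis Suc_eq_plus1)
  also have "\<dots> \<subset> iter_image g m h" using s image_psub[of "g [^] m" "g \<star> h" h] image_sub_V by simp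
  finally show ?thesis using iter_antimono[OF assms(1), of "Suc m" n] assms(2) by simp
qed

lemma iter_H: "g \<in> carrier G \<Longrightarrow> h \<in> H \<Longrightarrow> iter_image g n h \<in> H"
  by (simp add: H_act)

lemma iter_inj: "skewers g h \<Longrightarrow> inj (\<lambda>n. iter_image g n h)"
  by (rule linorder_injI) (metis iter_strict less_irrefl)

text \<open>The iterates are distinct, and if all contained \<open>v\<close> they would all separate
  \<open>v\<close> from one fixed vertex outside \<open>h\<close>.\<close>

lemma iter_escape:
  assumes "skewers g h" "v \<in> V" shows "\<exists>n. \<forall>m\<ge>n. v \<notin> iter_image g m h"
proof -
  note s = skewersD[OF assms(1)]
  obtain w where w: "w \<in> V" "w \<notin> h" using H_co_ne s by meson
  have "\<exists>n. v \<notin> iter_image g n h"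
  proof (rule ccontr)
    assume "\<not> (\<exists>n. v \<notin> iter_image g n h)"
    moreover have "iter_image g n h \<subseteq> h" for n using iter_antimono[OF assms(1), of 0 n] iter_0[OF s(3)] by simp
    ultimately have "range (\<lambda>n. iter_image g n h) \<subseteq> {j \<in> H. v \<in> j \<and> w \<notin> j}" using iter_H s w by blast
    then have "finite (range (\<lambda>n. iter_image g n h))" using finite_sep assms w by (meson finite_subset)
    then show False using iter_inj[OF assms(1)] finite_imageD by blast
  qed
  then show ?thesis using iter_antimono[OF assms(1)] by blast
qed

lemma skewers_inv:
  assumes "skewers g h" shows "skewers (inv g) (V - h)"
proof -
  note s = skewersD[OF assms]
  have "inv g \<star> g \<star> h \<subset> inv g \<star> h" using s image_psub image_sub_V by simp
  then have "h \<subset> inv g \<star> h" using image_inv s by simp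
  moreover have "inv g \<star> (V - h) = V - inv g \<star> h" using image_compl s by simp
  moreover have "inv g \<star> h \<subseteq> V" using image_sub_V s by simp
  moreover have "V - A \<subset> V - h" if "h \<subset> A" "A \<subseteq> V" for A using that by blast
  ultimately have "inv g \<star> (V - h) \<subset> V - h" by metis
  then show ?thesis using s unfolding skewers_def by simp
qed

text \<open>This is escape for the inverse element, which skewers the complement of
  \<open>h\<close>.\<close>

lemma iter_enter:
  assumes "skewers g h" "v \<in> V" shows "\<exists>n. \<phi> (g [^] (n::nat)) v \<in> h"
proof -
  note s = skewersD[OF assms(1)]
  obtain n where n: "v \<notin> iter_image (inv g) n (V - h)" using iter_escape[OF skewers_inv[OF assms(1)] assms(2)] by blast
  have "inv g [^] n = inv (g [^] n)" using s by (simp add: nat_pow_inv)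
  then have "\<phi> (g [^] n) v \<notin> V - h" using n mem_image[of "inv (g [^] n)" v "V - h"] assms(2) s by simp
  then show ?thesis using act_V s assms by auto
qed

section \<open>Invariant filters and elements skewering their members\<close>

definition "inv_filter N \<longleftrightarrow> N \<subseteq> H \<and> (\<forall>h\<in>N. \<forall>k\<in>H. h \<subseteq> k \<longrightarrow> k \<in> N)
  \<and> (\<forall>h\<in>N. \<forall>g\<in>carrier G. g \<star> h \<in> N) \<and> (\<forall>h\<in>N. \<forall>k\<in>N. h \<inter> k \<noteq> {})"

lemma inv_filterD:
  assumes "inv_filter N"
  shows "h \<in> N \<Longrightarrow> h \<in> H" "h \<in> N \<Longrightarrow> h \<subseteq> V" "h \<in> N \<Longrightarrow> k \<in> H \<Longrightarrow> h \<subseteq> k \<Longrightarrow> k \<in> N"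
    "h \<in> N \<Longrightarrow> g \<in> carrier G \<Longrightarrow> g \<star> h \<in> N" "h \<in> N \<Longrightarrow> k \<in> N \<Longrightarrow> h \<inter> k \<noteq> {}"
  using assms H_sub unfolding inv_filter_def by blast+

text \<open>Members of a filter meet, and \<open>v\<close> lies in the corner opposite to their
  intersection; so only nesting can prevent transversality.\<close>

lemma filter_transverse:
  assumes "inv_filter N" "h \<in> N" "k \<in> N" "v \<in> V" "v \<notin> h" "v \<notin> k" "\<not> h \<subseteq> k" "\<not> k \<subseteq> h"
  shows "transverse V h k"
  by (rule transverseI[OF inv_filterD(2)[OF assms(1,2)] inv_filterD(2)[OF assms(1,3)] 
        inv_filterD(5)[OF assms(1,2,3)] assms(7,8,4,5,6)])

text \<open>Deepness of the complement moves \<open>x\<close> arbitrarily far away from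
  \<open>h\<close>, so infinitely many translates of \<open>h\<close> miss \<open>x\<close>. They
  cannot all be transverse, and two nested translates give an element skewering
  \<open>h\<close>.\<close>

lemma filter_skewer:
  assumes ess: "essential G V E \<phi>" and N: "inv_filter N" and h: "h \<in> N"
  shows "\<exists>g. skewers g h"
proof -
  note Nd = inv_filterD[OF N]
  have hH: "h \<in> H" "h \<subseteq> V" using Nd h by blast+
  have "deep G V E \<phi> (V - h)" using ess hH unfolding essential_def by blast
  then obtain x where x: "x \<in> V" "\<And>n::nat. \<exists>g\<in>carrier G. \<phi> g x \<in> V - h \<and> (\<forall>w\<in>V - (V - h). d (\<phi> g x) w > n)"
    unfolding deep_def by blast
  define F where "F = {inv g \<star> h | g. g \<in> carrier G \<and> \<phi> g x \<notin> h}"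
  have FN: "k \<in> N \<and> x \<notin> k" if kF: "k \<in> F" for k
  proof -
    obtain g where g: "g \<in> carrier G" "\<phi> g x \<notin> h" "k = inv g \<star> h" using kF unfolding F_def by blast
    then show ?thesis using Nd(4)[OF h, of "inv g"] mem_image[of "inv g" x h] x hH by simp
  qed
  have "infinite F"
  proof
    assume fin: "finite F"
    \<comment> \<open>One chosen point in each member of a finite \<open>F\<close> bounds the
      distances from \<open>x\<close> to all these members.\<close>
    define p where "p k = (SOME y. y \<in> k)" for k :: "'a set"
    have p: "p k \<in> k" if "k \<in> F" for k
      unfolding p_def using FN[OF that] Nd(1) H_ne by (meson someI_ex)
    define n where "n = Max ((\<lambda>k. d x (p k)) ` F)"
    obtain g where g: "g \<in> carrier G" "\<phi> g x \<in> V - h" "\<forall>w\<in>V - (V - h). d (\<phi> g x) w > n" using x by blast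
    let ?k = "inv g \<star> h"
    have kF: "?k \<in> F" using g unfolding F_def by blast
    have pV: "p ?k \<in> V" using p[OF kF] image_sub_V[of "inv g" h] g hH by auto
    then have "\<phi> g (p ?k) \<in> h" using p[OF kF] mem_image[of "inv g" "p ?k" h] g hH by simp
    then have "d (\<phi> g x) (\<phi> g (p ?k)) > n" using g hH by blast
    moreover have "d (\<phi> g x) (\<phi> g (p ?k)) = d x (p ?k)" using gdist_act g x pV by blast
    moreover have "d x (p ?k) \<le> n" unfolding n_def using fin kF by simp
    ultimately show False by simp
  qed
  then have "\<not> transverse_family F" by (rule infinite_not_transverse_family)
  moreover have "F \<subseteq> H" using FN Nd(1) by blast
  ultimately obtain k1 k2 where k: "k1 \<in> F" "k2 \<in> F" "k1 \<noteq> k2" "\<not> transverse V k1 k2" unfolding transverse_family_def by blast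
  have "k1 \<subset> k2 \<or> k2 \<subset> k1" using filter_transverse[OF N, of k1 k2 x] FN[OF k(1)] FN[OF k(2)] k x(1) by blast
  then obtain a b where ab: "a \<in> F" "b \<in> F" "a \<subset> b" using k by blast
  obtain g1 g2 where g: "g1 \<in> carrier G" "g2 \<in> carrier G" "a = inv g1 \<star> h" "b = inv g2 \<star> h"
    using ab unfolding F_def by blast
  have "g2 \<star> a \<subset> g2 \<star> b" using ab g image_psub[of g2 a b] image_sub_V hH by simp
  then have "(g2 \<otimes> inv g1) \<star> h \<subset> h" using g image_inv' hH image_mult by simp
  then show ?thesis unfolding skewers_def using g hH by blast
qed

text \<open>A preorder that compares half-spaces at the forward end of \<open>g\<close>.\<close>

definition "enters g k i \<longleftrightarrow> (\<exists>l::nat. iter_image g l k \<subseteq> i)"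

lemma enters_trans:
  assumes "g \<in> carrier G" "k \<subseteq> V" "i \<subseteq> V" "enters g k i" "enters g i j" shows "enters g k j"
proof -
  obtain l m :: nat where lm: "iter_image g l k \<subseteq> i" "iter_image g m i \<subseteq> j" using assms unfolding enters_def by blast
  have "iter_image g (m + l) k = iter_image g m (iter_image g l k)" using iter_add assms by simp
  also have "\<dots> \<subseteq> iter_image g m i" using lm by blast
  finally show ?thesis using lm unfolding enters_def by blast
qed

text \<open>Otherwise there would be an endless sequence in which each half-space enters the next
  but not conversely. Translates of its members that miss \<open>v\<close> could be chosen pairwise
  transverse: a later one is not inside an earlier one because it does not enter it, and not around
  it because it is pushed far enough.\<close>

lemma minimal_skewered:
  assumes N: "inv_filter N" and k0: "k0 \<in> N" "skewers g k0"
  obtains k where "k \<in> N" "skewers g k" "\<And>i. i \<in> N \<Longrightarrow> skewers g i \<Longrightarrow> enters g k i \<Longrightarrow> enters g i k"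
proof (rule ccontr)
  assume nt: "\<not> thesis"
  note found = that
  have nm: "\<exists>i. i \<in> N \<and> skewers g i \<and> enters g k i \<and> \<not> enters g i k" if "k \<in> N" "skewers g k" for k
    using found[OF that] nt by blast
  note Nd = inv_filterD[OF N]
  obtain v where v: "v \<in> V" using H_ne Nd k0 by meson
  have gG: "g \<in> carrier G" using k0 skewersD by blast
  have "\<exists>T k. transverse_family T \<and> finite T \<and> card T = n \<and> k \<in> N \<and> skewers g k \<and> (\<forall>t\<in>T. t \<in> N \<and> v \<notin> t \<and> \<not> enters g k t)" for n
  proof (induction n)
    case 0
    show ?case using k0 by (intro exI[of _ "{}"] exI[of _ k0]) (auto simp: transverse_family_def)
  next
    case (Suc n)
    then obtain T k where T: "transverse_family T" "finite T" "card T = n" "k \<in> N" "skewers g k" 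
      "\<forall>t\<in>T. t \<in> N \<and> v \<notin> t \<and> \<not> enters g k t" by blast
    obtain i where i: "i \<in> N" "skewers g i" "enters g k i" "\<not> enters g i k" using nm T by blast
    have kV: "k \<subseteq> V" "i \<subseteq> V" using Nd T i by blast+
    have "\<exists>m0. \<forall>m\<ge>m0. \<not> t \<subseteq> iter_image g m k" if "t \<in> T" for t
    proof -
      have "t \<in> H" using T that Nd by blast
      then obtain y where "y \<in> t" "y \<in> V" using H_ne by blast
      then show ?thesis using iter_escape[OF T(5), of y] by blast
    qed
    then obtain f where f: "\<And>t m. t \<in> T \<Longrightarrow> m \<ge> f t \<Longrightarrow> \<not> t \<subseteq> iter_image g m k" by metis
    obtain m1 where m1: "\<And>m. m \<ge> m1 \<Longrightarrow> v \<notin> iter_image g m k" using iter_escape[OF T(5) v] by blast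
    define m where "m = m1 + sum f T"
    have fm: "f t \<le> m" if "t \<in> T" for t
      using member_le_sum[OF that, of f] T(2) unfolding m_def by simp
    let ?j = "iter_image g m k"
    have jN: "?j \<in> N" using Nd(4) T gG by simp
    have vj: "v \<notin> ?j" using m1 m_def by simp
    have tr: "transverse V t ?j" if t: "t \<in> T" for t
    proof (rule filter_transverse[OF N _ jN v _ vj])
      show "t \<in> N" "v \<notin> t" using T t by auto
      show "\<not> t \<subseteq> ?j" using f[OF t] fm[OF t] by blast
      show "\<not> ?j \<subseteq> t" using T t unfolding enters_def by blast
    qed
    have jT: "?j \<notin> T" using tr transverse_not_sub(4) by blast
    have "transverse_family (insert ?j T)" using transverse_family_insert[OF T(1) Nd(1)[OF jN]] tr by blast
    moreover have "card (insert ?j T) = Suc n" "finite (insert ?j T)" using jT T by auto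
    moreover have "t \<in> N \<and> v \<notin> t \<and> \<not> enters g i t" if t: "t \<in> insert ?j T" for t
    proof (cases "t = ?j")
      case True
      have "?j \<subseteq> k" using iter_antimono[OF T(5), of 0 m] iter_0[OF kV(1)] by simp
      then show ?thesis using jN vj i True unfolding enters_def by (meson order_trans)
    next
      case False
      then show ?thesis using t T(6) enters_trans[OF gG kV i(3)] by blast
    qed
    ultimately show ?case using i by blast
  qed
  then show False using no_large_transverse_family by metis
qed

lemma iter_mult_mono:
  assumes "g \<in> carrier G" "i \<subseteq> V" "iter_image g q i \<subseteq> i" shows "iter_image g (q * r) i \<subseteq> i"
proof (induction r)
  case (Suc r)
  have "iter_image g (q * Suc r) i = iter_image g q (iter_image g (q * r) i)" using iter_add assms by simp
  also have "\<dots> \<subseteq> iter_image g q i" using Suc by blast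
  finally show ?case using assms by blast
qed (simp add: image_one assms)

lemma iter_mult_mono':
  assumes "g \<in> carrier G" "i \<subseteq> V" "i \<subseteq> iter_image g q i" shows "i \<subseteq> iter_image g (q * r) i"
proof (induction r)
  case (Suc r)
  have "iter_image g q i \<subseteq> iter_image g q (iter_image g (q * r) i)" using Suc by blast
  also have "\<dots> = iter_image g (q * Suc r) i" using iter_add assms by simp
  finally show ?case using assms by blast
qed (simp add: image_one assms)

text \<open>By the dimension bound, two of the first \<open>D + 1\<close> translates of a half-space of the filter are nested;
  hence a suitable power of \<open>g\<close> skewers all but finitely many of the half-spaces entered by a skewered one.\<close>

lemma finitely_many_exceptions:
  assumes N: "inv_filter N" and k: "k \<in> N" "skewers g k" and g: "g = g0 [^] (fact D :: nat)" "g0 \<in> carrier G" and v: "v \<in> V"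
  shows "finite {i \<in> H. v \<notin> i \<and> enters g k i \<and> \<not> g \<star> i \<subset> i}"
proof (rule finite_subset)
  note Nd = inv_filterD[OF N] and s = skewersD[OF k(2)]
  show "finite (\<Union>m\<in>{..D}. {i \<in> H. \<phi> (inv (g0 [^] m)) v \<in> i \<and> v \<notin> i})"
    using finite_sep v g act_V by simp
  \<comment> \<open>An exceptional \<open>i\<close> must contain one of the \<open>D + 1\<close>
    points \<open>\<phi> (inv (g0 [^] m)) v\<close>; otherwise \<open>D + 1\<close> translates of
    \<open>i\<close> by powers of \<open>g0\<close> would all miss \<open>v\<close>.\<close>
  show "{i \<in> H. v \<notin> i \<and> enters g k i \<and> \<not> g \<star> i \<subset> i} \<subseteq> (\<Union>m\<in>{..D}. {i \<in> H. \<phi> (inv (g0 [^] m)) v \<in> i \<and> v \<notin> i})"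
  proof (rule ccontr)
    assume "\<not> ?thesis"
    then obtain i where i: "i \<in> H" "v \<notin> i" "enters g k i" "\<not> g \<star> i \<subset> i" 
      and out: "\<And>m. m \<le> D \<Longrightarrow> \<phi> (inv (g0 [^] m)) v \<notin> i" by blast
    have iV: "i \<subseteq> V" using i H_sub by blast
    obtain l :: nat where l: "iter_image g l k \<subseteq> i" using i unfolding enters_def by blast
    \<comment> \<open>If \<open>i\<close> grew under \<open>g\<close>, all its iterates would
      contain \<open>i\<close>. The orbit of \<open>v\<close> reaches \<open>k\<close> and then
      \<open>i\<close>; pulling back from the iterate with the same exponent would give
      \<open>v\<close> in \<open>i\<close>.\<close>
    have gi: "\<not> i \<subseteq> g \<star> i"
    proof
      assume "i \<subseteq> g \<star> i"
      then have up: "i \<subseteq> iter_image g n i" for n using iter_mult_mono'[OF s(1) iV, of 1 n] s by simp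
      obtain n :: nat where n: "\<phi> (g [^] n) v \<in> k" using iter_enter[OF k(2) v] by blast
      have "\<phi> (g [^] l) (\<phi> (g [^] n) v) \<in> i" using n l by blast
      then have "\<phi> (g [^] (l + n)) v \<in> i" using act_mult s v by (simp add: nat_pow_mult[symmetric])
      then have "\<phi> (g [^] (l + n)) v \<in> iter_image g (l + n) i" using up by blast
      then show False using image_mem v iV s i by simp
    qed
    have iN: "i \<in> N" using Nd(3)[OF _ i(1) l] Nd(4)[OF k(1)] s by simp
    let ?t = "\<lambda>m. iter_image g0 m i"
    have tN: "?t m \<in> N" for m using Nd(4)[OF iN] g by simp
    have vt: "v \<notin> ?t m" if "m \<le> D" for m using out[OF that] mem_image v g iV by simp
    have "\<exists>a b. a < b \<and> b \<le> D \<and> (?t a \<subseteq> ?t b \<or> ?t b \<subseteq> ?t a)"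
    proof (rule ccontr)
      assume n: "\<not> ?thesis"
      have tr: "transverse V (?t a) (?t b)" if ab: "a \<le> D" "b \<le> D" "a \<noteq> b" for a b
      proof -
        have "\<not> ?t a \<subseteq> ?t b \<and> \<not> ?t b \<subseteq> ?t a"
          using n ab by (cases "a < b") (blast, metis linorder_neqE_nat)
        then show ?thesis using filter_transverse[OF N tN tN v vt[OF ab(1)] vt[OF ab(2)]] by blast
      qed
      have "inj_on ?t {..D}"
        using tr transverse_not_sub(4)[of V] by (intro inj_onI) (metis atMost_iff)
      then have "card (?t ` {..D}) = Suc D" by (simp add: card_image)
      moreover have "transverse_family (?t ` {..D})" unfolding transverse_family_def
      proof (intro conjI ballI impI)
        show "?t ` {..D} \<subseteq> H" using tN Nd(1) by blast
        fix x y assume "x \<in> ?t ` {..D}" "y \<in> ?t ` {..D}" "x \<noteq> y"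
        then obtain a b where "a \<le> D" "b \<le> D" "x = ?t a" "y = ?t b" "a \<noteq> b" by blast
        then show "transverse V x y" using tr by simp
      qed
      ultimately show False using card_transverse_family[of "?t ` {..D}"] by simp
    qed
    then obtain a b where ab: "a < b" "b \<le> D" "?t a \<subseteq> ?t b \<or> ?t b \<subseteq> ?t a" by blast
    define q where "q = b - a"
    have "?t b = iter_image g0 a (?t q)" using iter_add g iV ab q_def by simp
    then have q: "i \<subseteq> ?t q \<or> ?t q \<subseteq> i" 
      using ab(3) image_sub[of "g0 [^] a" i "?t q"] image_sub[of "g0 [^] a" "?t q" i] image_sub_V g iV by auto
    \<comment> \<open>The exponent \<open>fact D\<close> is chosen for this: every possible
      \<open>q\<close> divides it, so nesting of \<open>i\<close> with its \<open>q\<close>-th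
      translate passes to \<open>g\<close>.\<close>
    have "q dvd fact D" using ab q_def by (intro dvd_fact) auto
    then obtain r where r: "fact D = q * r" by blast
    have gq: "g \<star> i = ?t (q * r)" using g r by simp
    show False
    proof (cases "i \<subseteq> ?t q")
      case True
      then show ?thesis using iter_mult_mono'[OF g(2) iV True, of r] gi gq by simp
    next
      case False
      then have "g \<star> i \<subseteq> i" using q iter_mult_mono[OF g(2) iV, of q r] gq by simp
      then show ?thesis using gi i(4) by blast
    qed
  qed
qed

section \<open>Corridors\<close>

text \<open>A corridor from \<open>v\<close> is a set of half-spaces crossed by a path from \<open>v\<close> to a point at infinity
  all of whose cross-sections are uniformly bounded.\<close>

definition "corridor v S \<longleftrightarrow> v \<in> V \<and> S \<subseteq> H \<and> infinite S \<and> (\<forall>s\<in>S. v \<notin> s)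
  \<and> (\<forall>s\<in>S. \<forall>j\<in>H. s \<subseteq> j \<longrightarrow> v \<notin> j \<longrightarrow> j \<in> S) \<and> (\<forall>s\<in>S. \<forall>t\<in>S. s \<inter> t \<noteq> {})
  \<and> (\<forall>s\<in>S. finite {j\<in>S. \<not> j \<subseteq> s}) \<and> (\<exists>C. \<forall>s\<in>S. card {j\<in>S. transverse V j s} \<le> C)"

text \<open>\<open>S\<close> consists of the half-spaces missing \<open>v\<close> that the minimal
  \<open>k\<close> enters. Apart from finitely many exceptions they are skewered by
  \<open>g\<close>, minimality makes them enter \<open>k\<close> in turn, and they are translates of
  finitely many by powers of \<open>g\<close>. This periodicity bounds the cross-sections.\<close>

lemma ex_corridor:
  assumes ess: "essential G V E \<phi>" and N: "inv_filter N" "N \<noteq> {}" and v: "v \<in> V"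
  shows "\<exists>S. corridor v S \<and> S \<subseteq> N"
proof -
  note Nd = inv_filterD[OF N(1)]
  obtain h where h: "h \<in> N" using N by blast
  obtain g0 where g0: "skewers g0 h" using filter_skewer[OF ess N(1) h] by blast
  define g where "g = g0 [^] (fact D :: nat)"
  have g0G: "g0 \<in> carrier G" and gG: "g \<in> carrier G" using skewersD[OF g0] unfolding g_def by auto
  have "iter_image g0 (fact D) h \<subset> iter_image g0 0 h" by (rule iter_strict[OF g0]) simp
  then have "skewers g h" using skewersD[OF g0] iter_0 gG unfolding skewers_def g_def by simp
  then obtain k where k: "k \<in> N" "skewers g k" and 
    min: "\<And>i. i \<in> N \<Longrightarrow> skewers g i \<Longrightarrow> enters g k i \<Longrightarrow> enters g i k"
    using minimal_skewered[OF N(1) h] by blast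
  have kV: "k \<subseteq> V" using Nd k by blast
  define S where "S = {i \<in> H. v \<notin> i \<and> enters g k i}"
  define X where "X = {i \<in> S. \<not> g \<star> i \<subset> i}"
  have "X = {i \<in> H. v \<notin> i \<and> enters g k i \<and> \<not> g \<star> i \<subset> i}" unfolding X_def S_def by blast
  then have finX: "finite X" using finitely_many_exceptions[OF N(1) k g_def g0G v] by simp
  have SN: "S \<subseteq> N"
  proof
    fix i assume "i \<in> S"
    then obtain l :: nat where "i \<in> H" "iter_image g l k \<subseteq> i" unfolding S_def enters_def by blast
    moreover have "iter_image g l k \<in> N" using Nd(4) k gG by simp
    ultimately show "i \<in> N" using Nd(3) by blast
  qed
  \<comment> \<open>A fundamental domain for \<open>g\<close>: the half-spaces that the orbit of
    \<open>v\<close> enters on its first step.\<close>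
  define R where "R = {r \<in> H. v \<notin> r \<and> \<phi> g v \<in> r \<and> skewers g r \<and> enters g k r \<and> enters g r k}"
  have finR: "finite R"
    by (rule finite_subset[OF _ finite_sep[of "\<phi> g v" v]]) (auto simp: R_def act_V gG v)
  have dec: "\<exists>n r. r \<in> R \<and> j = iter_image g n r" if j: "j \<in> S" "j \<notin> X" for j
  proof -
    have jH: "j \<in> H" "v \<notin> j" "enters g k j" "g \<star> j \<subset> j" using j unfolding S_def X_def by auto
    have jV: "j \<subseteq> V" using H_sub jH by blast
    have sk: "skewers g j" using jH gG unfolding skewers_def by blast
    have "\<exists>n. \<phi> (g [^] (n::nat)) v \<in> j" using iter_enter[OF sk v] .
    then have L: "\<phi> (g [^] (LEAST n. \<phi> (g [^] (n::nat)) v \<in> j)) v \<in> j" by (rule LeastI_ex)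
    \<comment> \<open>The first time at which the orbit of \<open>v\<close> is in \<open>j\<close>;
      translating \<open>j\<close> back by one step less brings it into \<open>R\<close>.\<close>
    define m where "m = (LEAST n. \<phi> (g [^] (n::nat)) v \<in> j)"
    have "m \<noteq> 0" using L jH act_one v unfolding m_def[symmetric] by (metis nat_pow_0)
    then obtain n where n: "m = Suc n" using not0_implies_Suc by blast
    have a: "\<phi> (g [^] n) v \<notin> j" using not_less_Least[of n "\<lambda>n. \<phi> (g [^] (n::nat)) v \<in> j"] n unfolding m_def by simp
    have b: "\<phi> (g [^] n) (\<phi> g v) \<in> j" using L act_mult[of "g [^] n" g v] gG v n unfolding m_def[symmetric] by simp
    define r where "r = inv (g [^] n) \<star> j"
    have jr: "j = iter_image g n r" unfolding r_def using image_inv' jV gG by simp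
    have rH: "r \<in> H" unfolding r_def using H_act jH gG by simp
    have rV: "r \<subseteq> V" using rH H_sub by blast
    have "v \<notin> r" "\<phi> g v \<in> r" unfolding r_def using mem_image[of "inv (g [^] n)"] gG v jV a b act_V by simp_all
    moreover have "iter_image g n (g \<star> r) \<subset> iter_image g n r"
    proof -
      have "iter_image g n (g \<star> r) = g \<star> iter_image g n r"
        using image_mult[of "g [^] n" g r] image_mult[of g "g [^] n" r] gG rV nat_pow_Suc2[of g n] by simp
      then show ?thesis using jH jr by simp
    qed
    then have "g \<star> r \<subset> r" using image_psub[of "g [^] n"] gG rV image_sub_V by simp
    then have skr: "skewers g r" using gG rH unfolding skewers_def by blast
    have "enters g j k" using min[OF _ sk] j SN jH by blast
    then obtain p :: nat where "iter_image g p j \<subseteq> k" unfolding enters_def by blast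
    then have "iter_image g (p + n) r \<subseteq> k" using jr iter_add gG rV by metis
    then have "enters g r k" unfolding enters_def by blast
    obtain l :: nat where "iter_image g l k \<subseteq> j" using jH unfolding enters_def by blast
    then have "iter_image g (n + l) k \<subseteq> iter_image g n r" 
      using jr iter_antimono[OF k(2), of l "n + l"] by (metis le_add2 order_trans)
    then have "iter_image g n (iter_image g l k) \<subseteq> iter_image g n r" using iter_add gG kV by metis
    then have "iter_image g l k \<subseteq> r" using image_sub[of "g [^] n"] gG rV image_sub_V kV by simp
    then have "enters g k r" unfolding enters_def by blast
    then show ?thesis using jr rH skr \<open>enters g r k\<close> calculation(1,2) unfolding R_def by blast
  qed
  have "\<exists>l::nat. iter_image g l k \<subseteq> r" "\<exists>m::nat. iter_image g m r \<subseteq> k" if "r \<in> R" for r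
    using that unfolding R_def enters_def by auto
  then obtain lr mr :: "'a set \<Rightarrow> nat" where lr: "\<And>r. r \<in> R \<Longrightarrow> iter_image g (lr r) k \<subseteq> r" 
    and mr: "\<And>r. r \<in> R \<Longrightarrow> iter_image g (mr r) r \<subseteq> k" by metis
  have RV: "r \<subseteq> V" if "r \<in> R" for r using that H_sub unfolding R_def by blast
  have deepin: "iter_image g n r \<subseteq> iter_image g l k" if r: "r \<in> R" and n: "n \<ge> mr r + l" for n l r
  proof -
    have "iter_image g n r = iter_image g (n - mr r) (iter_image g (mr r) r)" using iter_add gG RV[OF r] n by simp
    also have "\<dots> \<subseteq> iter_image g (n - mr r) k" using mr[OF r] by blast
    also have "\<dots> \<subseteq> iter_image g l k" using iter_antimono[OF k(2)] n by simp
    finally show ?thesis .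
  qed
  have C1: "finite {j\<in>S. \<not> j \<subseteq> s}" if s: "s \<in> S" for s
  proof -
    obtain l :: nat where l: "iter_image g l k \<subseteq> s" using s unfolding S_def enters_def by blast
    have "{j\<in>S. \<not> j \<subseteq> s} \<subseteq> X \<union> (\<Union>r\<in>R. (\<lambda>n. iter_image g n r) ` {..<mr r + l})"
    proof
      fix j assume j: "j \<in> {j\<in>S. \<not> j \<subseteq> s}"
      show "j \<in> X \<union> (\<Union>r\<in>R. (\<lambda>n. iter_image g n r) ` {..<mr r + l})"
      proof (cases "j \<in> X")
        case False
        then obtain n r where r: "r \<in> R" "j = iter_image g n r" using dec j by blast
        then have "n < mr r + l" using deepin[OF r(1), of l n] l j by (metis (no_types, lifting) leI mem_Collect_eq order_trans)
        then show ?thesis using r by blast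
      qed simp
    qed
    then show ?thesis using finX finR by (meson finite_UN finite_UnI finite_imageI finite_lessThan finite_subset)
  qed
  have fintr: "finite {j\<in>S. transverse V j s}" if "s \<in> S" for s
    by (rule finite_subset[OF _ C1[OF that]]) (use transverse_not_sub(1) in blast)
  \<comment> \<open>\<open>K\<close> dominates all the delays \<open>mr r\<close> and
    \<open>lr r\<close>. Translates of members of \<open>R\<close> whose exponents differ by at
    least \<open>2 * K\<close> are nested, so at most \<open>4 * K\<close> translates of each member
    can be transverse to \<open>s\<close>.\<close>
  define K where "K = (\<Sum>r\<in>R. mr r + lr r)"
  have K: "mr r + lr r' \<le> 2 * K" if "r \<in> R" "r' \<in> R" for r r'
    using member_le_sum[OF that(1), of "\<lambda>r. mr r + lr r"] member_le_sum[OF that(2), of "\<lambda>r. mr r + lr r"] finR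
    unfolding K_def by simp
  have C2: "card {j\<in>S. transverse V j s} \<le> card X + card R * (4 * K)" if s: "s \<in> S" "s \<notin> X" for s
  proof -
    obtain n r where r: "r \<in> R" "s = iter_image g n r" using dec s by blast
    let ?U = "\<Union>r'\<in>R. (\<lambda>m. iter_image g m r') ` {n - 2 * K..<n + 2 * K}"
    have "{j\<in>S. transverse V j s} \<subseteq> X \<union> ?U"
    proof
      fix j assume j: "j \<in> {j\<in>S. transverse V j s}"
      show "j \<in> X \<union> ?U"
      proof (cases "j \<in> X")
        case False
        then obtain m r' where r': "r' \<in> R" "j = iter_image g m r'" using dec j by blast
        have in_: "iter_image g b ra \<subseteq> iter_image g a rb" if ra: "ra \<in> R" "rb \<in> R" "b \<ge> a + 2 * K" for ra rb a b
        proof -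
          have "iter_image g b ra \<subseteq> iter_image g (a + lr rb) k" using deepin[OF ra(1), of "a + lr rb" b] K[OF ra(1,2)] ra(3) by simp
          also have "\<dots> = iter_image g a (iter_image g (lr rb) k)" using iter_add gG kV by simp
          also have "\<dots> \<subseteq> iter_image g a rb" using lr[OF ra(2)] by blast
          finally show ?thesis .
        qed
        have "\<not> m \<ge> n + 2 * K" using in_[OF r'(1) r(1), of n m] j r r' transverse_not_sub(1) by blast
        moreover have "\<not> n \<ge> m + 2 * K" using in_[OF r(1) r'(1), of m n] j r r' transverse_not_sub(2) by blast
        ultimately have "m \<in> {n - 2 * K..<n + 2 * K}" by auto
        then show ?thesis using r' by blast
      qed simp
    qed
    then have "card {j\<in>S. transverse V j s} \<le> card (X \<union> ?U)" using finX finR by (intro card_mono) auto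
    also have "\<dots> \<le> card X + card ?U" by (rule card_Un_le)
    also have "card ?U \<le> (\<Sum>r'\<in>R. card ((\<lambda>m. iter_image g m r') ` {n - 2 * K..<n + 2 * K}))" by (rule card_UN_le[OF finR])
    also have "\<dots> \<le> (\<Sum>r'\<in>R. 4 * K)" 
    proof (rule sum_mono)
      fix r'
      have "card ((\<lambda>m. iter_image g m r') ` {n - 2 * K..<n + 2 * K}) \<le> card {n - 2 * K..<n + 2 * K}" by (rule card_image_le) simp
      then show "card ((\<lambda>m. iter_image g m r') ` {n - 2 * K..<n + 2 * K}) \<le> 4 * K" by simp
    qed
    finally show ?thesis by simp
  qed
  have "\<exists>C. \<forall>s\<in>S. card {j\<in>S. transverse V j s} \<le> C"
  proof (intro exI ballI)
    fix s assume s: "s \<in> S"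
    show "card {j\<in>S. transverse V j s} \<le> card X + card R * (4 * K) + (\<Sum>s\<in>X. card {j\<in>S. transverse V j s})"
    proof (cases "s \<in> X")
      case True
      then show ?thesis using member_le_sum[OF True, of "\<lambda>s. card {j\<in>S. transverse V j s}"] finX by simp
    next
      case False
      then show ?thesis using C2[OF s] by simp
    qed
  qed
  note C2' = this
  have inf: "infinite S"
  proof -
    obtain n0 where n0: "\<forall>m\<ge>n0. v \<notin> iter_image g m k" using iter_escape[OF k(2) v] by blast
    have "(\<lambda>n. iter_image g n k) ` {n0..} \<subseteq> S"
      using n0 iter_H gG Nd(1)[OF k(1)] unfolding S_def enters_def by blast
    moreover have "infinite ((\<lambda>n. iter_image g n k) ` {n0..})"
      using iter_inj[OF k(2)] infinite_Ici finite_imageD inj_on_subset by blast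
    ultimately show ?thesis using finite_subset by blast
  qed
  have up: "\<forall>s\<in>S. \<forall>j\<in>H. s \<subseteq> j \<longrightarrow> v \<notin> j \<longrightarrow> j \<in> S" unfolding S_def enters_def by (auto intro: order_trans)
  have pw: "\<forall>s\<in>S. \<forall>t\<in>S. s \<inter> t \<noteq> {}" using SN Nd(5) by blast
  have SH: "S \<subseteq> H" "\<forall>s\<in>S. v \<notin> s" unfolding S_def by auto
  have C1': "\<forall>s\<in>S. finite {j\<in>S. \<not> j \<subseteq> s}" using C1 by blast
  show ?thesis unfolding corridor_def by (intro exI[of _ S] conjI v SH inf up pw C1' C2' SN)
qed

end

section \<open>Points and distances in the cube complex\<close>

context median_complex
begin

section \<open>Points of the realization and common cubes\<close>

definition "valid p \<longleftrightarrow> (\<forall>h. h \<notin> H \<longrightarrow> p h = (0::real)) \<and> (\<forall>h\<in>H. 0 \<le> p h \<and> p h \<le> 1 \<and> p (V - h) = 1 - p h)"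

lemma validD: 
  assumes "valid p" shows "h \<notin> H \<Longrightarrow> p h = 0" "0 \<le> p h" "p h \<le> 1" "h \<in> H \<Longrightarrow> p (V - h) = 1 - p h"
proof -
  show "h \<notin> H \<Longrightarrow> p h = 0" "h \<in> H \<Longrightarrow> p (V - h) = 1 - p h" using assms unfolding valid_def by simp_all
  show "0 \<le> p h" "p h \<le> 1" using assms unfolding valid_def by (cases "h \<in> H"; simp)+
qed

text \<open>An intrinsic form of \<open>common_cube\<close>: in place of a cube, the half-spaces at
  which \<open>p\<close> or \<open>q\<close> has a positive coordinate must meet pairwise,
  complementary pairs excepted. This form passes easily to retractions, limits and
  translates.\<close>

definition "joint p q \<longleftrightarrow> valid p \<and> valid q \<and> (\<exists>v\<in>V. finite {h \<in> H. p h \<noteq> of_bool (v \<in> h)}) \<and> finite {h. p h \<noteq> q h}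
  \<and> (\<forall>a\<in>H. \<forall>b\<in>H. b \<noteq> V - a \<longrightarrow> 0 < p a \<or> 0 < q a \<longrightarrow> 0 < p b \<or> 0 < q b \<longrightarrow> a \<inter> b \<noteq> {})"

lemma joint_cons: 
  assumes "joint p q" "a \<in> H" "b \<in> H" "b \<noteq> V - a" "0 < p a \<or> 0 < q a" "0 < p b \<or> 0 < q b" shows "a \<inter> b \<noteq> {}"
proof -
  have "\<forall>a\<in>H. \<forall>b\<in>H. b \<noteq> V - a \<longrightarrow> 0 < p a \<or> 0 < q a \<longrightarrow> 0 < p b \<or> 0 < q b \<longrightarrow> a \<inter> b \<noteq> {}" 
    using assms(1) unfolding joint_def by (elim conjE)
  from this[rule_format, OF assms(2-6)] show ?thesis .
qed

lemma joint_common_cube: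
  assumes "joint p q" shows "common_cube V E p q"
proof -
  have vp: "valid p" and vq: "valid q" and fpq: "finite {h. p h \<noteq> q h}"
    using assms unfolding joint_def by simp_all
  note cons = joint_cons[OF assms]
  obtain v where v: "v \<in> V" "finite {h \<in> H. p h \<noteq> of_bool (v \<in> h)}" using assms unfolding joint_def by blast
  note pd = validD[OF vp] and qd = validD[OF vq]
  \<comment> \<open>The hyperplanes of the cube: those at which the points differ, or agree on a
    value strictly between 0 and 1.\<close>
  define W where "W = {h \<in> H. p h \<noteq> q h \<or> (p h \<noteq> 0 \<and> p h \<noteq> 1)}"
  have WH: "W \<subseteq> H" unfolding W_def by blast
  have "W \<subseteq> {h. p h \<noteq> q h} \<union> {h \<in> H. p h \<noteq> of_bool (v \<in> h)}" unfolding W_def by auto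
  then have finW: "finite W" using fpq v by (meson finite_UnI finite_subset)
  have cW: "V - h \<in> W \<longleftrightarrow> h \<in> W" if h: "h \<in> H" for h
    using h pd(4)[OF h] qd(4)[OF h] unfolding W_def by auto
  have pos: "0 < p h \<or> 0 < q h" if "h \<in> W" for h
    using that pd(2)[of h] qd(2)[of h] unfolding W_def by fastforce
  \<comment> \<open>Any choice of sides on \<open>W\<close>, completed by the sides of
    \<open>p\<close>, is consistent because each chosen side has a positive coordinate at
    \<open>p\<close> or at \<open>q\<close>.\<close>
  have vert: "\<exists>u\<in>V. R = Uv V E u" if R: "R \<subseteq> H" "\<forall>h\<in>H - W. h \<in> R \<longleftrightarrow> p h = 1" "\<forall>h\<in>W. h \<in> R \<longleftrightarrow> V - h \<notin> R" for R
  proof -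
    have flip: "h \<in> R \<longleftrightarrow> V - h \<notin> R" if h: "h \<in> H" for h
    proof (cases "h \<in> W")
      case False
      then have "p h = 0 \<or> p h = 1" "V - h \<notin> W" using h cW unfolding W_def by auto
      then show ?thesis using R(2) h False pd(4)[OF h] by auto
    qed (use R in blast)
    have posR: "0 < p h \<or> 0 < q h" if "h \<in> R" for h
      using that R pos by (cases "h \<in> W") fastforce+
    obtain u where "u \<in> V" "R = Uv V E u"
    proof (rule orientation_vertex[OF R(1) flip _ v(1)])
      show "h \<inter> k \<noteq> {}" if hk: "h \<in> R" "k \<in> R" for h k
      proof (rule cons)
        show "h \<in> H" "k \<in> H" using hk R by blast+
        then show "k \<noteq> V - h" using flip hk by blast
      qed (use posR hk in blast)+
      have "{h \<in> R. v \<notin> h} \<subseteq> W \<union> {h \<in> H. p h \<noteq> of_bool (v \<in> h)}" using R by fastforce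
      then show "finite {h \<in> R. v \<notin> h}" using finW v by (meson finite_UnI finite_subset)
    qed
    then show ?thesis by blast
  qed
  define R where "R = {h \<in> H. if h \<in> W then v \<in> h else p h = 1}"
  have "\<exists>u\<in>V. R = Uv V E u"
  proof (rule vert)
    show "\<forall>h\<in>W. h \<in> R \<longleftrightarrow> V - h \<notin> R"
    proof
      fix h assume h: "h \<in> W"
      then have "h \<in> H" "V - h \<in> W" using WH cW by blast+
      then show "h \<in> R \<longleftrightarrow> V - h \<notin> R" unfolding R_def using h v(1) by simp
    qed
  qed (auto simp: R_def)
  then obtain w where w: "w \<in> V" "R = Uv V E w" by blast
  have wh: "w \<in> h \<longleftrightarrow> p h = 1" if h: "h \<in> H" "h \<notin> W" for h
  proof -
    have "w \<in> h \<longleftrightarrow> h \<in> R" unfolding w(2) Uv_def using h by blast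
    then show ?thesis unfolding R_def using h by simp
  qed
  have "is_cube V E w W" unfolding is_cube_def
  proof (intro conjI allI impI ballI)
    fix R' assume "R' \<subseteq> H \<and> (\<forall>h\<in>H - W. (h \<in> R') = (w \<in> h)) \<and> (\<forall>h\<in>W. (h \<in> R') = (V - h \<notin> R'))"
    then have "R' \<subseteq> H" "\<forall>h\<in>H - W. (h \<in> R') = (p h = 1)" "\<forall>h\<in>W. (h \<in> R') = (V - h \<notin> R')" using wh by auto
    then show "\<exists>u\<in>V. R' = Uv V E u" by (rule vert)
  qed (use w finW WH cW in auto)
  moreover have off: "p h = (if w \<in> h then 1 else 0) \<and> q h = (if w \<in> h then 1 else 0)" if "h \<in> H - W" for h
    using that wh[of h] unfolding W_def by auto
  have "p \<in> cube_points V E w W" "q \<in> cube_points V E w W" unfolding cube_points_def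
    using vp vq off unfolding valid_def by simp_all
  ultimately show ?thesis unfolding common_cube_def by blast
qed

lemma common_cube_joint:
  assumes "common_cube V E p q" shows "joint p q"
proof -
  obtain v W where c: "is_cube V E v W" "p \<in> cube_points V E v W" "q \<in> cube_points V E v W"
    using assms unfolding common_cube_def by blast
  note cube = c(1)[unfolded is_cube_def]
  have "v \<in> V" using cube by (elim conjE)
  moreover have "finite W" using cube by (elim conjE)
  moreover have "W \<subseteq> H" using cube by (elim conjE)
  moreover have "\<forall>h\<in>W. V - h \<in> W" using cube by (elim conjE)
  ultimately have W: "v \<in> V" "finite W" "W \<subseteq> H" "\<And>h. h \<in> W \<Longrightarrow> V - h \<in> W" by simp_all
  have "\<forall>R. R \<subseteq> H \<and> (\<forall>h\<in>H - W. h \<in> R \<longleftrightarrow> v \<in> h) \<and> (\<forall>h\<in>W. h \<in> R \<longleftrightarrow> V - h \<notin> R) \<longrightarrow> (\<exists>u\<in>V. R = Uv V E u)"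
    using cube by (elim conjE)
  note cube = this[THEN spec, THEN mp, OF conjI, OF _ conjI]
  have cW: "V - h \<in> W \<longleftrightarrow> h \<in> W" if "h \<in> H" for h using W(4)[of h] W(4)[of "V - h"] H_dcompl[OF that] by auto
  have vp: "valid p" and vq: "valid q" using c unfolding valid_def cube_points_def by auto
  have offp: "p h = (if v \<in> h then 1 else 0)" and offq: "q h = (if v \<in> h then 1 else 0)" if "h \<in> H" "h \<notin> W" for h 
    using c(2,3) that unfolding cube_points_def by auto
  have eq: "p h = q h" if "h \<notin> W" for h using offp offq validD(1)[OF vp] validD(1)[OF vq] that by (cases "h \<in> H") auto
  then have "{h. p h \<noteq> q h} \<subseteq> W" by blast
  moreover have "{h \<in> H. p h \<noteq> of_bool (v \<in> h)} \<subseteq> W"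
  proof
    fix h assume "h \<in> {h \<in> H. p h \<noteq> of_bool (v \<in> h)}"
    then show "h \<in> W" using offp[of h] by (cases "h \<in> W") (auto simp: of_bool_def)
  qed
  moreover have "a \<inter> b \<noteq> {}" if ab: "a \<in> H" "b \<in> H" "b \<noteq> V - a" "0 < p a \<or> 0 < q a" "0 < p b \<or> 0 < q b" for a b
  proof -
    have ab': "a \<noteq> V - b" using ab H_dcompl by metis
    have a: "a \<in> W \<or> v \<in> a" and b: "b \<in> W \<or> v \<in> b" using ab offp offq by fastforce+
    \<comment> \<open>Flipping the base vertex, within the cube, into both \<open>a\<close> and
      \<open>b\<close> yields a vertex of their intersection.\<close>
    define R where "R = {h \<in> H. if h \<in> W then h = a \<or> h = b \<or> (v \<in> h \<and> h \<noteq> V - a \<and> h \<noteq> V - b) else v \<in> h}"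
    have "\<exists>u\<in>V. R = Uv V E u"
    proof (rule cube)
      show "R \<subseteq> H" "\<forall>h\<in>H - W. h \<in> R \<longleftrightarrow> v \<in> h" unfolding R_def by auto
      show "\<forall>h\<in>W. h \<in> R \<longleftrightarrow> V - h \<notin> R"
      proof
        fix h assume h: "h \<in> W"
        then have hH: "h \<in> H" "V - h \<in> H" and hW: "V - h \<in> W" using W by auto
        have e: "V - h = a \<longleftrightarrow> h = V - a" "V - h = b \<longleftrightarrow> h = V - b" "V - h = V - a \<longleftrightarrow> h = a" "V - h = V - b \<longleftrightarrow> h = b"
          using H_dcompl hH ab by metis+
        have ne: "a \<noteq> V - a" "b \<noteq> V - b" using ab by auto
        have "h \<in> R \<longleftrightarrow> h = a \<or> h = b \<or> (v \<in> h \<and> h \<noteq> V - a \<and> h \<noteq> V - b)"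
          unfolding R_def using hH h by simp
        moreover have "V - h \<in> R \<longleftrightarrow> h = V - a \<or> h = V - b \<or> (v \<notin> h \<and> h \<noteq> a \<and> h \<noteq> b)"
          unfolding R_def mem_Collect_eq e using hH hW W(1) by simp
        moreover have "h \<noteq> a \<and> h \<noteq> b" if "h = V - a \<or> h = V - b" using that ne ab(3) ab' by metis
        ultimately show "h \<in> R \<longleftrightarrow> V - h \<notin> R" by argo
      qed
    qed
    then obtain u where "R = Uv V E u" by blast
    moreover have "a \<in> R" "b \<in> R" unfolding R_def using ab a b by auto
    ultimately show ?thesis unfolding Uv_def by blast
  qed
  ultimately show ?thesis unfolding joint_def using vp vq W(1) finite_subset[OF _ W(2)]
    by (intro conjI bexI[of _ v]; blast)
qed

lemma common_cube_iff: "common_cube V E p q \<longleftrightarrow> joint p q"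
  using joint_common_cube common_cube_joint by blast

abbreviation "pts \<equiv> realization V E"

lemma pts_iff: "p \<in> pts \<longleftrightarrow> joint p p"
  unfolding common_cube_iff[symmetric] realization_def common_cube_def by blast

lemma joint_sym: "joint p q \<Longrightarrow> joint q p"
  unfolding common_cube_iff[symmetric] common_cube_def by blast

lemma joint_pts: assumes "joint p q" shows "p \<in> pts" "q \<in> pts"
  using assms unfolding pts_iff common_cube_iff[symmetric] common_cube_def by blast+

lemma pts_valid: "p \<in> pts \<Longrightarrow> valid p"
  by (simp add: pts_iff joint_def)

lemma joint_valid: "joint p q \<Longrightarrow> valid p" "joint p q \<Longrightarrow> valid q"
  by (simp_all add: joint_def)

text \<open>Otherwise \<open>a\<close> and the complement of \<open>b\<close> would both have
  positive coordinates although they are disjoint.\<close>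

lemma pts_mono:
  assumes p: "p \<in> pts" and ab: "a \<in> H" "b \<in> H" "a \<subset> b" "0 < p a" shows "p b = 1"
proof (rule ccontr)
  assume n: "p b \<noteq> 1"
  note pd = validD[OF pts_valid[OF p]]
  have "0 < p (V - b)" using n pd(3)[of b] pd(4)[OF ab(2)] by simp
  moreover have "V - b \<noteq> V - a" using ab H_dcompl by (metis psubset_eq)
  ultimately have "a \<inter> (V - b) \<noteq> {}" using joint_cons[of p p a "V - b"] p ab by (simp add: pts_iff)
  then show False using ab by blast
qed

lemma local_dist_nonneg: "0 \<le> local_dist p q"
  unfolding local_dist_def by (simp add: sum_nonneg)

lemma local_dist_self [simp]: "local_dist p p = 0"
  unfolding local_dist_def by simp

lemma local_dist_sym: "local_dist p q = local_dist q p"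
  unfolding local_dist_def by (simp add: power2_commute neq_commute)

lemma local_dist_superset:
  assumes "finite F" "{h. p h \<noteq> q h} \<subseteq> F"
  shows "local_dist p q = sqrt ((\<Sum>h\<in>F. (p h - q h)^2) / 2)"
proof -
  have "(\<Sum>h\<in>{h. p h \<noteq> q h}. (p h - q h)^2) = (\<Sum>h\<in>F. (p h - q h)^2)"
    by (rule sum.mono_neutral_left) (use assms in auto)
  then show ?thesis unfolding local_dist_def by simp
qed

lemma local_dist_ge:
  assumes "joint p q" "h \<in> H" shows "\<bar>p h - q h\<bar> \<le> local_dist p q"
proof -
  let ?F = "{h. p h \<noteq> q h} \<union> {h, V - h}"
  have fin: "finite ?F" using assms(1) unfolding joint_def by simp
  have c: "p (V - h) - q (V - h) = q h - p h" using validD(4)[OF joint_valid(1)[OF assms(1)] assms(2)] validD(4)[OF joint_valid(2)[OF assms(1)] assms(2)] by simp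
  \<comment> \<open>The change at \<open>h\<close> is repeated at its complement, which cancels the
    factor 1/2 in \<open>local_dist\<close>.\<close>
  have "2 * (p h - q h)^2 = (\<Sum>x\<in>{h, V - h}. (p x - q x)^2)"
    using assms(2) c by (simp add: power2_commute)
  also have "\<dots> \<le> (\<Sum>x\<in>?F. (p x - q x)^2)" by (rule sum_mono2[OF fin]) auto
  finally have "(p h - q h)^2 \<le> (\<Sum>x\<in>?F. (p x - q x)^2) / 2" by simp
  then have "sqrt ((p h - q h)^2) \<le> sqrt ((\<Sum>x\<in>?F. (p x - q x)^2) / 2)" by (rule real_sqrt_le_mono)
  then show ?thesis using local_dist_superset[OF fin, of p q] by (simp only: real_sqrt_abs Un_upper1)
qed

lemma local_dist_0: 
  assumes "joint p q" "local_dist p q = 0" shows "p = q"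
proof
  fix h show "p h = q h"
    using local_dist_ge[OF assms(1), of h] assms(2) 
      validD(1)[OF joint_valid(1)[OF assms(1)]] validD(1)[OF joint_valid(2)[OF assms(1)]] by (cases "h \<in> H") simp_all
qed

text \<open>The sums in the infimum defining \<open>cdist\<close>, made inductive so that statements
  about chains are proved one cube at a time.\<close>

inductive chain :: "('a set \<Rightarrow> real) \<Rightarrow> ('a set \<Rightarrow> real) \<Rightarrow> real \<Rightarrow> bool" where
  chain_refl: "chain p p 0"
| chain_step: "chain p q l \<Longrightarrow> joint q r \<Longrightarrow> chain p r (l + local_dist q r)"

lemma chain_nonneg: "chain p q l \<Longrightarrow> 0 \<le> l"
  by (induction rule: chain.induct) (auto simp: local_dist_nonneg)

lemma chain_iff:
  "chain p q l \<longleftrightarrow> (\<exists>c n. l = (\<Sum>i<n. local_dist (c i) (c (Suc i))) \<and> c 0 = p \<and> c n = q 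
      \<and> (\<forall>i<n. common_cube V E (c i) (c (Suc i))))"
proof
  assume "chain p q l"
  then show "\<exists>c n. l = (\<Sum>i<n. local_dist (c i) (c (Suc i))) \<and> c 0 = p \<and> c n = q 
      \<and> (\<forall>i<n. common_cube V E (c i) (c (Suc i)))"
  proof (induction rule: chain.induct)
    case (chain_refl p)
    then show ?case by (intro exI[of _ "\<lambda>_. p"] exI[of _ 0]) simp
  next
    case (chain_step p q l r)
    then obtain c n where c: "l = (\<Sum>i<n. local_dist (c i) (c (Suc i)))" "c 0 = p" "c n = q" 
      "\<forall>i<n. common_cube V E (c i) (c (Suc i))" by blast
    let ?c = "c(Suc n := r)"
    have "(\<Sum>i<Suc n. local_dist (?c i) (?c (Suc i))) = l + local_dist q r" using c by simp
    moreover have "\<forall>i<Suc n. common_cube V E (?c i) (?c (Suc i))" 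
      using c joint_common_cube[OF chain_step(2)] by (simp add: less_Suc_eq)
    ultimately show ?case using c by (intro exI[of _ ?c] exI[of _ "Suc n"]) simp
  qed
next
  have "chain (c 0) (c n) (\<Sum>i<n. local_dist (c i) (c (Suc i)))" if "\<forall>i<n. common_cube V E (c i) (c (Suc i))" for c n
    using that
  proof (induction n)
    case (Suc n)
    then have "chain (c 0) (c n) (\<Sum>i<n. local_dist (c i) (c (Suc i)))" "joint (c n) (c (Suc n))" 
      using common_cube_joint by auto
    then show ?case using chain_step by simp
  qed (simp add: chain_refl)
  then show "\<exists>c n. l = (\<Sum>i<n. local_dist (c i) (c (Suc i))) \<and> c 0 = p \<and> c n = q 
      \<and> (\<forall>i<n. common_cube V E (c i) (c (Suc i))) \<Longrightarrow> chain p q l" by blast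
qed

lemma cdist_Inf: "cdist V E p q = Inf {l. chain p q l}"
proof -
  have "{(\<Sum>i<n. local_dist (c i) (c (Suc i))) | c n.
      c 0 = p \<and> c n = q \<and> (\<forall>i<n. common_cube V E (c i) (c (Suc i)))} = {l. chain p q l}"
    unfolding chain_iff by auto
  then show ?thesis unfolding cdist_def by simp
qed

abbreviation "dc \<equiv> cdist V E"

lemma chain_bdd: "bdd_below {l. chain p q l}"
  using chain_nonneg by (intro bdd_belowI[of _ 0]) auto

lemma dc_le: "chain p q l \<Longrightarrow> dc p q \<le> l"
  unfolding cdist_Inf by (rule cInf_lower[OF _ chain_bdd]) simp

lemma chain_trans: "chain q r l' \<Longrightarrow> chain p q l \<Longrightarrow> chain p r (l + l')"
  by (induction rule: chain.induct) (auto simp: add.assoc[symmetric] intro: chain_step)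

lemma chain_single: "joint p q \<Longrightarrow> chain p q (local_dist p q)"
  using chain_step[OF chain_refl] by fastforce

lemma chain_sym: "chain p q l \<Longrightarrow> chain q p l"
proof (induction rule: chain.induct)
  case (chain_step p q l r)
  then show ?case using chain_trans[OF chain_step(3) chain_single[OF joint_sym[OF chain_step(2)]]] 
    by (simp add: local_dist_sym add.commute)
qed (rule chain_refl)

lemma finite_diff:
  assumes "p \<in> pts" "q \<in> pts" shows "finite {h. p h \<noteq> q h}"
proof -
  have ex: "\<exists>v\<in>V. finite {h \<in> H. r h \<noteq> of_bool (v \<in> h)}" if "r \<in> pts" for r
    using that unfolding pts_iff joint_def by (elim conjE)
  from ex[OF assms(1)] ex[OF assms(2)] 
  obtain v w where v: "v \<in> V" "finite {h \<in> H. p h \<noteq> of_bool (v \<in> h)}" and w: "w \<in> V" "finite {h \<in> H. q h \<noteq> of_bool (w \<in> h)}"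
    by blast
  have "{h. p h \<noteq> q h} \<subseteq> {h \<in> H. p h \<noteq> of_bool (v \<in> h)} \<union> {h \<in> H. q h \<noteq> of_bool (w \<in> h)}
      \<union> {h \<in> H. v \<in> h \<and> w \<notin> h} \<union> {h \<in> H. w \<in> h \<and> v \<notin> h}"
  proof
    fix h assume h: "h \<in> {h. p h \<noteq> q h}"
    then have "h \<in> H" using validD(1)[OF pts_valid[OF assms(1)]] validD(1)[OF pts_valid[OF assms(2)]] by (cases "h \<in> H") simp_all
    then show "h \<in> {h \<in> H. p h \<noteq> of_bool (v \<in> h)} \<union> {h \<in> H. q h \<noteq> of_bool (w \<in> h)}
      \<union> {h \<in> H. v \<in> h \<and> w \<notin> h} \<union> {h \<in> H. w \<in> h \<and> v \<notin> h}" using h by (cases "v \<in> h"; cases "w \<in> h") simp_all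
  qed
  then show ?thesis using v w finite_sep by (meson finite_UnI finite_subset)
qed

text \<open>Change one hyperplane at a time, raising the coordinate at \<open>k\<close> to its value
  at \<open>q\<close>. Taking \<open>k\<close> maximal among the half-spaces where \<open>q\<close>
  is larger keeps the new point consistent. Each move costs at most 1 and settles two half-spaces,
  \<open>k\<close> and its complement.\<close>

lemma chain_card:
  assumes "p \<in> pts" "q \<in> pts" shows "\<exists>l. chain p q l \<and> l \<le> card {h. p h \<noteq> q h}"
  using assms
proof (induction "card {h. p h \<noteq> q h}" arbitrary: p rule: less_induct)
  case less
  note pd = validD[OF pts_valid[OF less.prems(1)]] and qd = validD[OF pts_valid[OF less.prems(2)]]
  have fin: "finite {h. p h \<noteq> q h}" using finite_diff less.prems by blast
  show ?case
  proof (cases "p = q")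
    case True
    then show ?thesis using chain_refl by force
  next
    case False
    define L where "L = {h. p h < q h}"
    have LH: "L \<subseteq> H" using pd(1) qd(1) unfolding L_def by fastforce
    have finL: "finite L" by (rule finite_subset[OF _ fin]) (auto simp: L_def)
    obtain h where "p h \<noteq> q h" using False by blast
    then have "h \<in> H" using pd(1) qd(1) by metis
    then have "h \<in> L \<or> V - h \<in> L" using \<open>p h \<noteq> q h\<close> pd(4) qd(4) unfolding L_def by auto
    then have "L \<noteq> {}" by blast
    then obtain k where k: "k \<in> L" "\<And>j. j \<in> L \<Longrightarrow> k \<subseteq> j \<Longrightarrow> k = j" using finite_has_maximal[OF finL] by metis
    have kH: "k \<in> H" and klt: "p k < q k" using k LH unfolding L_def by auto
    let ?p = "p(k := q k, V - k := 1 - q k)"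
    have p': "?p k = q k" "?p (V - k) = q (V - k)" using kH qd(4)[OF kH] by simp_all
    have off: "?p x = p x" if "x \<noteq> k" "x \<noteq> V - k" for x using that by simp
    have vp': "valid ?p" unfolding valid_def
    proof (intro conjI allI impI ballI)
      fix x assume x: "x \<notin> H"
      then have "x \<noteq> k" "x \<noteq> V - k" using kH by auto
      then show "?p x = 0" using pd(1) x by simp
    next
      fix x assume x: "x \<in> H"
      show "0 \<le> ?p x" "?p x \<le> 1" using pd(2,3)[of x] qd(2,3)[of k] by auto
      consider "x = k" | "x = V - k" | "x \<noteq> k" "x \<noteq> V - k" by blast
      then show "?p (V - x) = 1 - ?p x"
      proof cases
        case 1
        then show ?thesis using kH by simp
      next
        case 2
        then show ?thesis using kH H_dcompl[OF kH] by simp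
      next
        case 3
        then have "V - x \<noteq> V - k" "V - x \<noteq> k" using H_dcompl[OF kH] H_dcompl[OF x] by metis+
        then show ?thesis using 3 pd(4)[OF x] by simp
      qed
    qed
    have diff: "{x. p x \<noteq> ?p x} \<subseteq> {k, V - k}" by auto
    have J: "joint p ?p" unfolding joint_def
    proof (intro conjI ballI impI)
      show "\<exists>v\<in>V. finite {h \<in> H. p h \<noteq> of_bool (v \<in> h)}" using less.prems(1) unfolding pts_iff joint_def by blast
      show "finite {h. p h \<noteq> ?p h}" using diff by (rule finite_subset) simp
      fix a b assume ab: "a \<in> H" "b \<in> H" "b \<noteq> V - a" "0 < p a \<or> 0 < ?p a" "0 < p b \<or> 0 < ?p b"
      \<comment> \<open>A positive coordinate of \<open>p\<close> at some \<open>c\<close> disjoint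
        from \<open>k\<close> would put the complement of \<open>c\<close> into \<open>L\<close>,
        strictly above \<open>k\<close>.\<close>
      have kpos: "k \<inter> c \<noteq> {}" if c: "c \<in> H" "c \<noteq> V - k" "0 < p c" for c
      proof
        assume "k \<inter> c = {}"
        then have sub: "k \<subset> V - c" using H_sub[OF kH] c H_dcompl[OF c(1)] by blast
        have "0 < q k" using klt pd(2)[of k] by linarith
        then have "q (V - c) = 1" using pts_mono[OF less.prems(2) kH H_compl[OF c(1)] sub] by blast
        moreover have "p (V - c) < 1" using pd(4)[OF c(1)] c by simp
        ultimately have "V - c \<in> L" unfolding L_def by simp
        then show False using k(2)[of "V - c"] sub by blast
      qed
      have pos: "0 < p x \<or> x = k" if "0 < p x \<or> 0 < ?p x" "x \<in> H" for x
      proof (cases "x = V - k")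
        case True
        then have "?p x < p x" using p' pd(4)[OF kH] qd(4)[OF kH] klt by simp
        then show ?thesis using that by linarith
      next
        case False
        then show ?thesis using that off[of x] by (cases "x = k") auto
      qed
      have ab': "a \<noteq> V - b" using ab H_dcompl by metis
      show "a \<inter> b \<noteq> {}"
      proof (cases "a = k \<or> b = k")
        case True
        then show ?thesis
        proof (elim disjE)
          assume "a = k"
          then show ?thesis using kpos[of b] pos[of b] ab H_ne[OF kH] by blast
        next
          assume "b = k"
          then show ?thesis using kpos[of a] pos[of a] ab ab' H_ne[OF kH] by blast
        qed
      next
        case False
        then show ?thesis using joint_cons[of p p a b] less.prems(1) pos[OF ab(4,1)] pos[OF ab(5,2)] ab 
          by (simp add: pts_iff)
      qed
    qed (use pts_valid less.prems vp' in auto)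
    have "p k \<noteq> q k" "p (V - k) \<noteq> q (V - k)" using klt pd(4)[OF kH] qd(4)[OF kH] by simp_all
    have eqd: "{x. ?p x \<noteq> q x} = {x. p x \<noteq> q x} - {k, V - k}" using p' by auto
    have sub: "{k, V - k} \<subseteq> {x. p x \<noteq> q x}" using \<open>p k \<noteq> q k\<close> \<open>p (V - k) \<noteq> q (V - k)\<close> by blast
    have c2: "card {x. ?p x \<noteq> q x} + 2 = card {x. p x \<noteq> q x}"
    proof -
      have "card {k, V - k} = 2" using kH by simp
      then show ?thesis using card_Diff_subset[OF _ sub] card_mono[OF fin sub] eqd by simp
    qed
    then obtain l where l: "chain ?p q l" "l \<le> card {x. ?p x \<noteq> q x}" 
      using less.hyps[OF _ joint_pts(2)[OF J] less.prems(2)] by fastforce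
    have "local_dist p ?p = sqrt ((\<Sum>x\<in>{k, V - k}. (p x - ?p x)^2) / 2)" by (rule local_dist_superset[OF _ diff]) simp
    also have "(\<Sum>x\<in>{k, V - k}. (p x - ?p x)^2) = 2 * (p k - q k)^2"
      using kH p' pd(4)[OF kH] qd(4)[OF kH] by (simp add: power2_commute)
    also have "sqrt (2 * (p k - q k)^2 / 2) \<le> 1" using pd(2,3)[of k] qd(2,3)[of k] by simp
    finally have "local_dist p ?p \<le> 1" .
    then show ?thesis using chain_trans[OF l(1) chain_single[OF J]] l(2) c2 by (intro exI conjI) auto
  qed
qed

lemma ex_chain: "p \<in> pts \<Longrightarrow> q \<in> pts \<Longrightarrow> \<exists>l. chain p q l"
  using chain_card by blast

lemma dc_card: 
  assumes "p \<in> pts" "q \<in> pts" shows "dc p q \<le> card {h. p h \<noteq> q h}"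
  using chain_card[OF assms] dc_le by (meson order_trans)

lemma dc_greatest:
  assumes "p \<in> pts" "q \<in> pts" "\<And>l. chain p q l \<Longrightarrow> x \<le> l" shows "x \<le> dc p q"
  unfolding cdist_Inf by (rule cInf_greatest) (use ex_chain assms in auto)

lemma dc_nonneg: "p \<in> pts \<Longrightarrow> q \<in> pts \<Longrightarrow> 0 \<le> dc p q"
  by (rule dc_greatest) (auto simp: chain_nonneg)

lemma dc_approx:
  assumes "p \<in> pts" "q \<in> pts" "e > 0" shows "\<exists>l. chain p q l \<and> l < dc p q + e"
proof -
  have "Inf {l. chain p q l} < dc p q + e" using assms(3) unfolding cdist_Inf by simp
  then show ?thesis using cInf_lessD[of "{l. chain p q l}"] ex_chain[OF assms(1,2)] by auto
qed

lemma dc_sym: "dc p q = dc q p"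
proof -
  have "{l. chain p q l} = {l. chain q p l}" using chain_sym by blast
  then show ?thesis unfolding cdist_Inf by simp
qed

lemma dc_triangle:
  assumes "p \<in> pts" "q \<in> pts" "r \<in> pts" shows "dc p r \<le> dc p q + dc q r"
proof (rule field_le_epsilon)
  fix e :: real assume "e > 0"
  then obtain l l' where l: "chain p q l" "l < dc p q + e/2" "chain q r l'" "l' < dc q r + e/2"
    using dc_approx assms by (meson half_gt_zero)
  then have "dc p r \<le> l + l'" using dc_le chain_trans by blast
  then show "dc p r \<le> dc p q + dc q r + e" using l by linarith
qed

lemma dc_local: "joint p q \<Longrightarrow> dc p q \<le> local_dist p q"
  using dc_le chain_single by blast

lemma dc_self: "p \<in> pts \<Longrightarrow> dc p p = 0"
  using dc_le[OF chain_refl] dc_nonneg by (metis antisym)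

text \<open>Hyperplanes of one cube are transverse, so two of its points differ at no more than one
  member of a nested family. Summed along chains, this bounds distances from below.\<close>

lemma local_nested_sum:
  assumes J: "joint p q" and K: "finite K" "K \<subseteq> H" "\<And>a b. a \<in> K \<Longrightarrow> b \<in> K \<Longrightarrow> a \<subseteq> b \<or> b \<subseteq> a"
  shows "(\<Sum>k\<in>K. \<bar>p k - q k\<bar>) \<le> local_dist p q"
proof (cases "\<forall>k\<in>K. p k = q k")
  case True
  then show ?thesis using local_dist_nonneg by simp
next
  case False
  then obtain k where k: "k \<in> K" "p k \<noteq> q k" by blast
  note pd = validD[OF joint_valid(1)[OF J]] and qd = validD[OF joint_valid(2)[OF J]]
  have *: False if ab: "a \<in> K" "b \<in> K" "p a \<noteq> q a" "p b \<noteq> q b" "a \<subset> b" for a b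
  proof -
    have abH: "a \<in> H" "b \<in> H" using ab K by blast+
    have "0 < p a \<or> 0 < q a" "0 < p (V - b) \<or> 0 < q (V - b)"
      using ab pd(2)[of a] qd(2)[of a] pd(3)[of b] qd(3)[of b] pd(4)[OF abH(2)] qd(4)[OF abH(2)] by linarith+
    moreover have "V - b \<noteq> V - a" using ab abH H_dcompl by (metis psubset_eq)
    ultimately have "a \<inter> (V - b) \<noteq> {}" using joint_cons[OF J, of a "V - b"] abH by simp
    then show False using ab by blast
  qed
  have "p j = q j" if "j \<in> K" "j \<noteq> k" for j
    using *[of j k] *[of k j] K(3)[of j k] k that by blast
  then have "(\<Sum>j\<in>K. \<bar>p j - q j\<bar>) = (\<Sum>j\<in>{k}. \<bar>p j - q j\<bar>)"
    using K(1) k by (intro sum.mono_neutral_right) auto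
  then show ?thesis using local_dist_ge[OF J, of k] k K by auto
qed

lemma chain_nested_sum:
  assumes "chain p q l" and K: "finite K" "K \<subseteq> H" "\<And>a b. a \<in> K \<Longrightarrow> b \<in> K \<Longrightarrow> a \<subseteq> b \<or> b \<subseteq> a"
  shows "(\<Sum>k\<in>K. \<bar>p k - q k\<bar>) \<le> l"
  using assms(1)
proof (induction rule: chain.induct)
  case (chain_step p q l r)
  have "(\<Sum>k\<in>K. \<bar>p k - r k\<bar>) \<le> (\<Sum>k\<in>K. \<bar>p k - q k\<bar> + \<bar>q k - r k\<bar>)" by (rule sum_mono) simp
  then show ?case using chain_step.IH local_nested_sum[OF chain_step(2) K] by (simp add: sum.distrib)
qed simp

lemma dc_nested_sum:
  assumes "p \<in> pts" "q \<in> pts" "finite K" "K \<subseteq> H" "\<And>a b. a \<in> K \<Longrightarrow> b \<in> K \<Longrightarrow> a \<subseteq> b \<or> b \<subseteq> a"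
  shows "(\<Sum>k\<in>K. \<bar>p k - q k\<bar>) \<le> dc p q"
  by (rule dc_greatest[OF assms(1,2)]) (rule chain_nested_sum[OF _ assms(3-5)])

lemma dc_ge:
  assumes "p \<in> pts" "q \<in> pts" shows "\<bar>p h - q h\<bar> \<le> dc p q"
proof (cases "h \<in> H")
  case True
  then show ?thesis using dc_nested_sum[OF assms, of "{h}"] by auto
next
  case False
  then show ?thesis using validD(1)[OF pts_valid[OF assms(1)]] validD(1)[OF pts_valid[OF assms(2)]] dc_nonneg[OF assms] by simp
qed

text \<open>A coordinate of a convex combination is positive only if it is positive at
  \<open>p\<close> or at \<open>q\<close>.\<close>

lemma joint_comb:
  assumes J: "joint p q" and s: "0 \<le> s" "s \<le> 1" and t: "0 \<le> t" "t \<le> 1"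
  shows "joint (\<lambda>h. (1 - s) * p h + s * q h) (\<lambda>h. (1 - t) * p h + t * q h)"
proof -
  note vp = joint_valid(1)[OF J] and vq = joint_valid(2)[OF J]
  note pd = validD[OF vp] and qd = validD[OF vq]
  have v: "valid (\<lambda>h. (1 - s) * p h + s * q h)" if s: "0 \<le> s" "s \<le> 1" for s
    unfolding valid_def
  proof (intro conjI allI impI ballI)
    fix h
    show "0 \<le> (1 - s) * p h + s * q h" using pd(2)[of h] qd(2)[of h] s by simp
    show "(1 - s) * p h + s * q h \<le> 1" by (rule convex_bound_le) (use pd(3)[of h] qd(3)[of h] s in auto)
    show "(1 - s) * p h + s * q h = 0" if "h \<notin> H" using pd(1) qd(1) that by simp
    show "(1 - s) * p (V - h) + s * q (V - h) = 1 - ((1 - s) * p h + s * q h)" if "h \<in> H" 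
      unfolding pd(4)[OF that] qd(4)[OF that] by (simp add: algebra_simps)
  qed
  have pos: "0 < p h \<or> 0 < q h" if "0 < (1 - s) * p h + s * q h" for s h
    using pd(2)[of h] qd(2)[of h] that by (metis add.right_neutral less_eq_real_def mult_zero_right)
  have fin: "finite {h. p h \<noteq> q h}" using J unfolding joint_def by simp
  obtain v0 where v0: "v0 \<in> V" "finite {h \<in> H. p h \<noteq> of_bool (v0 \<in> h)}" using J unfolding joint_def by blast
  have same: "(1 - s) * p h + s * q h = p h" if "p h = q h" for s h using that by (simp add: algebra_simps)
  show ?thesis unfolding joint_def
  proof (intro conjI ballI impI)
    have "{h \<in> H. (1 - s) * p h + s * q h \<noteq> of_bool (v0 \<in> h)} \<subseteq> {h. p h \<noteq> q h} \<union> {h \<in> H. p h \<noteq> of_bool (v0 \<in> h)}"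
      using same by auto
    then show "\<exists>v\<in>V. finite {h \<in> H. (1 - s) * p h + s * q h \<noteq> of_bool (v \<in> h)}" 
      using v0 fin by (meson finite_UnI finite_subset)
    have "{h. (1 - s) * p h + s * q h \<noteq> (1 - t) * p h + t * q h} \<subseteq> {h. p h \<noteq> q h}" using same by auto
    then show "finite {h. (1 - s) * p h + s * q h \<noteq> (1 - t) * p h + t * q h}" using fin finite_subset by blast
    fix a b assume ab: "a \<in> H" "b \<in> H" "b \<noteq> V - a" "0 < (1 - s) * p a + s * q a \<or> 0 < (1 - t) * p a + t * q a"
      "0 < (1 - s) * p b + s * q b \<or> 0 < (1 - t) * p b + t * q b"
    then show "a \<inter> b \<noteq> {}" using pos joint_cons[OF J ab(1-3)] by blast
  qed (use v s t in auto)
qed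

lemma local_dist_comb:
  assumes J: "joint p q"
  shows "local_dist (\<lambda>h. (1 - s) * p h + s * q h) (\<lambda>h. (1 - t) * p h + t * q h) = \<bar>s - t\<bar> * local_dist p q"
proof -
  let ?F = "{h. p h \<noteq> q h}"
  have fin: "finite ?F" using J unfolding joint_def by simp
  have "{h. (1 - s) * p h + s * q h \<noteq> (1 - t) * p h + t * q h} \<subseteq> ?F" by (auto simp: algebra_simps)
  then have "local_dist (\<lambda>h. (1 - s) * p h + s * q h) (\<lambda>h. (1 - t) * p h + t * q h) =
    sqrt ((\<Sum>h\<in>?F. ((1 - s) * p h + s * q h - ((1 - t) * p h + t * q h))^2) / 2)"
    by (rule local_dist_superset[OF fin])
  also have "(\<Sum>h\<in>?F. ((1 - s) * p h + s * q h - ((1 - t) * p h + t * q h))^2) = (\<Sum>h\<in>?F. (s - t)^2 * (p h - q h)^2)"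
  proof (rule sum.cong[OF refl])
    fix h
    have "(1 - s) * p h + s * q h - ((1 - t) * p h + t * q h) = - ((s - t) * (p h - q h))" by (simp add: algebra_simps)
    then show "((1 - s) * p h + s * q h - ((1 - t) * p h + t * q h))^2 = (s - t)^2 * (p h - q h)^2"
      by (simp add: power_mult_distrib)
  qed
  also have "\<dots> = (s - t)^2 * (\<Sum>h\<in>?F. (p h - q h)^2)" by (simp add: sum_distrib_left)
  also have "sqrt ((s - t)^2 * (\<Sum>h\<in>?F. (p h - q h)^2) / 2) = \<bar>s - t\<bar> * local_dist p q"
    unfolding local_dist_def by (simp add: real_sqrt_mult real_sqrt_divide)
  finally show ?thesis .
qed

end

text \<open>Tychonoff for a product of unit intervals. The index set will contain all times of a
  ray, hence is uncountable, so a filter finer than \<open>sequentially\<close> takes the place of a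
  convergent subsequence.\<close>

lemma cluster_filter:
  fixes x :: "nat \<Rightarrow> 'i \<Rightarrow> real"
  assumes "\<And>n i. x n i \<in> {0..1}"
  obtains X G where "G \<noteq> bot" "G \<le> sequentially" "\<And>i. ((\<lambda>n. x n i) \<longlongrightarrow> X i) G"
proof -
  let ?U = "PiE UNIV (\<lambda>_. {0..1}) :: ('i \<Rightarrow> real) set"
  have "compactin (product_topology (\<lambda>_. euclidean) UNIV) ?U" unfolding compactin_PiE by simp
  then have "compact ?U" by (simp add: euclidean_product_topology)
  moreover have "eventually (\<lambda>y. y \<in> ?U) (filtermap x sequentially)" 
    unfolding eventually_filtermap by (rule always_eventually) (use assms in auto)
  moreover have "filtermap x sequentially \<noteq> bot" by (simp add: filtermap_bot_iff)
  ultimately obtain X where X: "inf (nhds X) (filtermap x sequentially) \<noteq> bot" unfolding compact_filter by blast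
  define G where "G = inf sequentially (filtercomap x (nhds X))"
  have "G \<noteq> bot"
  proof
    assume "G = bot"
    then have "eventually (\<lambda>_. False) G" by simp
    then obtain P Q where P: "eventually P sequentially" and Q: "eventually Q (filtercomap x (nhds X))" 
      and PQ: "\<And>n. P n \<Longrightarrow> Q n \<Longrightarrow> False" unfolding G_def eventually_inf by blast
    obtain R where R: "eventually R (nhds X)" "\<And>n. R (x n) \<Longrightarrow> Q n" using Q unfolding eventually_filtercomap by blast
    have "eventually (\<lambda>y. \<not> R y) (filtermap x sequentially)" unfolding eventually_filtermap
      using P by (rule eventually_mono) (use R PQ in blast)
    then have "eventually (\<lambda>y. False) (inf (nhds X) (filtermap x sequentially))"
      unfolding eventually_inf using R(1) by blast
    then show False using X by (simp add: trivial_limit_def)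
  qed
  moreover have "G \<le> sequentially" unfolding G_def by simp
  moreover have lim: "(x \<longlongrightarrow> X) G" 
    unfolding filterlim_iff_le_filtercomap G_def by simp
  have "((\<lambda>n. x n i) \<longlongrightarrow> X i) G" for i
  proof -
    have "continuous_on UNIV (\<lambda>y::'i \<Rightarrow> real. y i)" by (rule continuous_on_product_coordinates)
    then have "((\<lambda>y::'i \<Rightarrow> real. y i) \<longlongrightarrow> X i) (at X)" unfolding continuous_on_def by simp
    then show ?thesis using lim by (rule tendsto_compose)
  qed
  ultimately show ?thesis using that by blast
qed

section \<open>Geodesic rays along corridors\<close>

locale corridor_ray = median_complex +
  fixes v and S
  assumes cv: "v \<in> V" and cH: "S \<subseteq> H" and cout: "\<And>s. s \<in> S \<Longrightarrow> v \<notin> s"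
    and cup: "\<And>s j. s \<in> S \<Longrightarrow> j \<in> H \<Longrightarrow> s \<subseteq> j \<Longrightarrow> v \<notin> j \<Longrightarrow> j \<in> S"
    and cint: "\<And>s t. s \<in> S \<Longrightarrow> t \<in> S \<Longrightarrow> s \<inter> t \<noteq> {}"
    and cinf: "infinite S" and cfin: "\<And>s. s \<in> S \<Longrightarrow> finite {j \<in> S. \<not> j \<subseteq> s}"
begin

definition "crossing h \<longleftrightarrow> h \<in> H \<and> (h \<in> S \<or> V - h \<in> S)"
definition "base h = (if h \<in> H then of_bool (v \<in> h) else (0::real))"
text \<open>The retraction onto \<open>Y\<close>. It maps cubes to cubes and does not increase
  lengths of chains, so near-geodesics between points of \<open>Y\<close> can be chosen inside
  \<open>Y\<close>.\<close>

definition "ret p h = (if crossing h then p h else base h)"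
definition "Y = {p \<in> pts. \<forall>h. \<not> crossing h \<longrightarrow> p h = base h}"

lemma crossing_compl: "h \<in> H \<Longrightarrow> crossing (V - h) \<longleftrightarrow> crossing h"
  unfolding crossing_def using H_dcompl by auto

lemma base_pts: "base \<in> pts"
proof -
  have "a \<inter> b \<noteq> {}" if "a \<in> H" "b \<in> H" "0 < base a" "0 < base b" for a b
    using that unfolding base_def by (auto split: if_splits)
  moreover have "valid base" unfolding valid_def base_def using cv by auto
  moreover have "{h \<in> H. base h \<noteq> of_bool (v \<in> h)} = {}" unfolding base_def by auto
  then have "finite {h \<in> H. base h \<noteq> of_bool (v \<in> h)}" by (metis finite.emptyI)
  ultimately show ?thesis unfolding pts_iff joint_def by (intro conjI ballI impI bexI[OF _ cv]) simp_all
qed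

lemma base_Y: "base \<in> Y" unfolding Y_def using base_pts by simp

lemma Y_pts: "p \<in> Y \<Longrightarrow> p \<in> pts" unfolding Y_def by simp

lemma ret_Y: "p \<in> Y \<Longrightarrow> ret p = p" unfolding Y_def ret_def by auto

text \<open>The critical case is a crossing \<open>a\<close> missing \<open>v\<close> and a
  non-crossing \<open>b\<close> containing \<open>v\<close>: if they were disjoint, \<open>a\<close>
  would lie in the complement of \<open>b\<close>, and upward closure of \<open>S\<close> would make
  \<open>b\<close> crossing.\<close>

lemma joint_ret:
  assumes J: "joint p q" shows "joint (ret p) (ret q)"
proof -
  have v: "valid (ret r)" if "valid r" for r
    unfolding valid_def
  proof (intro conjI allI impI ballI)
    note rd = validD[OF that] and bd = validD[OF pts_valid[OF base_pts]]
    fix h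
    show "0 \<le> ret r h" "ret r h \<le> 1" using rd(2,3) bd(2,3) unfolding ret_def by auto
    show "ret r h = 0" if "h \<notin> H" using that rd(1) bd(1) unfolding ret_def by auto
    show "ret r (V - h) = 1 - ret r h" if "h \<in> H" using rd(4) bd(4) crossing_compl that unfolding ret_def by auto
  qed
  have mixed: "a \<inter> b \<noteq> {}" if ab: "a \<in> H" "b \<in> H" "crossing a" "\<not> crossing b" "v \<in> b" for a b
  proof (cases "v \<in> a")
    case True
    then show ?thesis using ab by blast
  next
    case False
    then have aS: "a \<in> S" using ab(3) cout[of "V - a"] cv unfolding crossing_def by blast
    show ?thesis
    proof
      assume "a \<inter> b = {}"
      then have "a \<subseteq> V - b" using H_sub[OF ab(1)] by blast
      then have "V - b \<in> S" using cup[OF aS H_compl[OF ab(2)]] ab(5) by blast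
      then show False using ab unfolding crossing_def by blast
    qed
  qed
  have vb: "v \<in> h" if "0 < ret r h" "\<not> crossing h" "h \<in> H" for r h
    using that unfolding ret_def base_def by (auto split: if_splits)
  show ?thesis unfolding joint_def
  proof (intro conjI ballI impI)
    show "valid (ret p)" "valid (ret q)" using v joint_valid[OF J] by blast+
    have "{h. ret p h \<noteq> ret q h} \<subseteq> {h. p h \<noteq> q h}" unfolding ret_def by auto
    then show "finite {h. ret p h \<noteq> ret q h}" using finite_diff[OF joint_pts[OF J]] finite_subset by blast
    have "{h \<in> H. ret p h \<noteq> of_bool (v \<in> h)} \<subseteq> {h. p h \<noteq> base h}" unfolding ret_def base_def by auto
    then show "\<exists>v\<in>V. finite {h \<in> H. ret p h \<noteq> of_bool (v \<in> h)}" 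
      using finite_diff[OF joint_pts(1)[OF J] base_pts] finite_subset cv by blast
    fix a b assume ab: "a \<in> H" "b \<in> H" "b \<noteq> V - a" "0 < ret p a \<or> 0 < ret q a" "0 < ret p b \<or> 0 < ret q b"
    consider "crossing a" "crossing b" | "crossing a" "\<not> crossing b" | "\<not> crossing a" "crossing b" | "\<not> crossing a" "\<not> crossing b" by blast
    then show "a \<inter> b \<noteq> {}"
    proof cases
      case 1
      then show ?thesis using joint_cons[OF J ab(1-3)] ab(4,5) unfolding ret_def by simp
    next
      case 2
      then show ?thesis using mixed[of a b] vb[of _ b] ab by blast
    next
      case 3
      then show ?thesis using mixed[of b a] vb[of _ a] ab by (metis Int_commute)
    next
      case 4
      then show ?thesis using vb[of _ a] vb[of _ b] ab by blast
    qed
  qed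
qed

lemma ret_in_Y: "p \<in> pts \<Longrightarrow> ret p \<in> Y"
  unfolding Y_def using joint_ret by (auto simp: pts_iff ret_def)

lemma local_dist_ret:
  assumes "joint p q" shows "local_dist (ret p) (ret q) \<le> local_dist p q"
proof -
  let ?F = "{h. p h \<noteq> q h}"
  have fin: "finite ?F" using finite_diff joint_pts[OF assms] by blast
  have "{h. ret p h \<noteq> ret q h} \<subseteq> ?F" unfolding ret_def by auto
  then have "local_dist (ret p) (ret q) = sqrt ((\<Sum>h\<in>?F. (ret p h - ret q h)^2) / 2)" by (rule local_dist_superset[OF fin])
  also have "\<dots> \<le> sqrt ((\<Sum>h\<in>?F. (p h - q h)^2) / 2)"
    by (intro real_sqrt_le_mono divide_right_mono sum_mono) (auto simp: ret_def)
  finally show ?thesis unfolding local_dist_def .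
qed

lemma comb_Y:
  assumes "joint p q" "p \<in> Y" "q \<in> Y" "0 \<le> t" "t \<le> 1" shows "(\<lambda>h. (1 - t) * p h + t * q h) \<in> Y"
  using joint_comb[OF assms(1,4,5,4,5)] assms(2,3) unfolding Y_def pts_iff[symmetric] 
  by (auto simp: algebra_simps)

section \<open>Near-geodesic curves, far points and limits inside \<open>Y\<close>\<close>

definition "curve u l \<longleftrightarrow> 0 \<le> l \<and> (\<forall>s\<in>{0..l}. u s \<in> Y) \<and> (\<forall>s t. 0 \<le> s \<longrightarrow> s \<le> t \<longrightarrow> t \<le> l \<longrightarrow> dc (u s) (u t) \<le> t - s)"

lemma chain_curve:
  assumes "chain p q l" "p \<in> pts" shows "\<exists>u. curve u l \<and> u 0 = ret p \<and> u l = ret q"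
  using assms
proof (induction rule: chain.induct)
  case (chain_refl p)
  then show ?case using ret_in_Y dc_self Y_pts by (intro exI[of _ "\<lambda>_. ret p"]) (auto simp: curve_def)
next
  case (chain_step p q l r)
  then obtain u where u: "curve u l" "u 0 = ret p" "u l = ret q" by blast
  have J: "joint (ret q) (ret r)" using joint_ret chain_step(2) by blast
  have qr: "ret q \<in> Y" "ret r \<in> Y" using ret_in_Y joint_pts[OF chain_step(2)] by auto
  define \<delta> where "\<delta> = local_dist q r"
  have l0: "0 \<le> l" using u unfolding curve_def by blast
  show ?case
  \<comment> \<open>A step of length 0 is dropped, since the linear interpolation divides by the
    length.\<close>
  proof (cases "\<delta> = 0")
    case True
    then have "q = r" using local_dist_0[OF chain_step(2)] unfolding \<delta>_def by blast
    then show ?thesis using u by auto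
  next
    case False
    then have d: "\<delta> > 0" using local_dist_nonneg[of q r] unfolding \<delta>_def by simp
    let ?w = "\<lambda>s h. (1 - (s - l) / \<delta>) * ret q h + (s - l) / \<delta> * ret r h"
    let ?u = "\<lambda>s. if s \<le> l then u s else ?w s"
    have w: "?w s \<in> Y" if "l \<le> s" "s \<le> l + \<delta>" for s
      by (rule comb_Y[OF J qr]) (use that d in auto)
    have wl: "?w l = ret q" by simp
    have dw: "dc (?w s) (?w t) \<le> t - s" if st: "l \<le> s" "s \<le> t" "t \<le> l + \<delta>" for s t
    proof -
      have "joint (?w s) (?w t)" by (rule joint_comb[OF J]) (use st d in auto)
      then have "dc (?w s) (?w t) \<le> local_dist (?w s) (?w t)" by (rule dc_local)
      also have "\<dots> = \<bar>(s - l) / \<delta> - (t - l) / \<delta>\<bar> * local_dist (ret q) (ret r)" by (rule local_dist_comb[OF J])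
      also have "\<dots> \<le> \<bar>(s - l) / \<delta> - (t - l) / \<delta>\<bar> * \<delta>"
        using local_dist_ret[OF chain_step(2)] unfolding \<delta>_def by (intro mult_left_mono) auto
      also have "\<dots> = t - s" using d st by (simp add: diff_divide_distrib[symmetric] abs_if field_simps)
      finally show ?thesis .
    qed
    have "curve ?u (l + \<delta>)" unfolding curve_def
    proof (intro conjI ballI allI impI)
      show "0 \<le> l + \<delta>" using l0 d by simp
      show "?u s \<in> Y" if "s \<in> {0..l + \<delta>}" for s using that w u(1) unfolding curve_def by auto
      fix s t assume st: "0 \<le> s" "s \<le> t" "t \<le> l + \<delta>"
      consider "t \<le> l" | "s \<le> l" "l < t" | "l < s" by linarith
      then show "dc (?u s) (?u t) \<le> t - s"
      proof cases
        case 1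
        then show ?thesis using u(1) st unfolding curve_def by auto
      next
        case 2
        have "dc (u s) (?w t) \<le> dc (u s) (ret q) + dc (ret q) (?w t)"
          by (rule dc_triangle) (use Y_pts w u(1) qr 2 st in \<open>auto simp: curve_def\<close>)
        moreover have "dc (u s) (u l) \<le> l - s" using u(1) 2 st unfolding curve_def by auto
        moreover have "dc (?w l) (?w t) \<le> t - l" by (rule dw) (use 2 st in auto)
        ultimately show ?thesis using 2 u(3) unfolding wl by simp
      next
        case 3
        then show ?thesis using dw[of s t] st by simp
      qed
    qed
    moreover have "?u (l + \<delta>) = ret r" using d by (auto simp: fun_eq_iff)
    moreover have "?u 0 = ret p" using l0 u by simp
    ultimately show ?thesis unfolding \<delta>_def by blast
  qed
qed

text \<open>A 1-Lipschitz curve whose length exceeds the distance of its ends by less than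
  \<open>e\<close> wastes less than \<open>e\<close> on each of its parts.\<close>

lemma near_geodesic:
  assumes "p \<in> Y" "q \<in> Y" "e > 0"
  obtains u l where "curve u l" "u 0 = p" "u l = q" "dc p q \<le> l" 
    "\<And>s t. 0 \<le> s \<Longrightarrow> s \<le> t \<Longrightarrow> t \<le> l \<Longrightarrow> \<bar>dc (u s) (u t) - (t - s)\<bar> \<le> e"
proof -
  obtain l where l: "chain p q l" "l < dc p q + e" using dc_approx Y_pts assms by blast
  obtain u where u: "curve u l" "u 0 = p" "u l = q" using chain_curve[OF l(1)] Y_pts ret_Y assms by metis
  have "\<bar>dc (u s) (u t) - (t - s)\<bar> \<le> e" if st: "0 \<le> s" "s \<le> t" "t \<le> l" for s t
  proof -
    have uY: "u x \<in> pts" if "0 \<le> x" "x \<le> l" for x using u(1) that Y_pts unfolding curve_def by auto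
    have d: "dc (u x) (u y) \<le> y - x" if "0 \<le> x" "x \<le> y" "y \<le> l" for x y using u(1) that unfolding curve_def by blast
    have "dc p q \<le> dc (u 0) (u s) + dc (u s) q" using dc_triangle[of "u 0" "u s" "u l"] uY st u by auto
    moreover have "dc (u s) q \<le> dc (u s) (u t) + dc (u t) (u l)" using dc_triangle[of "u s" "u t" "u l"] uY st u by auto
    moreover have "dc (u 0) (u s) \<le> s" "dc (u t) (u l) \<le> l - t" "dc (u s) (u t) \<le> t - s" 
      using d[of 0 s] d[of t l] d[of s t] st by auto
    ultimately show ?thesis using l(2) by linarith
  qed
  then show ?thesis using that u dc_le[OF l(1)] by blast
qed

text \<open>All but finitely many members of \<open>S\<close> lie inside a given one.\<close>

lemma nested_sequence: 
  obtains s :: "nat \<Rightarrow> 'a set" where "\<And>n. s n \<in> S" "\<And>n. s (Suc n) \<subset> s n"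
proof -
  have "\<exists>y. y \<in> S \<and> y \<subset> x" if x: "x \<in> S" for x
  proof -
    have "finite (insert x {j \<in> S. \<not> j \<subseteq> x})" using cfin[OF x] by simp
    then obtain y where "y \<in> S" "y \<notin> insert x {j \<in> S. \<not> j \<subseteq> x}" using cinf by (meson finite_subset subsetI)
    then show ?thesis by blast
  qed
  moreover obtain x where "x \<in> S" using cinf by (metis all_not_in_conv finite.emptyI)
  ultimately have "\<exists>f. \<forall>n. f n \<in> S \<and> f (Suc n) \<subset> f n"
    by (intro dependent_nat_choice) auto
  then obtain f :: "nat \<Rightarrow> 'a set" where "\<forall>n. f n \<in> S \<and> f (Suc n) \<subset> f n" by (elim exE)
  then show ?thesis using that[of f] by simp
qed

text \<open>The point is obtained from \<open>v\<close> by crossing exactly the members of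
  \<open>S\<close> that contain \<open>s n\<close>. It differs from \<open>base\<close> by 1 at each
  of the nested half-spaces \<open>s 0\<close>, ..., \<open>s (n - 1)\<close>.\<close>

lemma far_point: "\<exists>p\<in>Y. real n \<le> dc base p"
proof -
  obtain s where s: "\<And>n. s n \<in> S" "\<And>n. s (Suc n) \<subset> s n" using nested_sequence by blast
  have anti: "s j \<subseteq> s i" if "i \<le> j" for i j by (rule lift_Suc_antimono_le[OF _ that]) (use s in blast)
  have strict: "s j \<subset> s i" if "i < j" for i j 
    using anti[of "Suc i" j] s(2)[of i] that by (metis Suc_leI order_le_less_trans)
  define A where "A = {h \<in> S. s n \<subseteq> h}"
  have AS: "A \<subseteq> S" unfolding A_def by blast
  have A0: "V - h \<notin> A" if "h \<in> A" for h using cint[of h "V - h"] that unfolding A_def by blast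
  define p where "p h = (if h \<in> A then 1 else if h \<in> H \<and> V - h \<in> A then 0 else base h)" for h
  have Aup: "V - b \<in> A" if "a \<in> A" "b \<in> H" "a \<inter> b = {}" "v \<in> b" for a b
  proof -
    have "a \<subseteq> V - b" using that AS cH H_sub by blast
    then show ?thesis using that cup[of a "V - b"] unfolding A_def by auto
  qed
  have ppos: "h \<in> A \<or> (v \<in> h \<and> V - h \<notin> A)" if "0 < p h" "h \<in> H" for h
    using that unfolding p_def base_def by (auto split: if_splits)
  have "valid p" unfolding valid_def
  proof (intro conjI allI impI ballI)
    note bd = validD[OF pts_valid[OF base_pts]]
    fix h
    show "0 \<le> p h" "p h \<le> 1" using bd(2,3) unfolding p_def by auto
    show "p h = 0" if "h \<notin> H" using that bd(1) AS cH unfolding p_def by auto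
    show "p (V - h) = 1 - p h" if h: "h \<in> H" 
      using bd(4)[OF h] A0[of h] h AS cH H_dcompl[OF h] unfolding p_def by auto
  qed
  obtain y where y: "y \<in> s n" "y \<in> V" using H_ne s(1) cH by blast
  have finA: "finite A" by (rule finite_subset[OF _ finite_sep[OF y(2) cv]]) (use y cH cout in \<open>auto simp: A_def\<close>)
  have diff: "{h \<in> H. p h \<noteq> of_bool (v \<in> h)} \<subseteq> A \<union> (\<lambda>h. V - h) ` A"
  proof
    fix h assume h: "h \<in> {h \<in> H. p h \<noteq> of_bool (v \<in> h)}"
    then have "h \<in> A \<or> V - h \<in> A" unfolding p_def base_def by (auto split: if_splits)
    then show "h \<in> A \<union> (\<lambda>h. V - h) ` A" using H_dcompl[of h] h by (metis (no_types, lifting) UnCI image_eqI mem_Collect_eq)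
  qed
  have "joint p p" unfolding joint_def
  proof (intro conjI ballI impI)
    show "\<exists>v\<in>V. finite {h \<in> H. p h \<noteq> of_bool (v \<in> h)}" using diff finA cv by (meson finite_UnI finite_imageI finite_subset)
    fix a b assume ab: "a \<in> H" "b \<in> H" "b \<noteq> V - a" "0 < p a \<or> 0 < p a" "0 < p b \<or> 0 < p b"
    then consider "a \<in> A" "b \<in> A" | "a \<in> A" "v \<in> b" "V - b \<notin> A" | "b \<in> A" "v \<in> a" "V - a \<notin> A" | "v \<in> a" "v \<in> b"
      using ppos by blast
    then show "a \<inter> b \<noteq> {}"
    proof cases
      case 1
      then show ?thesis using cint AS by blast
    next
      case 2
      then show ?thesis using Aup[of a b] ab by blast
    next
      case 3
      then show ?thesis using Aup[of b a] ab by blast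
    qed blast
  qed (use \<open>valid p\<close> in auto)
  then have pp: "p \<in> pts" by (simp add: pts_iff)
  have "p \<in> Y" unfolding Y_def
  proof (intro CollectI conjI pp allI impI)
    fix h assume "\<not> crossing h"
    then show "p h = base h" using AS cH unfolding p_def crossing_def by auto
  qed
  moreover have "real n \<le> dc base p"
  proof -
    have inj: "inj_on s {..<n}" using strict by (intro linorder_inj_onI) auto
    have "p (s i) = 1" "base (s i) = 0" if "i < n" for i
      using anti[of i n] s(1)[of i] that cout cH unfolding p_def A_def base_def by auto
    then have "(\<Sum>k\<in>s ` {..<n}. \<bar>base k - p k\<bar>) = real n" by (simp add: sum.reindex[OF inj])
    moreover have "(\<Sum>k\<in>s ` {..<n}. \<bar>base k - p k\<bar>) \<le> dc base p"
    proof (rule dc_nested_sum[OF base_pts pp])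
      show "s ` {..<n} \<subseteq> H" using s(1) cH by blast
      fix a b assume "a \<in> s ` {..<n}" "b \<in> s ` {..<n}"
      then show "a \<subseteq> b \<or> b \<subseteq> a" using anti by (metis image_iff linear)
    qed simp
    ultimately show ?thesis by simp
  qed
  ultimately show ?thesis by blast
qed

text \<open>As long as \<open>s\<close> is not fully crossed, the members of \<open>S\<close>
  strictly inside \<open>s\<close> have coordinate 0.\<close>

lemma support_bound:
  assumes "p \<in> Y" "s \<in> S" "p s < 1" shows "{h. p h \<noteq> base h} \<subseteq> (\<lambda>h. V - h) ` {j \<in> S. \<not> j \<subset> s} \<union> {j \<in> S. \<not> j \<subset> s}"
proof
  fix h assume h: "h \<in> {h. p h \<noteq> base h}"
  note pd = validD[OF pts_valid[OF Y_pts[OF assms(1)]]]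
  have cr: "crossing h" using h assms(1) unfolding Y_def by blast
  have *: "\<not> j \<subset> s" if j: "j \<in> S" "p j \<noteq> 0" for j
    using pts_mono[OF Y_pts[OF assms(1)], of j s] pd(2)[of j] j assms cH by fastforce
  show "h \<in> (\<lambda>h. V - h) ` {j \<in> S. \<not> j \<subset> s} \<union> {j \<in> S. \<not> j \<subset> s}"
  proof (cases "h \<in> S")
    case True
    then have "base h = 0" using cout cH unfolding base_def by auto
    then show ?thesis using *[OF True] h True by simp
  next
    case False
    then have hH: "h \<in> H" and c: "V - h \<in> S" using cr unfolding crossing_def by auto
    then have "base h = 1" using cout[OF c] cv unfolding base_def by auto
    then have "p (V - h) \<noteq> 0" using h pd(4)[OF hH] by auto
    then show ?thesis using *[OF c] c H_dcompl[OF hH] by (metis (no_types, lifting) UnCI image_eqI mem_Collect_eq)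
  qed
qed

lemma finite_not_psub: "s \<in> S \<Longrightarrow> finite {j \<in> S. \<not> j \<subset> s}"
  by (rule finite_subset[of _ "insert s {j \<in> S. \<not> j \<subseteq> s}"]) (use cfin in auto)

text \<open>A point at distance at most \<open>R < n\<close> cannot have crossed all of
  \<open>n\<close> nested members, and one that is not fully crossed confines its support to a
  finite set. This local finiteness of \<open>Y\<close> is what makes limits of curves
  exist.\<close>

lemma bounded_support:
  obtains F where "finite F" "\<And>p. p \<in> Y \<Longrightarrow> dc base p \<le> R \<Longrightarrow> {h. p h \<noteq> base h} \<subseteq> F"
proof -
  obtain s where s: "\<And>n. s n \<in> S" "\<And>n. s (Suc n) \<subset> s n" using nested_sequence by blast
  have anti: "s j \<subseteq> s i" if "i \<le> j" for i j by (rule lift_Suc_antimono_le[OF _ that]) (use s in blast)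
  have strict: "s j \<subset> s i" if "i < j" for i j 
    using anti[of "Suc i" j] s(2)[of i] that by (metis Suc_leI order_le_less_trans)
  have inj: "inj_on s {..<n}" for n using strict by (intro linorder_inj_onI) auto
  obtain n :: nat where n: "R < real n" using reals_Archimedean2 by blast
  define F where "F = (\<Union>i\<in>{..<n}. (\<lambda>h. V - h) ` {j \<in> S. \<not> j \<subset> s i} \<union> {j \<in> S. \<not> j \<subset> s i})"
  have "finite F" unfolding F_def using finite_not_psub[OF s(1)] by auto
  moreover have "{h. p h \<noteq> base h} \<subseteq> F" if p: "p \<in> Y" "dc base p \<le> R" for p
  proof -
    have "\<exists>i<n. p (s i) < 1"
    proof (rule ccontr)
      assume no: "\<not> ?thesis"
      have "\<bar>base (s i) - p (s i)\<bar> \<ge> 1" if "i < n" for i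
      proof -
        have "base (s i) = 0" using cout[OF s(1)] unfolding base_def by simp
        moreover have "p (s i) \<ge> 1" using no that by force
        ultimately show ?thesis by simp
      qed
      then have "(\<Sum>i<n. 1) \<le> (\<Sum>i<n. \<bar>base (s i) - p (s i)\<bar>)" by (intro sum_mono) simp
      then have "real n \<le> (\<Sum>i<n. \<bar>base (s i) - p (s i)\<bar>)" by simp
      also have "\<dots> = (\<Sum>k\<in>s ` {..<n}. \<bar>base k - p k\<bar>)" by (simp add: sum.reindex[OF inj])
      also have "\<dots> \<le> dc base p"
      proof (rule dc_nested_sum[OF base_pts Y_pts[OF p(1)]])
        show "s ` {..<n} \<subseteq> H" using s(1) cH by blast
        fix a b assume "a \<in> s ` {..<n}" "b \<in> s ` {..<n}"
        then show "a \<subseteq> b \<or> b \<subseteq> a" using anti by (metis image_iff linear)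
      qed simp
      finally show False using p n by simp
    qed
    then obtain i where i: "i < n" "p (s i) < 1" by blast
    have "(\<lambda>h. V - h) ` {j \<in> S. \<not> j \<subset> s i} \<union> {j \<in> S. \<not> j \<subset> s i} \<subseteq> F"
      unfolding F_def using i(1) by (intro subsetI UN_I[of i]) simp_all
    with support_bound[OF p(1) s(1) i(2)] show ?thesis by (rule order_trans)
  qed
  ultimately show ?thesis using that by blast
qed

text \<open>Where the limit has a positive coordinate, so has \<open>x n\<close> eventually. Hence
  \<open>x n\<close> and \<open>p\<close> eventually share a cube, and there the distance is bounded
  by a finite expression in the coordinates that tends to 0.\<close>

lemma limit_point:
  fixes G :: "nat filter"
  assumes G: "G \<noteq> bot" and ev: "eventually (\<lambda>n. x n \<in> Y \<and> {h. x n h \<noteq> base h} \<subseteq> F) G" and F: "finite F"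
    and lim: "\<And>h. ((\<lambda>n. x n h) \<longlongrightarrow> p h) G"
  shows "p \<in> Y" "((\<lambda>n. dc (x n) p) \<longlongrightarrow> 0) G"
proof -
  have evY: "eventually (\<lambda>n. x n \<in> Y) G" using ev by (rule eventually_mono) blast
  have evv: "eventually (\<lambda>n. valid (x n)) G" using evY by (rule eventually_mono) (blast intro: pts_valid Y_pts)
  have off: "p h = base h" if "h \<notin> F" for h
  proof (rule tendsto_unique[OF G lim])
    show "((\<lambda>n. x n h) \<longlongrightarrow> base h) G"
      by (rule tendsto_eventually) (rule eventually_mono[OF ev], use that in blast)
  qed
  have nc: "p h = base h" if "\<not> crossing h" for h
  proof (rule tendsto_unique[OF G lim])
    show "((\<lambda>n. x n h) \<longlongrightarrow> base h) G"
      by (rule tendsto_eventually) (rule eventually_mono[OF evY], use that in \<open>auto simp: Y_def\<close>)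
  qed
  have vp: "valid p" unfolding valid_def
  proof (intro conjI allI impI ballI)
    fix h
    show "p h = 0" if "h \<notin> H" using nc[of h] that unfolding crossing_def base_def by auto
    show "0 \<le> p h" by (rule tendsto_lowerbound[OF lim _ G]) (rule eventually_mono[OF evv], simp add: validD(2))
    show "p h \<le> 1" by (rule tendsto_upperbound[OF lim _ G]) (rule eventually_mono[OF evv], simp add: validD(3))
    show "p (V - h) = 1 - p h" if "h \<in> H"
    proof (rule tendsto_unique[OF G lim])
      have "((\<lambda>n. 1 - x n h) \<longlongrightarrow> 1 - p h) G" by (intro tendsto_intros lim)
      moreover have "eventually (\<lambda>n. 1 - x n h = x n (V - h)) G" 
        by (rule eventually_mono[OF evv]) (simp add: validD(4)[OF _ that])
      ultimately show "((\<lambda>n. x n (V - h)) \<longlongrightarrow> 1 - p h) G" using tendsto_cong by fastforce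
    qed
  qed
  have "eventually (\<lambda>n. \<forall>h\<in>F. 0 < p h \<longrightarrow> 0 < x n h) G"
  proof (rule eventually_ball_finite[OF F], rule ballI)
    fix h show "eventually (\<lambda>n. 0 < p h \<longrightarrow> 0 < x n h) G"
      using order_tendstoD(1)[OF lim, of 0 h] by (cases "0 < p h") (auto elim: eventually_mono)
  qed
  then have evJ: "eventually (\<lambda>n. joint (x n) p) G" using ev
  proof eventually_elim
    case (elim n)
    have xY: "x n \<in> pts" using elim Y_pts by blast
    have pos: "0 < x n h" if "0 < x n h \<or> 0 < p h" for h
    proof (cases "h \<in> F")
      case False
      then have "x n h = p h" using off[OF False] elim(2) by auto
      then show ?thesis using that by auto
    qed (use elim that in blast)
    show ?case unfolding joint_def
    proof (intro conjI ballI impI)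
      show "valid (x n)" using xY pts_valid by blast
      show "valid p" by fact
      show "\<exists>v\<in>V. finite {h \<in> H. x n h \<noteq> of_bool (v \<in> h)}" using xY unfolding pts_iff joint_def by (elim conjE)
      have "{h. x n h \<noteq> p h} \<subseteq> F" using off elim(2) by auto
      then show "finite {h. x n h \<noteq> p h}" using F finite_subset by blast
      fix a b assume ab: "a \<in> H" "b \<in> H" "b \<noteq> V - a" "0 < x n a \<or> 0 < p a" "0 < x n b \<or> 0 < p b"
      then show "a \<inter> b \<noteq> {}" using joint_cons[OF _ ab(1-3), of "x n" "x n"] xY pos[OF ab(4)] pos[OF ab(5)] by (simp add: pts_iff)
    qed
  qed
  show pY: "p \<in> Y"
  proof -
    obtain n where "joint (x n) p" using eventually_happens[OF evJ] G by auto
    then show ?thesis unfolding Y_def using joint_pts(2) nc by blast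
  qed
  have "((\<lambda>n. sqrt ((\<Sum>h\<in>F. (x n h - p h)^2) / 2)) \<longlongrightarrow> sqrt ((\<Sum>h\<in>F. (p h - p h)^2) / 2)) G"
    by (intro tendsto_intros lim) simp_all
  then have L: "((\<lambda>n. sqrt ((\<Sum>h\<in>F. (x n h - p h)^2) / 2)) \<longlongrightarrow> 0) G" by simp
  show "((\<lambda>n. dc (x n) p) \<longlongrightarrow> 0) G"
  proof (rule tendsto_sandwich[OF _ _ tendsto_const L])
    show "eventually (\<lambda>n. 0 \<le> dc (x n) p) G" 
      by (rule eventually_mono[OF evY]) (use dc_nonneg Y_pts pY in blast)
    show "eventually (\<lambda>n. dc (x n) p \<le> sqrt ((\<Sum>h\<in>F. (x n h - p h)^2) / 2)) G" using evJ ev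
    proof eventually_elim
      case (elim n)
      have "{h. x n h \<noteq> p h} \<subseteq> F" using off elim(2) by auto
      then show ?case using dc_local[OF elim(1)] local_dist_superset[OF F, of "x n" p] by simp
    qed
  qed
qed

lemma ex_ray:
  obtains c where "geodesic_ray V E c" "\<And>t. 0 \<le> t \<Longrightarrow> c t \<in> Y" "c 0 = base"
proof -
  have "\<exists>u l. curve u l \<and> u 0 = base \<and> real n \<le> l \<and> 
    (\<forall>s t. 0 \<le> s \<longrightarrow> s \<le> t \<longrightarrow> t \<le> l \<longrightarrow> \<bar>dc (u s) (u t) - (t - s)\<bar> \<le> inverse (real (Suc n)))" for n
  proof -
    obtain p where p: "p \<in> Y" "real n \<le> dc base p" using far_point by blast
    obtain u l where "curve u l" "u 0 = base" "u l = p" "dc base p \<le> l"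
      "\<And>s t. 0 \<le> s \<Longrightarrow> s \<le> t \<Longrightarrow> t \<le> l \<Longrightarrow> \<bar>dc (u s) (u t) - (t - s)\<bar> \<le> inverse (real (Suc n))"
      using near_geodesic[OF base_Y p(1), of "inverse (real (Suc n))"] by auto
    then show ?thesis using p(2) by (intro exI[of _ u] exI[of _ l]) auto
  qed
  then obtain u l where u: "\<And>n. curve (u n) (l n)" "\<And>n. u n 0 = base" "\<And>n. real n \<le> l n"
    "\<And>n s t. 0 \<le> s \<Longrightarrow> s \<le> t \<Longrightarrow> t \<le> l n \<Longrightarrow> \<bar>dc (u n s) (u n t) - (t - s)\<bar> \<le> inverse (real (Suc n))" by metis
  \<comment> \<open>Times are clipped to the interval from 0 to \<open>l n\<close>, so that all
    coordinates lie in \<open>{0..1}\<close> for every \<open>n\<close>.\<close>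
  define x where "x n i = u n (min (max (fst i) 0) (l n)) (snd i)" for n and i :: "real \<times> 'a set"
  have uY: "u n t \<in> Y" if "0 \<le> t" "t \<le> l n" for n t using u(1)[of n] that unfolding curve_def by simp
  have l0: "0 \<le> l n" for n using u(1)[of n] unfolding curve_def by simp
  have "x n i \<in> {0..1}" for n i
  proof -
    have "valid (u n (min (max (fst i) 0) (l n)))" by (intro pts_valid Y_pts uY) (use l0[of n] in auto)
    then show ?thesis unfolding x_def using validD(2,3) by auto
  qed
  then obtain X G where G: "G \<noteq> bot" "G \<le> sequentially" and lim: "\<And>i. ((\<lambda>n. x n i) \<longlongrightarrow> X i) G"
    using cluster_filter[of x] by blast
  define c where "c t h = X (t, h)" for t h
  have ev_l: "eventually (\<lambda>n. t \<le> l n) G" for t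
  proof -
    have "eventually (\<lambda>n. t \<le> real n) sequentially" by real_asymp
    then have "eventually (\<lambda>n. t \<le> l n) sequentially" by (rule eventually_mono) (use u(3) order_trans in blast)
    then show ?thesis using G(2) by (simp add: le_filter_def)
  qed
  have limu: "((\<lambda>n. u n t h) \<longlongrightarrow> c t h) G" if t: "0 \<le> t" for t h
  proof -
    have "eventually (\<lambda>n. x n (t, h) = u n t h) G" using ev_l[of t]
      by (rule eventually_mono) (use t in \<open>simp add: x_def\<close>)
    then show ?thesis using lim[of "(t, h)"] tendsto_cong unfolding c_def by fast
  qed
  have L: "c t \<in> Y \<and> ((\<lambda>n. dc (u n t) (c t)) \<longlongrightarrow> 0) G" if t: "0 \<le> t" for t
  proof -
    \<comment> \<open>The errors are at most 1, so at time \<open>t\<close> all these curves are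
      within distance \<open>t + 1\<close> of \<open>base\<close>.\<close>
    obtain F where F: "finite F" "\<And>p. p \<in> Y \<Longrightarrow> dc base p \<le> t + 1 \<Longrightarrow> {h. p h \<noteq> base h} \<subseteq> F"
      using bounded_support[of "t + 1"] by blast
    have "eventually (\<lambda>n. u n t \<in> Y \<and> {h. u n t h \<noteq> base h} \<subseteq> F) G" using ev_l[of t]
    proof eventually_elim
      case (elim n)
      have "\<bar>dc (u n 0) (u n t) - t\<bar> \<le> inverse (real (Suc n))" using u(4)[of 0 t n] t elim by simp
      moreover have "inverse (real (Suc n)) \<le> 1" by (simp add: field_simps)
      ultimately have "dc base (u n t) \<le> t + 1" using u(2) by (simp add: abs_le_iff)
      then show ?case using uY t elim F by blast
    qed
    from limit_point[OF G(1) this F(1) limu[OF t]] show ?thesis by blast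
  qed
  have eq: "dc (c s) (c t) = t - s" if st: "0 \<le> s" "s \<le> t" for s t
  proof -
    have cs: "c s \<in> pts" "c t \<in> pts" using L st Y_pts by (meson order_trans)+
    have "eventually (\<lambda>n. \<bar>dc (c s) (c t) - (t - s)\<bar> \<le> dc (u n s) (c s) + dc (u n t) (c t) + inverse (real (Suc n))) G"
      using ev_l[of t]
    proof eventually_elim
      case (elim n)
      have up: "u n s \<in> pts" "u n t \<in> pts" using uY Y_pts st elim by auto
      have "dc (c s) (c t) \<le> dc (c s) (u n s) + dc (u n s) (c t)" "dc (u n s) (c t) \<le> dc (u n s) (u n t) + dc (u n t) (c t)"
        "dc (u n s) (u n t) \<le> dc (u n s) (c s) + dc (c s) (u n t)" "dc (c s) (u n t) \<le> dc (c s) (c t) + dc (c t) (u n t)"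
        using dc_triangle cs up by blast+
      moreover have "dc (c s) (u n s) = dc (u n s) (c s)" "dc (c t) (u n t) = dc (u n t) (c t)" by (rule dc_sym)+
      ultimately show ?case using u(4)[OF st elim] by linarith
    qed
    moreover have "((\<lambda>n. inverse (real (Suc n))) \<longlongrightarrow> 0) G" 
      using LIMSEQ_inverse_real_of_nat G(2) by (rule tendsto_mono[rotated])
    then have "((\<lambda>n. dc (u n s) (c s) + dc (u n t) (c t) + inverse (real (Suc n))) \<longlongrightarrow> 0 + 0 + 0) G"
      using L st by (intro tendsto_add) auto
    ultimately have "\<bar>dc (c s) (c t) - (t - s)\<bar> \<le> 0 + 0 + 0" 
      by (intro tendsto_lowerbound[OF _ _ G(1)])
    then show ?thesis by simp
  qed
  have "geodesic_ray V E c" unfolding geodesic_ray_def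
  proof (intro conjI allI impI)
    show "c t \<in> pts" if "0 \<le> t" for t using L that Y_pts by blast
    fix s t :: real assume "0 \<le> s" "0 \<le> t"
    then show "dc (c s) (c t) = \<bar>s - t\<bar>" using eq[of s t] eq[of t s] dc_sym[of "c s" "c t"] by (cases "s \<le> t") auto
  qed
  moreover have "c 0 = base"
  proof
    fix h
    have "((\<lambda>n. u n 0 h) \<longlongrightarrow> base h) G" using u(2) by simp
    then show "c 0 h = base h" using tendsto_unique[OF G(1) limu[of 0 h]] by simp
  qed
  ultimately show ?thesis using that L by blast
qed

text \<open>While \<open>s\<close> is not fully crossed the ray stays within distance
  \<open>card ?F\<close> of its start, whereas at time \<open>t\<close> its distance is
  \<open>t\<close>.\<close>

lemma ray_crosses:
  assumes c: "geodesic_ray V E c" "\<And>t. 0 \<le> t \<Longrightarrow> c t \<in> Y" "c 0 = base" and s: "s \<in> S"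
  obtains T where "\<And>t. T \<le> t \<Longrightarrow> 0 \<le> t \<Longrightarrow> c t s = 1"
proof -
  let ?F = "(\<lambda>h. V - h) ` {j \<in> S. \<not> j \<subset> s} \<union> {j \<in> S. \<not> j \<subset> s}"
  have fin: "finite ?F" using finite_not_psub[OF s] by simp
  have "c t s = 1" if t: "real (card ?F) + 1 \<le> t" "0 \<le> t" for t
  proof (rule ccontr)
    assume n: "c t s \<noteq> 1"
    have "c t s \<le> 1" using c(2)[OF t(2)] Y_pts pts_valid validD(3) by blast
    then have "{h. c t h \<noteq> base h} \<subseteq> ?F" using support_bound[OF c(2)[OF t(2)] s] n by simp
    moreover have "{h. c t h \<noteq> base h} = {h. base h \<noteq> c t h}" by auto
    ultimately have "card {h. base h \<noteq> c t h} \<le> card ?F" using card_mono[OF fin] by simp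
    then have "dc base (c t) \<le> real (card ?F)" using dc_card[OF base_pts Y_pts[OF c(2)[OF t(2)]]] by linarith
    moreover have "dc (c 0) (c t) = t" using c(1) t unfolding geodesic_ray_def by simp
    ultimately show False using c(3) t by simp
  qed
  then show ?thesis using that by blast
qed

text \<open>The coordinate at \<open>s\<close> is 1-Lipschitz along the ray, starts at 0 and ends at
  1.\<close>

lemma ray_hits:
  assumes c: "geodesic_ray V E c" "\<And>t. 0 \<le> t \<Longrightarrow> c t \<in> Y" "c 0 = base" and s: "s \<in> S"
  obtains t where "0 \<le> t" "c t s = 1/2"
proof -
  obtain T where T: "\<And>t. T \<le> t \<Longrightarrow> 0 \<le> t \<Longrightarrow> c t s = 1" using ray_crosses[OF assms] by metis
  let ?b = "max T 0"
  have "continuous_on {0..?b} (\<lambda>t. c t s)" unfolding continuous_on_iff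
  proof (intro ballI allI impI)
    fix t e :: real assume t: "t \<in> {0..?b}" and e: "0 < e"
    have "dist (c t' s) (c t s) < e" if "t' \<in> {0..?b}" "dist t' t < e" for t'
    proof -
      have "\<bar>c t' s - c t s\<bar> \<le> dc (c t') (c t)" using dc_ge Y_pts c(2) t that by simp
      also have "\<dots> = \<bar>t' - t\<bar>" using c(1) t that unfolding geodesic_ray_def by simp
      finally show ?thesis using that by (simp add: dist_real_def)
    qed
    then show "\<exists>d>0. \<forall>x'\<in>{0..?b}. dist x' t < d \<longrightarrow> dist (c x' s) (c t s) < e" using e by blast
  qed
  moreover have "c 0 s \<le> 1/2" using c(3) cout[OF s] unfolding base_def by simp
  moreover have "1/2 \<le> c ?b s" using T[of ?b] by simp
  ultimately obtain t where "0 \<le> t" "c t s = 1/2" using IVT'[of "\<lambda>t. c t s" 0 "1/2" ?b] by auto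
  then show ?thesis using that by blast
qed

text \<open>If at both times all coordinates were 0 or 1, the two points, being at distance 1/2,
  could not differ anywhere. A point strictly between the sides of some \<open>s\<close> is what
  allows a comparison with another ray.\<close>

lemma ray_generic:
  assumes c: "geodesic_ray V E c" "\<And>t. 0 \<le> t \<Longrightarrow> c t \<in> Y" "c 0 = base" and t: "0 \<le> t"
  obtains t' s where "t' = t \<or> t' = t + 1/2" "s \<in> S" "0 < c t' s" "c t' s < 1"
proof (rule ccontr)
  assume nt: "\<not> thesis"
  note found = that
  have Z: "c t' s = 0 \<or> c t' s = 1" if t': "t' = t \<or> t' = t + 1/2" "s \<in> S" for t' s
  proof -
    have "valid (c t')" using t' t c(2)[of t'] Y_pts pts_valid by auto
    then have "0 \<le> c t' s" "c t' s \<le> 1" using validD(2,3) by blast+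
    then show ?thesis using found[OF t'] nt by linarith
  qed
  have Zh: "c t' h = 0 \<or> c t' h = 1" if t': "t' = t \<or> t' = t + 1/2" for t' h
  proof (cases "crossing h")
    case True
    have "c t' \<in> pts" using t' t c(2)[of t'] Y_pts by auto
    then show ?thesis using Z[OF t', of h] Z[OF t', of "V - h"] True validD(4)[OF pts_valid, of "c t'" h] 
      unfolding crossing_def by auto
  next
    case False
    then have "c t' h = base h" using c(2)[of t'] t' t unfolding Y_def by auto
    then show ?thesis unfolding base_def by auto
  qed
  have p: "c t \<in> pts" "c (t + 1/2) \<in> pts" using c(2) t Y_pts by auto
  have D: "dc (c t) (c (t + 1/2)) = 1/2" using c(1) t unfolding geodesic_ray_def by simp
  have "c t = c (t + 1/2)"
  proof
    fix h
    have "\<bar>c t h - c (t + 1/2) h\<bar> \<le> 1/2" using dc_ge[OF p, of h] D by simp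
    then show "c t h = c (t + 1/2) h" using Zh[of t h] Zh[of "t + 1/2" h] by auto
  qed
  then show False using D dc_self[OF p(1)] by simp
qed

end

text \<open>A point strictly between the sides of \<open>s\<close> has positive coordinates at
  \<open>s\<close> and at its complement, so by \<open>pts_mono\<close> its coordinates at
  half-spaces nested with \<open>s\<close> are 0 or 1, as dictated by \<open>s\<close>.\<close>

lemma (in median_complex) equal_at_nested:
  assumes p: "p \<in> pts" "0 < p s" "p s < 1" and q: "q \<in> pts" "0 < q s" "q s < 1"
    and s: "s \<in> H" and j: "j \<in> H" "\<not> transverse V j s" "j \<noteq> s" "j \<noteq> V - s"
  shows "p j = q j"
proof -
  have cs: "0 < r (V - s)" "r (V - s) < 1" if "r \<in> pts" "0 < r s" "r s < 1" for r
    using validD(4)[OF pts_valid[OF that(1)] s] that by simp_all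
  have up: "r x = 1" if "r \<in> pts" "0 < r y" "y \<in> H" "x \<in> H" "y \<subseteq> x" "x \<noteq> y" for r x y
    using pts_mono[OF that(1,3,4)] that by blast
  note V = H_sub[OF s] H_sub[OF j(1)]
  have neg: "r j = 0" if "r \<in> pts" "r (V - j) = 1" for r using validD(4)[OF pts_valid[OF that(1)] j(1)] that by simp
  have ne: "V - j \<noteq> s" "V - j \<noteq> V - s" using j H_dcompl s by metis+
  have "j \<inter> s = {} \<or> j \<inter> (V - s) = {} \<or> (V - j) \<inter> s = {} \<or> (V - j) \<inter> (V - s) = {}"
    using j(2) unfolding transverse_def by blast
  then consider "s \<subseteq> V - j" | "V - s \<subseteq> V - j" | "s \<subseteq> j" | "V - s \<subseteq> j" using V by blast
  then show ?thesis
  proof cases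
    case 1
    then show ?thesis using up[OF p(1,2) s H_compl[OF j(1)] 1 ne(1)] up[OF q(1,2) s H_compl[OF j(1)] 1 ne(1)] neg[OF p(1)] neg[OF q(1)] by simp
  next
    case 2
    then show ?thesis 
      using up[OF p(1) cs(1)[OF p] H_compl[OF s] H_compl[OF j(1)] 2 ne(2)] 
        up[OF q(1) cs(1)[OF q] H_compl[OF s] H_compl[OF j(1)] 2 ne(2)] neg[OF p(1)] neg[OF q(1)] by simp
  next
    case 3
    then show ?thesis using up[OF p(1,2) s j(1) 3 j(3)] up[OF q(1,2) s j(1) 3 j(3)] by simp
  next
    case 4
    then show ?thesis using up[OF p(1) cs(1)[OF p] H_compl[OF s] j(1) 4 j(4)] up[OF q(1) cs(1)[OF q] H_compl[OF s] j(1) 4 j(4)] by simp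
  qed
qed

text \<open>Where both rays cross the same half-space \<open>s\<close>, their points differ only at half-spaces transverse
  to \<open>s\<close>, of which both corridors contain boundedly many.\<close>

lemma (in median_complex) rays_asymptotic:
  assumes R1: "corridor_ray V E v1 S1" and R2: "corridor_ray V E v2 S2"
    and c1: "geodesic_ray V E c1" "\<And>t. 0 \<le> t \<Longrightarrow> c1 t \<in> corridor_ray.Y V E v1 S1" "c1 0 = corridor_ray.base V E v1"
    and c2: "geodesic_ray V E c2" "\<And>t. 0 \<le> t \<Longrightarrow> c2 t \<in> corridor_ray.Y V E v2 S2" "c2 0 = corridor_ray.base V E v2"
    and fin: "finite (S1 - S2)"
    and b1: "\<And>s. s \<in> S1 \<Longrightarrow> card {j \<in> S1. transverse V j s} \<le> C1"
    and b2: "\<And>s. s \<in> S2 \<Longrightarrow> card {j \<in> S2. transverse V j s} \<le> C2"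
  shows "\<exists>B. \<forall>t\<ge>0. cdist V E (c1 t) (c2 t) \<le> B"
proof -
  interpret R1: corridor_ray V E v1 S1 by fact
  interpret R2: corridor_ray V E v2 S2 by fact
  have p1: "c1 t \<in> pts" and p2: "c2 t \<in> pts" if "0 \<le> t" for t using c1(2) c2(2) R1.Y_pts R2.Y_pts that by blast+
  have g1: "dc (c1 s) (c1 t) = \<bar>s - t\<bar>" and g2: "dc (c2 s) (c2 t) = \<bar>s - t\<bar>" if "0 \<le> s" "0 \<le> t" for s t
    using c1(1) c2(1) that unfolding geodesic_ray_def by blast+
  define W where "W = {h. R1.base h \<noteq> R2.base h}"
  have finW: "finite W" unfolding W_def by (rule finite_diff[OF R1.base_pts R2.base_pts])
  \<comment> \<open>This counts where the two points can differ: at \<open>s\<close> and its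
    complement, at two half-spaces for each transverse member of either corridor, and where the base
    points differ.\<close>
  define K where "K = 2 + 2 * C1 + 2 * C2 + card W"
  have "\<exists>T. \<forall>t. T \<le> t \<longrightarrow> 0 \<le> t \<longrightarrow> c1 t s = 1" if "s \<in> S1" for s
    using R1.ray_crosses[OF c1 that] by metis
  then obtain T where T: "\<And>s t. s \<in> S1 \<Longrightarrow> T s \<le> t \<Longrightarrow> 0 \<le> t \<Longrightarrow> c1 t s = 1" by metis
  \<comment> \<open>After \<open>T0\<close> the first ray has fully crossed the finitely many
    members of \<open>S1\<close> outside \<open>S2\<close>, so the half-space it is crossing belongs
    to both corridors.\<close>
  define T0 where "T0 = (\<Sum>s\<in>S1 - S2. \<bar>T s\<bar>)"
  have fintr: "finite {j \<in> S. transverse V j s}" if "corridor_ray V E v S" "s \<in> S" for v S s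
    by (rule finite_subset[OF _ corridor_ray.cfin[OF that]]) (use transverse_not_sub(1) in blast)
  have near: "\<exists>t1 t2. 0 \<le> t1 \<and> 0 \<le> t2 \<and> \<bar>t - t1\<bar> \<le> 1/2 \<and> dc (c1 t1) (c2 t2) \<le> K" if t: "T0 \<le> t" "0 \<le> t" for t
  proof -
    obtain t1 s where t1: "t1 = t \<or> t1 = t + 1/2" "s \<in> S1" "0 < c1 t1 s" "c1 t1 s < 1"
      using R1.ray_generic[OF c1 t(2)] by blast
    have t10: "0 \<le> t1" "T0 \<le> t1" using t1 t by auto
    have sS2: "s \<in> S2"
    proof (rule ccontr)
      assume "s \<notin> S2"
      then have "\<bar>T s\<bar> \<le> T0" unfolding T0_def using t1 fin by (intro member_le_sum) auto
      then have "c1 t1 s = 1" using T[OF t1(2), of t1] t10 by linarith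
      then show False using t1 by simp
    qed
    obtain t2 where t2: "0 \<le> t2" "c2 t2 s = 1/2" using R2.ray_hits[OF c2 sS2] by blast
    have sH: "s \<in> H" using t1 R1.cH by blast
    let ?A1 = "{j \<in> S1. transverse V j s}" and ?A2 = "{j \<in> S2. transverse V j s}"
    have fA: "finite ?A1" "finite ?A2" using fintr R1 R2 t1 sS2 by blast+
    let ?co = "\<lambda>h. V - h"
    have sub: "{j. c1 t1 j \<noteq> c2 t2 j} \<subseteq> {s, V - s} \<union> (?A1 \<union> ?co ` ?A1) \<union> (?A2 \<union> ?co ` ?A2) \<union> W"
    proof
      fix j assume j: "j \<in> {j. c1 t1 j \<noteq> c2 t2 j}"
      have jH: "j \<in> H"
        using j validD(1)[OF pts_valid[OF p1[OF t10(1)]]] validD(1)[OF pts_valid[OF p2[OF t2(1)]]] by (cases "j \<in> H") auto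
      show "j \<in> {s, V - s} \<union> (?A1 \<union> ?co ` ?A1) \<union> (?A2 \<union> ?co ` ?A2) \<union> W"
      proof (cases "j = s \<or> j = V - s")
        case False
        then have tr: "transverse V j s"
          using equal_at_nested[OF p1[OF t10(1)] t1(3,4) p2[OF t2(1)] _ _ sH jH] t2(2) j by auto
        have trc: "transverse V (V - j) s" using tr transverse_compl(1)[OF H_sub[OF jH]] by blast
        have jc: "j = V - (V - j)" using H_dcompl[OF jH] by simp
        have mem: "j \<in> {j \<in> S. transverse V j s} \<union> ?co ` {j \<in> S. transverse V j s}" if "j \<in> S \<or> V - j \<in> S" for S
          using that tr trc jc by blast
        show ?thesis
        proof (cases "R1.crossing j \<or> R2.crossing j")
          case True
          then show ?thesis using mem[of S1] mem[of S2] unfolding R1.crossing_def R2.crossing_def by blast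
        next
          case False
          then have "c1 t1 j = R1.base j" "c2 t2 j = R2.base j" 
            using c1(2)[OF t10(1)] c2(2)[OF t2(1)] unfolding R1.Y_def R2.Y_def by blast+
          then show ?thesis using j unfolding W_def by simp
        qed
      qed blast
    qed
    have "card {j. c1 t1 j \<noteq> c2 t2 j} \<le> card ({s, V - s} \<union> (?A1 \<union> ?co ` ?A1) \<union> (?A2 \<union> ?co ` ?A2) \<union> W)"
      by (rule card_mono[OF _ sub]) (use fA finW in simp)
    also have "\<dots> \<le> card {s, V - s} + (card ?A1 + card ?A1) + (card ?A2 + card ?A2) + card W"
    proof -
      have *: "card (A \<union> ?co ` A) \<le> card A + card A" if "finite A" for A
        using card_Un_le[of A "?co ` A"] card_image_le[OF that, of ?co] by linarith
      show ?thesis using card_Un_le[of "{s, V - s} \<union> (?A1 \<union> ?co ` ?A1) \<union> (?A2 \<union> ?co ` ?A2)" W]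
          card_Un_le[of "{s, V - s} \<union> (?A1 \<union> ?co ` ?A1)" "?A2 \<union> ?co ` ?A2"]
          card_Un_le[of "{s, V - s}" "?A1 \<union> ?co ` ?A1"] *[OF fA(1)] *[OF fA(2)] by linarith
    qed
    also have "\<dots> \<le> K" unfolding K_def using b1[OF t1(2)] b2[OF sS2] sH by simp
    finally have "dc (c1 t1) (c2 t2) \<le> K" using dc_card[OF p1[OF t10(1)] p2[OF t2(1)]] by linarith
    then show ?thesis using t10 t2 t1 by (intro exI[of _ t1] exI[of _ t2]) auto
  qed
  let ?d = "dc (c1 0) (c2 0)"
  have "dc (c1 t) (c2 t) \<le> 2 * T0 + 2 * K + ?d + 1" if t: "0 \<le> t" for t
  proof (cases "T0 \<le> t")
    case True
    obtain t1 t2 where n: "0 \<le> t1" "0 \<le> t2" "\<bar>t - t1\<bar> \<le> 1/2" "dc (c1 t1) (c2 t2) \<le> K" using near[OF True t] by blast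
    have "dc (c1 0) (c1 t1) \<le> dc (c1 0) (c2 0) + dc (c2 0) (c1 t1)" "dc (c2 0) (c1 t1) \<le> dc (c2 0) (c2 t2) + dc (c2 t2) (c1 t1)"
      "dc (c2 0) (c2 t2) \<le> dc (c2 0) (c1 0) + dc (c1 0) (c2 t2)" "dc (c1 0) (c2 t2) \<le> dc (c1 0) (c1 t1) + dc (c1 t1) (c2 t2)"
      by (rule dc_triangle; use p1 p2 n in simp)+
    \<comment> \<open>Both rays have unit speed and start at distance \<open>?d\<close>, so nearby
      points are reached at nearly equal times.\<close>
    then have "\<bar>t1 - t2\<bar> \<le> ?d + K" using g1[of 0 t1] g2[of 0 t2] n dc_sym[of "c2 0" "c1 0"] dc_sym[of "c2 t2" "c1 t1"] by simp
    moreover have "dc (c1 t) (c2 t) \<le> dc (c1 t) (c1 t1) + dc (c1 t1) (c2 t)" "dc (c1 t1) (c2 t) \<le> dc (c1 t1) (c2 t2) + dc (c2 t2) (c2 t)"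
      by (rule dc_triangle; use p1 p2 n t in simp)+
    moreover have "dc (c1 t) (c1 t1) = \<bar>t - t1\<bar>" "dc (c2 t2) (c2 t) = \<bar>t2 - t\<bar>" using g1 g2 n t by blast+
    moreover have "0 \<le> T0" unfolding T0_def by (simp add: sum_nonneg)
    ultimately show ?thesis using n by linarith
  next
    case False
    have "dc (c1 t) (c2 t) \<le> dc (c1 t) (c1 0) + dc (c1 0) (c2 t)" "dc (c1 0) (c2 t) \<le> dc (c1 0) (c2 0) + dc (c2 0) (c2 t)"
      by (rule dc_triangle; use p1 p2 t in simp)+
    then show ?thesis using g1[of t 0] g2[of 0 t] t False by simp
  qed
  then show ?thesis by blast
qed

context cube_action
begin

section \<open>Sectors and strongly separated half-spaces\<close>

definition "flips \<longleftrightarrow> (\<forall>h\<in>H. \<exists>g\<in>carrier G. g \<star> h \<inter> h = {})"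

lemma flipE:
  assumes flips "h \<in> H" obtains g where "g \<in> carrier G" "g \<star> h \<subseteq> V - h"
proof -
  obtain g where g: "g \<in> carrier G" "g \<star> h \<inter> h = {}" using assms unfolding flips_def by blast
  moreover have "g \<star> h \<subseteq> V" using image_sub_V[OF g(1)] H_sub[OF assms(2)] by blast
  ultimately show ?thesis using that by blast
qed

lemma flip_into:
  assumes fl: flips and l: "l \<in> H" "k \<in> H" "l \<subseteq> k"
  shows "\<exists>g\<in>carrier G. g \<star> (V - l) \<subseteq> V - k"
proof -
  obtain a where a: "a \<in> carrier G" "a \<star> (V - l) \<subseteq> V - (V - l)" using flipE[OF fl, of "V - l"] l by auto
  obtain b where b: "b \<in> carrier G" "b \<star> k \<subseteq> V - k" using flipE[OF fl l(2)] by blast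
  have "a \<star> (V - l) \<subseteq> k" using a l H_dcompl[OF l(1)] by auto
  then have "b \<star> a \<star> (V - l) \<subseteq> V - k" using b(2) by blast
  then show ?thesis using a(1) b(1) image_mult[of b a "V - l"] by (metis Diff_subset m_closed)
qed

text \<open>Compose two flips: one sends \<open>k\<close> into its complement, hence into that of
  \<open>l\<close>; the other sends the complement of \<open>l\<close> into
  \<open>l\<close>.\<close>

lemma double_skewer:
  assumes fl: flips and l: "l \<in> H" "k \<in> H" "l \<subseteq> k"
  shows "\<exists>g\<in>carrier G. g \<star> k \<subseteq> l"
proof -
  obtain a where a: "a \<in> carrier G" "a \<star> (V - l) \<subseteq> V - (V - l)" using flipE[OF fl, of "V - l"] l by auto
  obtain b where b: "b \<in> carrier G" "b \<star> k \<subseteq> V - k" using flipE[OF fl l(2)] by blast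
  have "b \<star> k \<subseteq> V - l" using b l by blast
  then have "a \<star> b \<star> k \<subseteq> l" using a H_dcompl[OF l(1)] by auto
  then show ?thesis using a(1) b(1) image_mult[of a b k] H_sub[OF l(2)] by (metis m_closed)
qed

lemma not_transverse_cases:
  assumes "\<not> transverse V h k" "h \<subseteq> V" "k \<subseteq> V"
  obtains "h \<subseteq> V - k" | "h \<subseteq> k" | "V - h \<subseteq> V - k" | "V - h \<subseteq> k"
proof -
  have "h \<inter> k = {} \<or> h \<inter> (V - k) = {} \<or> (V - h) \<inter> k = {} \<or> (V - h) \<inter> (V - k) = {}"
    using assms(1) unfolding transverse_def by blast
  then show ?thesis using that assms(2,3) by blast
qed

lemma nestedI:
  "h \<subseteq> k \<Longrightarrow> \<not> transverse V h k" "h \<subseteq> V - k \<Longrightarrow> \<not> transverse V h k"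
  "k \<subseteq> h \<Longrightarrow> \<not> transverse V h k" "k \<subseteq> V - h \<Longrightarrow> \<not> transverse V h k"
  unfolding transverse_def by blast+

section \<open>Sectors that contain a half-space\<close>

definition "occupied a b \<longleftrightarrow> (\<exists>m\<in>H. m \<subseteq> a \<and> m \<subseteq> b)"

lemma occupiedI: "m \<in> H \<Longrightarrow> m \<subseteq> a \<Longrightarrow> m \<subseteq> b \<Longrightarrow> occupied a b"
  unfolding occupied_def by blast

lemma occupied_sym: "occupied a b \<longleftrightarrow> occupied b a"
  unfolding occupied_def by blast

text \<open>If no half-space inside the complement of \<open>k\<close> were nested with \<open>h\<close>, then the preimages of \<open>h\<close>
  under elements mapping ever smaller half-spaces to the complement of \<open>k\<close> would be pairwise transverse.\<close>

lemma sector_step: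
  assumes fl: flips and hk: "h \<in> H" "k \<in> H" "transverse V h k" and occ: "occupied h k"
  shows "occupied h (V - k) \<or> occupied (V - h) (V - k)"
proof (rule ccontr)
  assume no: "\<not> ?thesis"
  have hV: "h \<subseteq> V" "k \<subseteq> V" using hk H_sub by blast+
  have ne: "h \<inter> k \<noteq> {}" "(V - h) \<inter> k \<noteq> {}" using hk(3) unfolding transverse_def by blast+
  \<comment> \<open>A half-space in the complement of \<open>k\<close> contains no side of
    \<open>h\<close>, since both sides meet \<open>k\<close>; if it were nested with
    \<open>h\<close>, it would lie in a side of \<open>h\<close> and occupy a forbidden
    sector.\<close>
  have all: "transverse V m h" if m: "m \<in> H" "m \<subseteq> V - k" for m
  proof (rule ccontr)
    assume "\<not> transverse V m h"
    from this H_sub[OF m(1)] hV(1) show False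
    proof (cases rule: not_transverse_cases)
      case 1
      then show ?thesis using no occupiedI[OF m(1) _ m(2)] by blast
    next
      case 2
      then show ?thesis using no occupiedI[OF m(1) _ m(2)] by blast
    next
      case 3
      then have "h \<subseteq> m" using hV(1) by blast
      then show ?thesis using m ne by blast
    next
      case 4
      then have "V - h \<subseteq> m" using hV(1) by blast
      then show ?thesis using m ne by blast
    qed
  qed
  obtain l where l: "l \<in> H" "l \<subseteq> h" "l \<subseteq> k" using occ unfolding occupied_def by blast
  have lV: "l \<subseteq> V" using l H_sub by blast
  have "\<exists>T l'. transverse_family T \<and> finite T \<and> card T = n \<and> l' \<in> H \<and> l' \<subseteq> k \<and> (\<forall>t\<in>T. l' \<subseteq> t)" for n
  proof (induction n)
    case 0
    show ?case using l by (intro exI[of _ "{}"] exI[of _ l]) (simp add: transverse_family_def)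
  next
    case (Suc n)
    then obtain T l' where T: "transverse_family T" "finite T" "card T = n" and l': "l' \<in> H" "l' \<subseteq> k" "\<forall>t\<in>T. l' \<subseteq> t" by blast
    have l'V: "l' \<subseteq> V" using l' H_sub by blast
    \<comment> \<open>The complement of each \<open>t\<close> in \<open>T\<close> lies in that of
      \<open>l'\<close>, so \<open>g\<close> sends it into the complement of \<open>k\<close>, where
      everything is transverse to \<open>h\<close>. Pulling \<open>h\<close> back by
      \<open>g\<close> gives the new member.\<close>
    obtain g where g: "g \<in> carrier G" "g \<star> (V - l') \<subseteq> V - k" using flip_into[OF fl l'(1) hk(2) l'(2)] by blast
    let ?h = "inv g \<star> h"
    let ?l = "inv g \<star> l"
    have tr: "transverse V t ?h" if t: "t \<in> T" for t
    proof -
      have tH: "t \<in> H" "t \<subseteq> V" using T(1) t H_sub unfolding transverse_family_def by blast+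
      have "V - t \<subseteq> V - l'" using l' t by blast
      then have "g \<star> (V - t) \<subseteq> V - k" using g(2) by blast
      then have "transverse V (g \<star> (V - t)) h" using all[OF H_act] g(1) tH by simp
      then have "transverse V (g \<star> (V - t)) (g \<star> ?h)" using image_inv' g(1) hV by simp
      then have "transverse V (V - t) ?h" using image_transverse[OF g(1), of "V - t" ?h] image_sub_V g(1) hV by simp
      then show ?thesis using transverse_compl tH by metis
    qed
    have "?h \<notin> T" using tr transverse_not_sub(4) by blast
    moreover have "transverse_family (insert ?h T)" by (rule transverse_family_insert[OF T(1) _ tr]) (use H_act g hk in simp)
    moreover have "?l \<subseteq> l'"
    proof -
      have "V - k \<subseteq> V - l" using l by blast
      then have "g \<star> (V - l') \<subseteq> V - l" using g(2) by blast
      then have "inv g \<star> g \<star> (V - l') \<subseteq> inv g \<star> (V - l)" by blast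
      then have "V - l' \<subseteq> V - ?l" using image_inv[OF g(1), of "V - l'"] image_compl[of "inv g" l] g(1) lV by simp
      then show ?thesis using image_sub_V[of "inv g" l] g(1) lV l'V by blast
    qed
    moreover have "?l \<subseteq> ?h" using l by blast
    moreover have "?l \<in> H" using H_act g l by simp
    moreover have "\<forall>t\<in>insert ?h T. ?l \<subseteq> t" 
      using calculation(3,4) l'(3) by (metis insert_iff order_trans)
    moreover have "?l \<subseteq> k" using calculation(3) l'(2) by (rule order_trans)
    ultimately have "transverse_family (insert ?h T) \<and> finite (insert ?h T) \<and> card (insert ?h T) = Suc n \<and> ?l \<in> H \<and> ?l \<subseteq> k
        \<and> (\<forall>t\<in>insert ?h T. ?l \<subseteq> t)" using T(2,3) by (simp only: card_insert_disjoint finite_insert) simp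
    then show ?case by blast
  qed
  then show False using no_large_transverse_family by metis
qed

definition "opposite h k \<longleftrightarrow> occupied h k \<and> occupied (V - h) (V - k) \<or> occupied h (V - k) \<and> occupied (V - h) k"

text \<open>A step across \<open>k\<close> reaches the opposite sector or the neighbour on the same
  side of \<open>h\<close>. In the second case a step across \<open>h\<close> reaches either the
  sector opposite to that neighbour or the one opposite to the original.\<close>

lemma opposite_occupied:
  assumes fl: flips and hk: "h \<in> H" "k \<in> H" "transverse V h k" and occ: "occupied h k"
  shows "opposite h k"
proof (cases "occupied (V - h) (V - k)")
  case False
  then have o1: "occupied h (V - k)" using sector_step[OF assms] by blast
  have tr: "transverse V (V - k) h" using hk transverse_compl H_sub transverse_sym by metis
  have "occupied (V - k) (V - h) \<or> occupied (V - (V - k)) (V - h)"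
    by (rule sector_step[OF fl _ hk(1) tr]) (use hk o1 occupied_sym in auto)
  then show ?thesis using False o1 H_dcompl[OF hk(2)] occupied_sym unfolding opposite_def by metis
qed (use occ opposite_def in blast)

lemma opposite_compl:
  assumes "h \<in> H" "k \<in> H" shows "opposite (V - h) k \<longleftrightarrow> opposite h k" "opposite h (V - k) \<longleftrightarrow> opposite h k"
  unfolding opposite_def using H_dcompl assms by metis+

text \<open>Up to complements \<open>l\<close> lies in a side of \<open>h\<close>. By transversality
  it contains no side of \<open>k\<close>, so being nested with \<open>k\<close> it lies in a side
  of \<open>k\<close> too and occupies a sector.\<close>

lemma opposite_if_nested:
  assumes fl: flips and hk: "h \<in> H" "k \<in> H" "transverse V h k" 
    and l: "l \<in> H" "\<not> transverse V l h" "\<not> transverse V l k"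
  shows "opposite h k"
proof -
  note V = H_sub[OF hk(1)] H_sub[OF hk(2)] H_sub[OF l(1)]
  have compl: "transverse V (V - h) k" "transverse V h (V - k)" "transverse V (V - h) (V - k)"
    using hk V transverse_compl by metis+
  have *: "opposite x k" if x: "x = h \<or> x = V - h" "m \<in> H" "m \<subseteq> x" "\<not> transverse V m k" for m x
  proof -
    have xH: "x \<in> H" and xtr: "transverse V x k" "transverse V x (V - k)" using x hk compl by auto
    show ?thesis using x(4) H_sub[OF x(2)] V(2)
    proof (cases rule: not_transverse_cases)
      case 1
      then have "opposite x (V - k)" using opposite_occupied[OF fl xH H_compl[OF hk(2)] xtr(2)] x unfolding occupied_def by blast
      then show ?thesis using opposite_compl xH hk by blast
    next
      case 2
      then show ?thesis using opposite_occupied[OF fl xH hk(2) xtr(1)] x unfolding occupied_def by blast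
    next
      case 3
      then have "k \<subseteq> x" using x V by blast
      then show ?thesis using xtr transverse_not_sub by blast
    next
      case 4
      then have "V - k \<subseteq> x" using x V by blast
      then show ?thesis using xtr transverse_not_sub by blast
    qed
  qed
  have l': "\<not> transverse V (V - l) k" using l(3) V transverse_compl by metis
  have hh: "opposite h k" if "opposite (V - h) k" using that opposite_compl hk by blast
  show ?thesis using l(2) V(3,1)
  proof (cases rule: not_transverse_cases)
    case 1 then show ?thesis using *[of "V - h" l] l hh by blast
  next
    case 2 then show ?thesis using *[of h l] l by blast
  next
    case 3 then show ?thesis using *[of "V - h" "V - l"] l' l(1) hh by simp
  next
    case 4 then show ?thesis using *[of h "V - l"] l' l(1) by simp
  qed
qed

end

section \<open>Irreducible factors and strong separation\<close>

locale irreducible_blocks = cube_action +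
  fixes P :: "'a set set set"
  assumes P: "irreducible_decomposition V E P"
begin

lemma P_Union: "\<Union>P = H" using P unfolding irreducible_decomposition_def by simp

lemma P_ne: "B \<in> P \<Longrightarrow> B \<noteq> {}" using P unfolding irreducible_decomposition_def by auto

lemma P_H: "B \<in> P \<Longrightarrow> h \<in> B \<Longrightarrow> h \<in> H" using P_Union by blast

lemma P_compl: "B \<in> P \<Longrightarrow> h \<in> B \<Longrightarrow> V - h \<in> B" using P unfolding irreducible_decomposition_def by simp

lemma P_disj: "B \<in> P \<Longrightarrow> B' \<in> P \<Longrightarrow> h \<in> B \<Longrightarrow> h \<in> B' \<Longrightarrow> B = B'" 
  using P unfolding irreducible_decomposition_def by (elim conjE) (meson disjoint_iff)

lemma P_transverse: "B \<in> P \<Longrightarrow> B' \<in> P \<Longrightarrow> B \<noteq> B' \<Longrightarrow> h \<in> B \<Longrightarrow> k \<in> B' \<Longrightarrow> transverse V h k" 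
  using P unfolding irreducible_decomposition_def by simp

lemma P_irreducible:
  assumes "B \<in> P" "C \<subseteq> B" "C \<noteq> {}" "C \<noteq> B" "\<And>h. h \<in> C \<Longrightarrow> V - h \<in> C"
  shows "\<exists>c\<in>C. \<exists>k\<in>B - C. \<not> transverse V c k"
proof (rule ccontr)
  assume n: "\<not> ?thesis"
  have "V - h \<in> B - C" if h: "h \<in> B - C" for h
    using P_compl[OF assms(1), of h] assms(5)[of "V - h"] H_dcompl[OF P_H[OF assms(1), of h]] h by auto
  then have "C \<noteq> {} \<and> B - C \<noteq> {} \<and> C \<union> (B - C) = B \<and> C \<inter> (B - C) = {} \<and> (\<forall>h\<in>C. V - h \<in> C) \<and>
     (\<forall>h\<in>B - C. V - h \<in> B - C) \<and> (\<forall>h\<in>C. \<forall>k\<in>B - C. transverse V h k)"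
    using n assms by (intro conjI) auto
  moreover have "\<not> (\<exists>B1 B2. B1 \<noteq> {} \<and> B2 \<noteq> {} \<and> B1 \<union> B2 = B \<and> B1 \<inter> B2 = {}
            \<and> (\<forall>h\<in>B1. V - h \<in> B1) \<and> (\<forall>h\<in>B2. V - h \<in> B2)
            \<and> (\<forall>h\<in>B1. \<forall>k\<in>B2. transverse V h k))"
    using P assms(1) unfolding irreducible_decomposition_def by simp
  ultimately show False by metis
qed

lemma nested_block:
  assumes "B \<in> P" "h \<in> B" "k \<in> H" "\<not> transverse V h k" shows "k \<in> B"
proof -
  obtain B' where "B' \<in> P" "k \<in> B'" using P_Union assms(3) by blast
  then show ?thesis using P_transverse[OF assms(1), of B' h k] assms by blast
qed

text \<open>Irreducibility connects \<open>h\<close> and \<open>k\<close> by nested pairs; the point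
  is that one intermediate half-space suffices. Let \<open>l\<close> be nested with \<open>h\<close>
  and \<open>c\<close>, and \<open>c\<close> with \<open>k\<close>. If \<open>c\<close> is
  transverse to \<open>h\<close>, then \<open>opposite h c\<close> provides inside either side of
  \<open>c\<close> a half-space nested with \<open>h\<close>, and one side of \<open>c\<close> lies
  in a side of \<open>k\<close>.\<close>

lemma opposite_block:
  assumes fl: flips and B: "B \<in> P" "h \<in> B" "k \<in> B" and tr: "transverse V h k"
  shows "opposite h k"
proof -
  note hH = P_H[OF B(1,2)]
  note hV = H_sub[OF hH]
  define C where "C = {k \<in> B. \<exists>l\<in>H. \<not> transverse V l h \<and> \<not> transverse V l k}"
  have "C = B"
  proof (rule ccontr)
    assume ne: "C \<noteq> B"
    have "h \<in> C" unfolding C_def using B hH nestedI(1)[of h h] by blast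
    moreover have "V - k \<in> C" if k: "k \<in> C" for k
    proof -
      have kB: "k \<in> B" using k unfolding C_def by blast
      then have kV: "k \<subseteq> V" using P_H[OF B(1)] H_sub by blast
      obtain l where "l \<in> H" "\<not> transverse V l h" "\<not> transverse V l k" using k unfolding C_def by blast
      then show ?thesis unfolding C_def using P_compl[OF B(1) kB] transverse_compl(2)[OF kV] by blast
    qed
    ultimately obtain c k where ck: "c \<in> C" "k \<in> B - C" "\<not> transverse V c k"
      using P_irreducible[OF B(1), of C] ne unfolding C_def by blast
    obtain l where l: "l \<in> H" "\<not> transverse V l h" "\<not> transverse V l c" and cB: "c \<in> B" 
      using ck unfolding C_def by blast
    note cH = P_H[OF B(1) cB]
    have kH: "k \<in> H" using ck P_H[OF B(1)] by blast
    note V = H_sub[OF cH] H_sub[OF kH]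
    have "\<exists>l\<in>H. \<not> transverse V l h \<and> \<not> transverse V l k"
    proof (cases "transverse V h c")
      case True
      then have opp: "opposite h c" using opposite_if_nested[OF fl hH cH True l] by blast
      have *: "\<exists>a\<in>H. \<not> transverse V a h \<and> a \<subseteq> e" if e: "e = c \<or> e = V - c" for e
      proof -
        have "occupied h e \<or> occupied (V - h) e" using opp e unfolding opposite_def by blast
        then show ?thesis using nestedI(1,2) unfolding occupied_def by metis
      qed
      have "\<exists>e. (e = c \<or> e = V - c) \<and> (e \<subseteq> k \<or> e \<subseteq> V - k)"
        using ck(3) V by (cases rule: not_transverse_cases) blast+
      then obtain e where e: "e = c \<or> e = V - c" "e \<subseteq> k \<or> e \<subseteq> V - k" by blast
      obtain a where a: "a \<in> H" "\<not> transverse V a h" "a \<subseteq> e" using *[OF e(1)] by blast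
      have "\<not> transverse V a k" using nestedI(1,2) a(3) e(2) by (metis order_trans)
      then show ?thesis using a by blast
    next
      case False
      then show ?thesis using ck(3) cH transverse_sym by metis
    qed
    then show False using ck(2) unfolding C_def by blast
  qed
  then obtain l where "l \<in> H" "\<not> transverse V l h" "\<not> transverse V l k" using B(3) unfolding C_def by blast
  then show ?thesis using opposite_if_nested[OF fl hH P_H[OF B(1,3)] tr] by blast
qed

text \<open>A half-space transverse to two half-spaces in opposite corners of a transverse family is
  transverse to the whole family; so without strongly separated pairs transverse families would grow forever.
  Only opposite corners need be occupied, whence three nested levels are used to match the orientations.\<close>

lemma ex_strongly_separated:
  assumes fl: flips and B: "B \<in> P"
  shows "\<exists>h\<in>B. \<exists>k\<in>B. k \<subseteq> h \<and> strongly_separated V B k h"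
proof (rule ccontr)
  assume no: "\<not> ?thesis"
  have "\<exists>T a c. transverse_family T \<and> finite T \<and> card T = n \<and> T \<subseteq> B \<and> a \<in> B \<and> c \<in> B \<and> a \<subseteq> c \<and> (\<forall>t\<in>T. a \<subseteq> t \<and> t \<subseteq> c)" for n
  proof (induction n)
    case 0
    obtain h where "h \<in> B" using P_ne[OF B] by blast
    then show ?case by (intro exI[of _ "{}"] exI[of _ h]) (simp add: transverse_family_def)
  next
    case (Suc n)
    then obtain T a c where T: "transverse_family T" "finite T" "card T = n" "T \<subseteq> B" and ac: "a \<in> B" "c \<in> B" "a \<subseteq> c" 
      and bt: "\<forall>t\<in>T. a \<subseteq> t \<and> t \<subseteq> c" by (elim exE conjE) (rule that; assumption)
    have acH: "a \<in> H" "c \<in> H" using P_H[OF B] ac by blast+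
    note acV = acH[THEN H_sub]
    \<comment> \<open>Translating by \<open>g\<close> gives a second copy of the family, between
      \<open>a2\<close> and \<open>a\<close>, below the one between \<open>a\<close> and
      \<open>c\<close>.\<close>
    obtain g where g: "g \<in> carrier G" "g \<star> c \<subseteq> a" using double_skewer[OF fl acH ac(3)] by blast
    define a2 where "a2 = g \<star> a"
    have a2: "a2 \<subseteq> g \<star> c" "a2 \<subseteq> a" "a2 \<in> H" unfolding a2_def using ac g H_act[OF g(1) acH(1)] by blast+
    have inB: "x \<in> B" if "x \<in> H" "x \<subseteq> a" for x using nested_block[OF B ac(1) that(1)] nestedI(3)[OF that(2)] by blast
    have a2B: "a2 \<in> B" using inB a2 by blast
    \<comment> \<open>As \<open>a2\<close> and \<open>c\<close> are not strongly separated, some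
      \<open>j\<close> is transverse to both, hence to everything between them and so to both
      copies.\<close>
    obtain j where j: "j \<in> B" "transverse V j a2" "transverse V j c"
      using no a2B ac a2 unfolding strongly_separated_def by (meson order_trans)
    note jH = P_H[OF B j(1)]
    have jt: "transverse V x j" if "a2 \<subseteq> x" "x \<subseteq> c" for x using transverse_mono[OF j(2,3) that] transverse_sym by metis
    define T2 where "T2 = (\<lambda>t. g \<star> t) ` T"
    have T2: "finite T2" "card T2 = n" "T2 \<subseteq> B" "\<forall>t\<in>T2. a2 \<subseteq> t \<and> t \<subseteq> a" "transverse_family T2"
    proof -
      have TH: "t \<in> H" "t \<subseteq> V" if "t \<in> T" for t using T(4) that P_H[OF B] H_sub by blast+
      show "finite T2" unfolding T2_def using T by simp
      have "inj_on (\<lambda>t. g \<star> t) T" using TH image_eq[OF g(1)] by (intro inj_onI) metis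
      then show "card T2 = n" unfolding T2_def using T card_image by blast
      show b: "\<forall>t\<in>T2. a2 \<subseteq> t \<and> t \<subseteq> a" 
      proof
        fix t assume "t \<in> T2"
        then obtain s where "s \<in> T" "t = g \<star> s" unfolding T2_def by blast
        moreover have "a \<subseteq> s" "s \<subseteq> c" using bt calculation by blast+
        ultimately show "a2 \<subseteq> t \<and> t \<subseteq> a" using g(2) unfolding a2_def by blast
      qed
      have T2H: "T2 \<subseteq> H" unfolding T2_def using TH H_act[OF g(1)] by blast
      show "T2 \<subseteq> B" using inB T2H b by blast
      show "transverse_family T2" unfolding transverse_family_def
      proof (intro conjI ballI impI T2H)
        fix x y assume "x \<in> T2" "y \<in> T2" "x \<noteq> y"
        then obtain s t where st: "s \<in> T" "t \<in> T" "x = g \<star> s" "y = g \<star> t" "s \<noteq> t" unfolding T2_def by blast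
        then have "transverse V s t" using T(1) unfolding transverse_family_def by simp
        then show "transverse V x y" using image_transverse[OF g(1)] TH st by simp
      qed
    qed
    have extend: "\<exists>T a c. transverse_family T \<and> finite T \<and> card T = Suc n \<and> T \<subseteq> B \<and> a \<in> B \<and> c \<in> B \<and> a \<subseteq> c \<and> (\<forall>t\<in>T. a \<subseteq> t \<and> t \<subseteq> c)"
      if U: "transverse_family U" "finite U" "card U = n" "U \<subseteq> B" "\<forall>t\<in>U. q \<subseteq> t \<and> t \<subseteq> p" and qp: "q \<in> B" "p \<in> B" "a2 \<subseteq> q" "q \<subseteq> p" "p \<subseteq> c"
        and jj: "jj = j \<or> jj = V - j" and occ: "occupied q jj" "occupied (V - p) (V - jj)" for U p q jj
    proof -
      obtain x where x: "x \<in> H" "x \<subseteq> q" "x \<subseteq> jj" using occ unfolding occupied_def by blast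
      obtain y where y: "y \<in> H" "y \<subseteq> V - p" "y \<subseteq> V - jj" using occ unfolding occupied_def by blast
      have jjB: "jj \<in> B" "jj \<in> H" using jj P_compl[OF B] P_H[OF B] j(1) by blast+
      note V = H_sub[OF jjB(2)] H_sub[OF P_H[OF B qp(2)]]
      have xy: "p \<subseteq> V - y" "jj \<subseteq> V - y" using y(2,3) V by blast+
      have trU: "transverse V t jj" if t: "t \<in> U" for t
      proof -
        have "transverse V t j" using jt[of t] U(5) qp t by (meson order_trans)
        then show ?thesis using jj transverse_compl(2)[OF H_sub[OF jH]] by blast
      qed
      have "transverse_family (insert jj U)" by (rule transverse_family_insert[OF U(1) jjB(2) trU])
      moreover have "jj \<notin> U" using trU transverse_not_sub(4) by blast
      moreover have "x \<in> B" using nested_block[OF B qp(1) x(1)] nestedI(3) x by blast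
      moreover have "V - y \<in> B" using nested_block[OF B qp(2) H_compl[OF y(1)]] nestedI(1) xy(1) by blast
      moreover have "x \<subseteq> V - y" using x xy qp by blast
      moreover have "\<forall>t\<in>insert jj U. x \<subseteq> t \<and> t \<subseteq> V - y" using x(2,3) xy U(5) by (metis insert_iff order_trans)
      ultimately show ?thesis using U jjB by (intro exI[of _ "insert jj U"] exI[of _ x] exI[of _ "V - y"]) simp
    qed
    have jd: "V - (V - j) = j" using H_dcompl[OF jH] .
    have opp: "(occupied x j \<and> occupied (V - x) (V - j)) \<or> (occupied x (V - j) \<and> occupied (V - x) (V - (V - j)))" 
      if "x \<in> B" "a2 \<subseteq> x" "x \<subseteq> c" for x
      using opposite_block[OF fl B that(1) j(1) jt[OF that(2,3)]] unfolding opposite_def jd .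
    \<comment> \<open>At each of the three levels \<open>a2\<close>, \<open>a\<close>,
      \<open>c\<close> one of two diagonals is occupied. Two levels share a diagonal, and the
      matching side of \<open>j\<close> can be added to a copy lying between these two.\<close>
    define tA where "tA x jj \<longleftrightarrow> occupied x jj \<and> occupied (V - x) (V - jj)" for x jj
    have o: "tA a2 j \<or> tA a2 (V - j)" "tA a j \<or> tA a (V - j)" "tA c j \<or> tA c (V - j)"
      unfolding tA_def using opp[OF a2B] opp[OF ac(1)] opp[OF ac(2)] a2 ac(3) by blast+
    have ca: "\<exists>jj. (jj = j \<or> jj = V - j) \<and> (tA a jj \<and> tA c jj \<or> tA a2 jj \<and> tA a jj \<or> tA a2 jj \<and> tA c jj)" 
      using o by blast
    then obtain jj where jj: "jj = j \<or> jj = V - j" "tA a jj \<and> tA c jj \<or> tA a2 jj \<and> tA a jj \<or> tA a2 jj \<and> tA c jj" by blast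
    from jj(2) show ?case
    proof (elim disjE)
      assume "tA a jj \<and> tA c jj"
      then show ?thesis using extend[OF T bt ac(1,2) a2(2) ac(3) order_refl jj(1)] unfolding tA_def by blast
    next
      assume "tA a2 jj \<and> tA a jj"
      then show ?thesis using extend[OF T2(5,1,2,3,4) a2B ac(1) order_refl a2(2) ac(3) jj(1)] unfolding tA_def by blast
    next
      assume *: "tA a2 jj \<and> tA c jj"
      have "\<forall>t\<in>T. a2 \<subseteq> t \<and> t \<subseteq> c" using bt a2(2) by (meson order_trans)
      moreover have "a2 \<subseteq> c" using a2(2) ac(3) by (rule order_trans)
      ultimately show ?thesis using * extend[OF T(1,2,3,4) _ a2B ac(2) order_refl _ order_refl jj(1)] 
        unfolding tA_def by simp
    qed
  qed
  then show False using no_large_transverse_family by metis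
qed

text \<open>The half-spaces of \<open>B\<close> sent into \<open>B'\<close> are closed under
  nesting, because images of nested half-spaces are nested and nested half-spaces share a block; so
  irreducibility applies.\<close>

lemma block_act_sub:
  assumes g: "g \<in> carrier G" and B: "B \<in> P" shows "\<exists>B'\<in>P. (\<lambda>h. g \<star> h) ` B \<subseteq> B'"
proof -
  obtain h where h: "h \<in> B" using P_ne[OF B] by blast
  obtain B' where B': "B' \<in> P" "g \<star> h \<in> B'" using H_act[OF g P_H[OF B h]] P_Union by blast
  define C where "C = {k \<in> B. g \<star> k \<in> B'}"
  have BV: "k \<subseteq> V" if "k \<in> B" for k using P_H[OF B that] H_sub by blast
  have "C = B"
  proof (rule ccontr)
    assume ne: "C \<noteq> B"
    have "V - k \<in> C" if k: "k \<in> C" for k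
      using k P_compl[OF B] P_compl[OF B'(1)] image_compl[OF g BV, of k] unfolding C_def by auto
    then obtain c k where ck: "c \<in> C" "k \<in> B - C" "\<not> transverse V c k"
      using P_irreducible[OF B, of C] ne h B'(2) unfolding C_def by blast
    then have "\<not> transverse V (g \<star> c) (g \<star> k)" using image_transverse[OF g] BV unfolding C_def by simp
    then have "g \<star> k \<in> B'" using nested_block[OF B'(1)] ck H_act[OF g P_H[OF B, of k]] unfolding C_def by blast
    then show False using ck unfolding C_def by blast
  qed
  then show ?thesis using B' unfolding C_def by blast
qed

lemma block_act:
  assumes g: "g \<in> carrier G" and B: "B \<in> P" shows "(\<lambda>h. g \<star> h) ` B \<in> P"
proof -
  obtain B' where B': "B' \<in> P" "(\<lambda>h. g \<star> h) ` B \<subseteq> B'" using block_act_sub[OF g B] by blast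
  obtain B'' where B'': "B'' \<in> P" "(\<lambda>h. inv g \<star> h) ` B' \<subseteq> B''" using block_act_sub[of "inv g" B'] g B' by auto
  obtain h where h: "h \<in> B" using P_ne[OF B] by blast
  have "inv g \<star> g \<star> h \<in> B''" using h B'(2) B''(2) by blast
  then have "h \<in> B''" using image_inv[OF g H_sub[OF P_H[OF B h]]] by simp
  then have "B'' = B" using P_disj[OF B''(1) B _ h] by blast
  have "B' \<subseteq> (\<lambda>h. g \<star> h) ` B"
  proof
    fix k assume k: "k \<in> B'"
    then have "inv g \<star> k \<in> B" using B''(2) \<open>B'' = B\<close> by blast
    moreover have "k = g \<star> inv g \<star> k" using image_inv'[OF g H_sub[OF P_H[OF B'(1) k]]] by simp
    ultimately show "k \<in> (\<lambda>h. g \<star> h) ` B" by blast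
  qed
  then show ?thesis using B' by (metis subset_antisym)
qed

lemma strongly_separated_mono:
  assumes "strongly_separated V B k h" "k' \<subseteq> k" "k \<subseteq> h" "h \<subseteq> h'" shows "strongly_separated V B k' h'"
  unfolding strongly_separated_def
proof
  assume "\<exists>j\<in>B. transverse V j k' \<and> transverse V j h'"
  then obtain j where "j \<in> B" "transverse V j k'" "transverse V j h'" by blast
  then have "transverse V j k" "transverse V j h"
    using transverse_mono[of V j k' h'] assms(2-4) by (meson order_trans)+
  then show False using assms(1) \<open>j \<in> B\<close> unfolding strongly_separated_def by blast
qed

lemma strongly_separated_act:
  assumes g: "g \<in> carrier G" and B: "B \<in> P" "k \<in> B" "h \<in> B" and ss: "strongly_separated V B k h"
  shows "strongly_separated V ((\<lambda>h. g \<star> h) ` B) (g \<star> k) (g \<star> h)"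
proof -
  have BV: "k \<subseteq> V" if "k \<in> B" for k using P_H[OF B(1) that] H_sub by blast
  show ?thesis using ss image_transverse[OF g BV BV] B(2,3) unfolding strongly_separated_def by auto
qed

text \<open>Push a strongly separated pair \<open>k \<subseteq> h\<close> into \<open>k\<close>:
  then \<open>g \<star> k\<close> is strongly separated from \<open>g \<star> h\<close>, hence from
  the larger \<open>k\<close>, and \<open>h\<close>, \<open>k\<close>, \<open>g \<star> k\<close> is
  the triple.\<close>

lemma ex_triple:
  assumes fl: flips and B: "B \<in> P"
  shows "\<exists>h'\<in>B. \<exists>h\<in>B. \<exists>k\<in>B. k \<subseteq> h \<and> h \<subseteq> h' \<and> strongly_separated V B k h \<and> strongly_separated V B h h'"
proof -
  obtain h k where hk: "h \<in> B" "k \<in> B" "k \<subseteq> h" "strongly_separated V B k h" using ex_strongly_separated[OF assms] by blast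
  obtain g where g: "g \<in> carrier G" "g \<star> h \<subseteq> k" 
    using double_skewer[OF fl P_H[OF B hk(2)] P_H[OF B hk(1)] hk(3)] by blast
  have gk: "g \<star> k \<subseteq> g \<star> h" using hk by blast
  have gkB: "g \<star> k \<in> B" 
    using nested_block[OF B hk(2) H_act[OF g(1) P_H[OF B hk(2)]]] nestedI(3) gk g(2) by (meson order_trans)
  have "(\<lambda>h. g \<star> h) ` B = B" using P_disj[OF block_act[OF g(1) B] B, of "g \<star> k"] gkB hk by blast
  then have "strongly_separated V B (g \<star> k) (g \<star> h)" using strongly_separated_act[OF g(1) B hk(2,1,4)] by simp
  then have "strongly_separated V B (g \<star> k) k" using strongly_separated_mono gk g(2) by blast
  then show ?thesis using hk gkB gk g(2) by (meson order_trans)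
qed

text \<open>Representatives of distinct blocks are pairwise transverse.\<close>

lemma finite_P: "finite P"
proof (rule ccontr)
  assume inf: "infinite P"
  define f where "f B = (SOME h. h \<in> B)" for B :: "'a set set"
  have f: "f B \<in> B" if "B \<in> P" for B unfolding f_def using P_ne[OF that] by (simp add: some_in_eq)
  have "inj_on f P" using f P_disj by (intro inj_onI) metis
  then have "infinite (f ` P)" using inf finite_imageD by blast
  moreover have "transverse_family (f ` P)" unfolding transverse_family_def
  proof (intro conjI ballI impI)
    show "f ` P \<subseteq> H" using f P_H by blast
    fix x y assume "x \<in> f ` P" "y \<in> f ` P" "x \<noteq> y"
    then obtain A B where "A \<in> P" "B \<in> P" "x = f A" "y = f B" "A \<noteq> B" by blast
    then show "transverse V x y" using P_transverse f by simp
  qed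
  ultimately show False using infinite_not_transverse_family by blast
qed

end

section \<open>The flipping lemma\<close>

context cube_action
begin

section \<open>The action on the realization and on its rays\<close>

abbreviation "ap \<equiv> act_point G V E \<phi>"

lemma ap_H: "h \<in> H \<Longrightarrow> ap g p h = p (inv g \<star> h)"
  unfolding act_point_def by simp

lemma ap_not_H: "h \<notin> H \<Longrightarrow> ap g p h = 0"
  unfolding act_point_def by simp

lemma H_act_inv: "g \<in> carrier G \<Longrightarrow> h \<in> H \<Longrightarrow> inv g \<star> h \<in> H"
  using H_act by simp

lemma ap_image: "g \<in> carrier G \<Longrightarrow> k \<in> H \<Longrightarrow> ap g p (g \<star> k) = p k"
  using ap_H[OF H_act] image_inv H_sub by simp

lemma mem_image_H: "g \<in> carrier G \<Longrightarrow> h \<in> H \<Longrightarrow> h = g \<star> inv g \<star> h"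
  using image_inv' H_sub by simp

lemma inv_image_compl: "g \<in> carrier G \<Longrightarrow> h \<in> H \<Longrightarrow> inv g \<star> (V - h) = V - inv g \<star> h"
  using image_compl[of "inv g" h] H_sub by simp

lemma image_inj_H: "g \<in> carrier G \<Longrightarrow> A \<subseteq> H \<Longrightarrow> inj_on (\<lambda>h. g \<star> h) A"
  using image_eq H_sub by (intro inj_onI) (meson subset_iff)

lemma joint_act:
  assumes g: "g \<in> carrier G" and J: "joint p q" shows "joint (ap g p) (ap g q)"
proof -
  have v: "valid (ap g r)" if "valid r" for r
    unfolding valid_def
  proof (intro conjI allI impI ballI)
    note rd = validD[OF that]
    fix h
    show "ap g r h = 0" if "h \<notin> H" using that by (rule ap_not_H)
    assume h: "h \<in> H"
    show "0 \<le> ap g r h" "ap g r h \<le> 1" using rd(2,3) ap_H[OF h] by simp_all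
    show "ap g r (V - h) = 1 - ap g r h"
      using ap_H[OF h] ap_H[OF H_compl[OF h]] inv_image_compl[OF g h] rd(4)[OF H_act_inv[OF g h]] by simp
  qed
  show ?thesis unfolding joint_def
  proof (intro conjI ballI impI)
    show "valid (ap g p)" "valid (ap g q)" using v joint_valid[OF J] by blast+
    have "\<exists>v\<in>V. finite {h \<in> H. p h \<noteq> of_bool (v \<in> h)}" using J unfolding joint_def by (elim conjE)
    then obtain w where w: "w \<in> V" "finite {h \<in> H. p h \<noteq> of_bool (w \<in> h)}" by blast
    have "{h \<in> H. ap g p h \<noteq> of_bool (\<phi> g w \<in> h)} \<subseteq> (\<lambda>h. g \<star> h) ` {h \<in> H. p h \<noteq> of_bool (w \<in> h)}"
    proof
      fix h assume h: "h \<in> {h \<in> H. ap g p h \<noteq> of_bool (\<phi> g w \<in> h)}"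
      then have hH: "h \<in> H" by blast
      have "\<phi> g w \<in> h \<longleftrightarrow> w \<in> inv g \<star> h"
        using mem_image[of "inv g" w h] g w(1) H_sub[OF hH] by simp
      then have "inv g \<star> h \<in> {h \<in> H. p h \<noteq> of_bool (w \<in> h)}" using h ap_H[OF hH] H_act_inv[OF g hH] by simp
      then show "h \<in> (\<lambda>h. g \<star> h) ` {h \<in> H. p h \<noteq> of_bool (w \<in> h)}" using mem_image_H[OF g hH] by blast
    qed
    then have "finite {h \<in> H. ap g p h \<noteq> of_bool (\<phi> g w \<in> h)}" using w(2) by (meson finite_imageI finite_subset)
    then show "\<exists>v\<in>V. finite {h \<in> H. ap g p h \<noteq> of_bool (v \<in> h)}" using act_V[OF g w(1)] by blast
    have "{h. ap g p h \<noteq> ap g q h} \<subseteq> (\<lambda>h. g \<star> h) ` {h. p h \<noteq> q h}"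
    proof
      fix h assume h: "h \<in> {h. ap g p h \<noteq> ap g q h}"
      then have hH: "h \<in> H" using ap_not_H[of h] by (cases "h \<in> H") simp_all
      then have "inv g \<star> h \<in> {h. p h \<noteq> q h}" using h ap_H[OF hH] by simp
      then show "h \<in> (\<lambda>h. g \<star> h) ` {h. p h \<noteq> q h}" using mem_image_H[OF g hH] by blast
    qed
    then show "finite {h. ap g p h \<noteq> ap g q h}" using finite_diff[OF joint_pts[OF J]] by (meson finite_imageI finite_subset)
    fix a b assume ab: "a \<in> H" "b \<in> H" "b \<noteq> V - a" "0 < ap g p a \<or> 0 < ap g q a" "0 < ap g p b \<or> 0 < ap g q b"
    have "inv g \<star> b \<noteq> V - inv g \<star> a"
    proof
      assume "inv g \<star> b = V - inv g \<star> a"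
      then have "inv g \<star> b = inv g \<star> (V - a)" using inv_image_compl[OF g ab(1)] by simp
      then show False using ab image_eq[of "inv g" b "V - a"] g H_sub by simp
    qed
    then have "inv g \<star> a \<inter> inv g \<star> b \<noteq> {}"
      using joint_cons[OF J H_act_inv[OF g ab(1)] H_act_inv[OF g ab(2)]] ab ap_H by simp
    then show "a \<inter> b \<noteq> {}" using image_Int[of "inv g" a b] g H_sub ab(1,2) by (metis image_is_empty inv_closed)
  qed
qed

lemma local_dist_act:
  assumes g: "g \<in> carrier G" and J: "joint p q" shows "local_dist (ap g p) (ap g q) = local_dist p q"
proof -
  have dH: "{h. p h \<noteq> q h} \<subseteq> H" 
  proof
    fix h assume "h \<in> {h. p h \<noteq> q h}"
    then show "h \<in> H" using validD(1)[OF joint_valid(1)[OF J]] validD(1)[OF joint_valid(2)[OF J]] by (cases "h \<in> H") auto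
  qed
  have "{h. ap g p h \<noteq> ap g q h} \<subseteq> (\<lambda>h. g \<star> h) ` {h. p h \<noteq> q h}"
  proof
    fix h assume h: "h \<in> {h. ap g p h \<noteq> ap g q h}"
    then have hH: "h \<in> H" using ap_not_H[of h] by (cases "h \<in> H") simp_all
    then have "inv g \<star> h \<in> {h. p h \<noteq> q h}" using h ap_H[OF hH] by simp
    then show "h \<in> (\<lambda>h. g \<star> h) ` {h. p h \<noteq> q h}" using mem_image_H[OF g hH] by blast
  qed
  then have "local_dist (ap g p) (ap g q) = sqrt ((\<Sum>h\<in>(\<lambda>h. g \<star> h) ` {h. p h \<noteq> q h}. (ap g p h - ap g q h)^2) / 2)"
    using finite_diff[OF joint_pts[OF J]] by (intro local_dist_superset) auto
  also have "(\<Sum>h\<in>(\<lambda>h. g \<star> h) ` {h. p h \<noteq> q h}. (ap g p h - ap g q h)^2) = (\<Sum>h\<in>{h. p h \<noteq> q h}. (p h - q h)^2)"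
    unfolding sum.reindex[OF image_inj_H[OF g dH]] o_def
    by (rule sum.cong[OF refl]) (use ap_image[OF g] dH in auto)
  finally show ?thesis unfolding local_dist_def .
qed

lemma chain_act: 
  assumes g: "g \<in> carrier G" shows "chain p q l \<Longrightarrow> chain (ap g p) (ap g q) l"
proof (induction rule: chain.induct)
  case (chain_step p q l r)
  then show ?case using chain.chain_step[OF chain_step(3) joint_act[OF g chain_step(2)]] local_dist_act[OF g chain_step(2)] by simp
qed (rule chain_refl)

lemma ap_pts: "g \<in> carrier G \<Longrightarrow> p \<in> pts \<Longrightarrow> ap g p \<in> pts"
  using joint_act by (simp add: pts_iff)

lemma ap_inv: 
  assumes "g \<in> carrier G" "p \<in> pts" shows "ap (inv g) (ap g p) = p"
proof
  fix h show "ap (inv g) (ap g p) h = p h"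
  proof (cases "h \<in> H")
    case True
    then show ?thesis using ap_H[OF True, of "inv g"] ap_image[OF assms(1) True] assms(1) by simp
  next
    case False
    then show ?thesis using ap_not_H validD(1)[OF pts_valid[OF assms(2)]] by simp
  qed
qed

lemma dc_act_le: "g \<in> carrier G \<Longrightarrow> p \<in> pts \<Longrightarrow> q \<in> pts \<Longrightarrow> dc (ap g p) (ap g q) \<le> dc p q"
  using dc_greatest dc_le chain_act by meson

lemma dc_act: 
  assumes "g \<in> carrier G" "p \<in> pts" "q \<in> pts" shows "dc (ap g p) (ap g q) = dc p q"
  using dc_act_le[OF assms] dc_act_le[of "inv g" "ap g p" "ap g q"] ap_inv assms ap_pts by simp

lemma ray_act: "g \<in> carrier G \<Longrightarrow> geodesic_ray V E c \<Longrightarrow> geodesic_ray V E (\<lambda>t. ap g (c t))"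
  unfolding geodesic_ray_def using ap_pts dc_act by simp

lemma visual_eq:
  assumes r: "geodesic_ray V E c1" "geodesic_ray V E c2" and B: "\<exists>B. \<forall>t\<ge>0. dc (c1 t) (c2 t) \<le> B"
  shows "visual_point V E c1 = visual_point V E c2"
proof -
  have *: "visual_point V E a \<subseteq> visual_point V E b" 
    if r: "geodesic_ray V E a" "geodesic_ray V E b" and B: "\<exists>B. \<forall>t\<ge>0. dc (b t) (a t) \<le> B" for a b
  proof
    fix c assume "c \<in> visual_point V E a"
    then obtain B' where c: "geodesic_ray V E c" "\<forall>t\<ge>0. dc (a t) (c t) \<le> B'" unfolding visual_point_def by blast
    obtain B where B: "\<forall>t\<ge>0. dc (b t) (a t) \<le> B" using B by blast
    have "dc (b t) (c t) \<le> B + B'" if "0 \<le> t" for t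
    proof -
      have "dc (b t) (c t) \<le> dc (b t) (a t) + dc (a t) (c t)" 
        by (rule dc_triangle) (use r c that in \<open>auto simp: geodesic_ray_def\<close>)
      also have "dc (b t) (a t) \<le> B" using B that by blast
      also have "dc (a t) (c t) \<le> B'" using c that by blast
      finally show ?thesis by simp
    qed
    then show "c \<in> visual_point V E b" unfolding visual_point_def using c by blast
  qed
  have B': "\<exists>B. \<forall>t\<ge>0. dc (c2 t) (c1 t) \<le> B" using B dc_sym by metis
  show ?thesis using *[OF r B'] *[OF r(2,1) B] by blast
qed

section \<open>Translates of corridors and their comparison\<close>

lemma corridorD:
  assumes "corridor v S"
  shows "corridor_ray V E v S" "S \<subseteq> H" "v \<in> V" "infinite S" "\<And>s. s \<in> S \<Longrightarrow> v \<notin> s"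
    "\<And>s j. s \<in> S \<Longrightarrow> j \<in> H \<Longrightarrow> s \<subseteq> j \<Longrightarrow> v \<notin> j \<Longrightarrow> j \<in> S"
    "\<And>s t. s \<in> S \<Longrightarrow> t \<in> S \<Longrightarrow> s \<inter> t \<noteq> {}" "\<And>s. s \<in> S \<Longrightarrow> finite {j\<in>S. \<not> j \<subseteq> s}"
    "\<exists>C. \<forall>s\<in>S. card {j\<in>S. transverse V j s} \<le> C"
proof -
  note k1 = assms[unfolded corridor_def]
  note k2 = k1[THEN conjunct2]
  note k3 = k2[THEN conjunct2]
  note k4 = k3[THEN conjunct2]
  note k5 = k4[THEN conjunct2]
  note k6 = k5[THEN conjunct2]
  note k7 = k6[THEN conjunct2]
  note c = k1[THEN conjunct1] k2[THEN conjunct1] k3[THEN conjunct1] k4[THEN conjunct1] k5[THEN conjunct1] 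
    k6[THEN conjunct1] k7[THEN conjunct1] k7[THEN conjunct2]
  have out: "v \<notin> s" if "s \<in> S" for s using c(4) that by (rule bspec)
  have up: "j \<in> S" if "s \<in> S" "j \<in> H" "s \<subseteq> j" "v \<notin> j" for s j 
    using c(5)[THEN bspec, OF that(1), THEN bspec, OF that(2)] that(3,4) by blast
  have int: "s \<inter> t \<noteq> {}" if "s \<in> S" "t \<in> S" for s t 
    using c(6)[THEN bspec, OF that(1), THEN bspec, OF that(2)] .
  have fin: "finite {j\<in>S. \<not> j \<subseteq> s}" if "s \<in> S" for s using c(7) that by (rule bspec)
  show "S \<subseteq> H" "v \<in> V" "infinite S" "\<exists>C. \<forall>s\<in>S. card {j\<in>S. transverse V j s} \<le> C" by (rule c)+
  show "\<And>s. s \<in> S \<Longrightarrow> v \<notin> s" by (rule out)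
  show "\<And>s j. s \<in> S \<Longrightarrow> j \<in> H \<Longrightarrow> s \<subseteq> j \<Longrightarrow> v \<notin> j \<Longrightarrow> j \<in> S" by (rule up)
  show "\<And>s t. s \<in> S \<Longrightarrow> t \<in> S \<Longrightarrow> s \<inter> t \<noteq> {}" by (rule int)
  show "\<And>s. s \<in> S \<Longrightarrow> finite {j\<in>S. \<not> j \<subseteq> s}" by (rule fin)
  show "corridor_ray V E v S"
    by (rule corridor_ray.intro[OF median_complex_axioms corridor_ray_axioms.intro])
      (fact c(1), fact c(2), rule out, assumption, rule up, assumption+, rule int, assumption+, fact c(3), rule fin)
qed

lemma corridor_act:
  assumes g: "g \<in> carrier G" and c: "corridor v S" shows "corridor (\<phi> g v) ((\<lambda>h. g \<star> h) ` S)"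
proof -
  note cd = corridorD[OF c]
  have SV: "s \<subseteq> V" if "s \<in> S" for s using cd(2) H_sub that by blast
  let ?g = "\<lambda>h. g \<star> h"
  have e1: "{j \<in> ?g ` S. \<not> j \<subseteq> g \<star> s} = ?g ` {j \<in> S. \<not> j \<subseteq> s}" if "s \<in> S" for s
  proof -
    have "{j \<in> ?g ` S. \<not> j \<subseteq> g \<star> s} = ?g ` {j \<in> S. \<not> g \<star> j \<subseteq> g \<star> s}" by blast
    moreover have "{j \<in> S. \<not> g \<star> j \<subseteq> g \<star> s} = {j \<in> S. \<not> j \<subseteq> s}" 
      by (rule Collect_cong) (use image_sub[OF g SV SV[OF that]] in metis)
    ultimately show ?thesis by metis
  qed
  have e2: "{j \<in> ?g ` S. transverse V j (g \<star> s)} = ?g ` {j \<in> S. transverse V j s}" if "s \<in> S" for s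
  proof -
    have "{j \<in> ?g ` S. transverse V j (g \<star> s)} = ?g ` {j \<in> S. transverse V (g \<star> j) (g \<star> s)}" by blast
    moreover have "{j \<in> S. transverse V (g \<star> j) (g \<star> s)} = {j \<in> S. transverse V j s}" 
      by (rule Collect_cong) (use image_transverse[OF g SV SV[OF that]] in metis)
    ultimately show ?thesis by metis
  qed
  obtain C where C: "\<forall>s\<in>S. card {j\<in>S. transverse V j s} \<le> C" using cd(9) by blast
  show ?thesis unfolding corridor_def
  proof (intro conjI ballI impI)
    show "\<phi> g v \<in> V" using act_V g cd by blast
    show "?g ` S \<subseteq> H" using H_act[OF g] cd(2) by blast
    show "infinite (?g ` S)" using finite_imageD[OF _ image_inj_H[OF g cd(2)]] cd(4) by blast
    show "\<exists>C. \<forall>s\<in>?g ` S. card {j \<in> ?g ` S. transverse V j s} \<le> C"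
    proof (intro exI ballI)
      fix s assume "s \<in> ?g ` S"
      then obtain t where t: "t \<in> S" "s = g \<star> t" by blast
      have "card {j \<in> ?g ` S. transverse V j s} = card {j \<in> S. transverse V j t}"
        unfolding t(2) e2[OF t(1)] by (rule card_image[OF image_inj_H[OF g]]) (use cd(2) in blast)
      then show "card {j \<in> ?g ` S. transverse V j s} \<le> C" using C t by simp
    qed
  next
    fix s assume s: "s \<in> ?g ` S"
    then obtain s0 where s0: "s0 \<in> S" "s = g \<star> s0" by blast
    show "\<phi> g v \<notin> s" using image_mem[OF g cd(3) SV[OF s0(1)]] cd(5) s0 by blast
    show "finite {j \<in> ?g ` S. \<not> j \<subseteq> s}" unfolding s0(2) e1[OF s0(1)] using cd(8)[OF s0(1)] by simp
    show "s \<inter> t \<noteq> {}" if "t \<in> ?g ` S" for t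
    proof -
      obtain t0 where t0: "t0 \<in> S" "t = g \<star> t0" using \<open>t \<in> ?g ` S\<close> by blast
      show ?thesis using cd(7)[OF s0(1) t0(1)] image_Int[OF g SV[OF s0(1)] SV[OF t0(1)]] s0 t0 by (metis image_is_empty)
    qed
    fix j assume j: "j \<in> H" "s \<subseteq> j" "\<phi> g v \<notin> j"
    have "inv g \<star> g \<star> s0 \<subseteq> inv g \<star> j" using j(2) s0 by blast
    then have "s0 \<subseteq> inv g \<star> j" using image_inv[OF g SV[OF s0(1)]] by simp
    moreover have "v \<notin> inv g \<star> j" using mem_image[of "inv g" v j] g cd(3) H_sub[OF j(1)] j(3) by simp
    ultimately have "inv g \<star> j \<in> S" using cd(6)[OF s0(1) H_act_inv[OF g j(1)]] by blast
    then show "j \<in> ?g ` S" using mem_image_H[OF g j(1)] by blast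
  qed
qed

lemma base_act:
  assumes g: "g \<in> carrier G" and c: "corridor v S"
  shows "ap g (corridor_ray.base V E v) = corridor_ray.base V E (\<phi> g v)"
proof
  fix h
  note b = corridor_ray.base_def[OF corridorD(1)[OF c]] and b' = corridor_ray.base_def[OF corridorD(1)[OF corridor_act[OF g c]]]
  show "ap g (corridor_ray.base V E v) h = corridor_ray.base V E (\<phi> g v) h"
  proof (cases "h \<in> H")
    case True
    then show ?thesis unfolding b b' ap_H[OF True] 
      using mem_image[of "inv g" v h] g corridorD(3)[OF c] H_sub[OF True] H_act_inv[OF g True] by simp
  qed (simp add: b' ap_not_H)
qed

lemma Y_act:
  assumes g: "g \<in> carrier G" and c: "corridor v S" and p: "p \<in> corridor_ray.Y V E v S"
  shows "ap g p \<in> corridor_ray.Y V E (\<phi> g v) ((\<lambda>h. g \<star> h) ` S)"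
proof -
  interpret R: corridor_ray V E v S by (rule corridorD(1)[OF c])
  interpret R': corridor_ray V E "\<phi> g v" "(\<lambda>h. g \<star> h) ` S" by (rule corridorD(1)[OF corridor_act[OF g c]])
  have "ap g p h = R'.base h" if h: "\<not> R'.crossing h" for h
  proof (cases "h \<in> H")
    case True
    have "\<not> R.crossing (inv g \<star> h)"
    proof
      assume "R.crossing (inv g \<star> h)"
      then have "inv g \<star> h \<in> S \<or> inv g \<star> (V - h) \<in> S" unfolding R.crossing_def using inv_image_compl[OF g True] by simp
      then have "h \<in> (\<lambda>h. g \<star> h) ` S \<or> V - h \<in> (\<lambda>h. g \<star> h) ` S"
        using mem_image_H[OF g True] mem_image_H[OF g H_compl[OF True]] by blast
      then show False using h True unfolding R'.crossing_def by blast
    qed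
    then have "p (inv g \<star> h) = R.base (inv g \<star> h)" using p unfolding R.Y_def by blast
    then show ?thesis using base_act[OF g c] ap_H[OF True] by metis
  next
    case False
    then show ?thesis using ap_not_H unfolding R'.base_def by simp
  qed
  then show ?thesis unfolding R'.Y_def using ap_pts[OF g R.Y_pts[OF p]] by blast
qed

text \<open>Among infinitely many common members one lies inside a given \<open>s\<close> of
  \<open>S1\<close>; upward closure of \<open>S2\<close> then puts \<open>s\<close> into
  \<open>S2\<close> unless \<open>s\<close> contains \<open>v2\<close>.\<close>

lemma corridor_diff:
  assumes c1: "corridor v1 S1" and c2: "corridor v2 S2" and inf: "infinite (S1 \<inter> S2)"
  shows "finite (S1 - S2)"
proof -
  note d1 = corridorD[OF c1] and d2 = corridorD[OF c2]
  have "S1 - S2 \<subseteq> {s \<in> H. v2 \<in> s \<and> v1 \<notin> s}"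
  proof
    fix s assume s: "s \<in> S1 - S2"
    then have sH: "s \<in> H" "v1 \<notin> s" using d1 by blast+
    have "v2 \<in> s"
    proof (rule ccontr)
      assume n: "v2 \<notin> s"
      have "finite {j \<in> S1. \<not> j \<subseteq> s}" using d1(8) s by blast
      then obtain t where "t \<in> S1 \<inter> S2" "t \<notin> {j \<in> S1. \<not> j \<subseteq> s}" using inf by (meson finite_subset subsetI)
      then have "s \<in> S2" using d2(6)[of t s] sH n by blast
      then show False using s by blast
    qed
    then show "s \<in> {s \<in> H. v2 \<in> s \<and> v1 \<notin> s}" using sH by blast
  qed
  then show ?thesis using finite_sep[OF d2(3) d1(3)] finite_subset by blast
qed

text \<open>No member of \<open>S\<close> lies in \<open>t\<close>, since \<open>t\<close> would
  then belong to \<open>S\<close>; only finitely many contain \<open>t\<close>, since these separate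
  a point of \<open>t\<close> from \<open>v\<close>.\<close>

lemma corridor_transverse:
  assumes N: "inv_filter N" and c: "corridor v S" "S \<subseteq> N" and t: "t \<in> N" "t \<notin> S" "v \<notin> t"
  shows "finite {s \<in> S. \<not> transverse V t s}"
proof -
  note d = corridorD[OF c(1)]
  note tH = inv_filterD(1)[OF N t(1)]
  obtain y where y: "y \<in> t" "y \<in> V" using H_ne tH by blast
  have "{s \<in> S. \<not> transverse V t s} \<subseteq> {s \<in> H. y \<in> s \<and> v \<notin> s}"
  proof
    fix s assume s: "s \<in> {s \<in> S. \<not> transverse V t s}"
    then have "\<not> s \<subseteq> t" using d(6)[of s t] tH t by blast
    then have "t \<subseteq> s" using filter_transverse[OF N t(1) _ d(3) t(3), of s] s c(2) d(5) by blast
    then show "s \<in> {s \<in> H. y \<in> s \<and> v \<notin> s}" using s d(2,5) y by blast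
  qed
  then show ?thesis using finite_sep[OF y(2) d(3)] finite_subset by blast
qed

text \<open>Infinitely many translates of a ray along a corridor would yield corridors that are pairwise almost
  disjoint, hence arbitrarily large families of pairwise transverse half-spaces.\<close>

lemma inv_filter_empty:
  assumes ess: "essential G V E \<phi>" and ne: "nonelementary G V E \<phi>" and N: "inv_filter N"
  shows "N = {}"
proof (rule ccontr)
  assume "N \<noteq> {}"
  note Nd = inv_filterD[OF N]
  obtain v where v: "v \<in> V" using median unfolding median_graph_def by blast
  obtain S where S: "corridor v S" "S \<subseteq> N" using ex_corridor[OF ess N \<open>N \<noteq> {}\<close> v] by blast
  note Sd = corridorD[OF S(1)]
  obtain c where c: "geodesic_ray V E c" "\<And>t. 0 \<le> t \<Longrightarrow> c t \<in> corridor_ray.Y V E v S" "c 0 = corridor_ray.base V E v"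
    using corridor_ray.ex_ray[OF Sd(1)] by metis
  obtain C where C: "\<forall>s\<in>S. card {j\<in>S. transverse V j s} \<le> C" using Sd(9) by blast
  define f where "f g = visual_point V E (\<lambda>t. ap g (c t))" for g
  define Sg where "Sg g = (\<lambda>h. g \<star> h) ` S" for g
  have cor: "corridor (\<phi> g v) (Sg g)" if "g \<in> carrier G" for g unfolding Sg_def by (rule corridor_act[OF that S(1)])
  have SgN: "Sg g \<subseteq> N" if "g \<in> carrier G" for g unfolding Sg_def using Nd(4) S(2) that by blast
  have "infinite (f ` carrier G)" using ne c(1) unfolding nonelementary_def f_def by (simp add: setcompr_eq_image)
  \<comment> \<open>These are \<open>D + 1\<close> end points of translates of the ray, one more
    than a transverse family can have members.\<close>
  then obtain Z where Z: "Z \<subseteq> f ` carrier G" "finite Z" "card Z = Suc D" using infinite_arbitrarily_large by metis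
  obtain Q where Q: "Q \<subseteq> carrier G" "inj_on f Q" "Z = f ` Q" using Z(1) unfolding subset_image_inj by blast
  have finQ: "finite Q" using Z Q finite_image_iff by blast
  have cardQ: "card Q = Suc D" using Z Q card_image by metis
  have almost_disjoint: "finite (Sg a \<inter> Sg b)" if ab: "a \<in> Q" "b \<in> Q" "a \<noteq> b" for a b
  proof (rule ccontr)
    assume inf: "infinite (Sg a \<inter> Sg b)"
    have abG: "a \<in> carrier G" "b \<in> carrier G" using ab Q by blast+
    obtain C1 where C1: "\<forall>s\<in>Sg a. card {j\<in>Sg a. transverse V j s} \<le> C1" using corridorD(9)[OF cor[OF abG(1)]] by blast
    obtain C2 where C2: "\<forall>s\<in>Sg b. card {j\<in>Sg b. transverse V j s} \<le> C2" using corridorD(9)[OF cor[OF abG(2)]] by blast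
    have "\<exists>B. \<forall>t\<ge>0. dc (ap a (c t)) (ap b (c t)) \<le> B"
    proof (rule rays_asymptotic[OF corridorD(1)[OF cor[OF abG(1)]] corridorD(1)[OF cor[OF abG(2)]]])
      show "geodesic_ray V E (\<lambda>t. ap a (c t))" "geodesic_ray V E (\<lambda>t. ap b (c t))" using ray_act abG c(1) by blast+
      show "ap a (c t) \<in> corridor_ray.Y V E (\<phi> a v) (Sg a)" "ap b (c t) \<in> corridor_ray.Y V E (\<phi> b v) (Sg b)" if "0 \<le> t" for t
        unfolding Sg_def using Y_act abG S(1) c(2)[OF that] by blast+
      show "ap a (c 0) = corridor_ray.base V E (\<phi> a v)" "ap b (c 0) = corridor_ray.base V E (\<phi> b v)"
        using base_act[OF _ S(1)] abG c(3) by simp_all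
      show "finite (Sg a - Sg b)" by (rule corridor_diff[OF cor[OF abG(1)] cor[OF abG(2)] inf])
      show "card {j \<in> Sg a. transverse V j s} \<le> C1" if "s \<in> Sg a" for s using C1 that by blast
      show "card {j \<in> Sg b. transverse V j s} \<le> C2" if "s \<in> Sg b" for s using C2 that by blast
    qed
    then have "f a = f b" unfolding f_def using visual_eq[OF ray_act[OF abG(1) c(1)] ray_act[OF abG(2) c(1)]] by blast
    then show False using ab Q(2) by (meson inj_onD)
  qed
  \<comment> \<open>One half-space is taken from each corridor in turn. It is kept out of the
    remaining corridors and away from their base points, as \<open>corridor_transverse\<close>
    demands for the later choices.\<close>
  have "\<exists>T. transverse_family T \<and> finite T \<and> card T = card R \<and> T \<subseteq> N \<and> (\<forall>t\<in>T. \<forall>g\<in>Q - R. t \<notin> Sg g \<and> \<phi> g v \<notin> t)" 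
    if "finite R" "R \<subseteq> Q" for R
    using that
  proof (induction R rule: finite_induct)
    case empty
    show ?case by (rule exI[of _ "{}"]) (simp add: transverse_family_def)
  next
    case (insert g R)
    then obtain T where T: "transverse_family T" "finite T" "card T = card R" "T \<subseteq> N" 
      and sep: "\<forall>t\<in>T. \<forall>g\<in>Q - R. t \<notin> Sg g \<and> \<phi> g v \<notin> t" by auto
    have gQ: "g \<in> Q" "g \<in> Q - R" "g \<in> carrier G" using insert Q by auto
    \<comment> \<open>Avoiding these finite sets secures, in this order, transversality to
      \<open>T\<close>, absence from the remaining corridors, and absence of their base
      points.\<close>
    define X where "X = (\<Union>t\<in>T. {s \<in> Sg g. \<not> transverse V t s}) \<union> (\<Union>g'\<in>Q - insert g R. Sg g \<inter> Sg g')
      \<union> (\<Union>g'\<in>Q. {s \<in> H. \<phi> g' v \<in> s \<and> \<phi> g v \<notin> s})"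
    have "finite X" unfolding X_def
    proof (intro finite_UnI finite_UN_I)
      show "finite {s \<in> Sg g. \<not> transverse V t s}" if "t \<in> T" for t
        by (rule corridor_transverse[OF N cor[OF gQ(3)] SgN[OF gQ(3)]]) (use T(4) sep that gQ in auto)
      show "finite (Sg g \<inter> Sg g')" if "g' \<in> Q - insert g R" for g' using almost_disjoint gQ that by auto
      show "finite {s \<in> H. \<phi> g' v \<in> s \<and> \<phi> g v \<notin> s}" if "g' \<in> Q" for g'
        by (rule finite_sep) (use act_V v gQ Q that in auto)
    qed (use T finQ in auto)
    then obtain s where s: "s \<in> Sg g" "s \<notin> X" using corridorD(4)[OF cor[OF gQ(3)]] by (meson finite_subset subsetI)
    have sN: "s \<in> N" using SgN gQ s by blast
    have tr: "transverse V t s" if "t \<in> T" for t using s that unfolding X_def by blast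
    have "transverse_family (insert s T)" by (rule transverse_family_insert[OF T(1) Nd(1)[OF sN] tr])
    moreover have "s \<notin> T" using tr transverse_not_sub(4) by blast
    moreover have "s \<notin> Sg g' \<and> \<phi> g' v \<notin> s" if g': "g' \<in> Q - insert g R" for g'
    proof
      show "s \<notin> Sg g'" using s g' unfolding X_def by blast
      have "\<phi> g v \<notin> s" using corridorD(5)[OF cor[OF gQ(3)] s(1)] .
      then show "\<phi> g' v \<notin> s" using s(2) g' Nd(1)[OF sN] unfolding X_def by blast
    qed
    ultimately show ?case using T insert(1,2) sN sep by (intro exI[of _ "insert s T"]) auto
  qed
  from this[OF finQ order_refl] show False using card_transverse_family cardQ by fastforce
qed

text \<open>The half-spaces containing a translate of an unflippable one would form a nonempty
  invariant filter.\<close>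

lemma flips:
  assumes ess: "essential G V E \<phi>" and ne: "nonelementary G V E \<phi>" shows flips
  unfolding flips_def
proof (rule ballI, rule ccontr)
  fix h assume h: "h \<in> H" and n: "\<not> (\<exists>g\<in>carrier G. g \<star> h \<inter> h = {})"
  note hV = H_sub[OF h]
  define N where "N = {k \<in> H. \<exists>g\<in>carrier G. g \<star> h \<subseteq> k}"
  have pw: "a \<star> h \<inter> b \<star> h \<noteq> {}" if ab: "a \<in> carrier G" "b \<in> carrier G" for a b
  proof
    assume e: "a \<star> h \<inter> b \<star> h = {}"
    have "inv b \<star> (a \<star> h \<inter> b \<star> h) = (inv b \<otimes> a) \<star> h \<inter> h"
      using image_Int[of "inv b" "a \<star> h" "b \<star> h"] image_sub_V image_mult[of "inv b" a h] image_inv ab hV by simp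
    then show False using e n ab by (metis image_empty inv_closed m_closed)
  qed
  have "inv_filter N" unfolding inv_filter_def
  proof (intro conjI ballI impI)
    show "N \<subseteq> H" unfolding N_def by blast
    show "k \<in> N" if "j \<in> N" "k \<in> H" "j \<subseteq> k" for j k using that unfolding N_def by (auto intro: order_trans)
    show "g \<star> k \<in> N" if k: "k \<in> N" "g \<in> carrier G" for k g
    proof -
      obtain a where a: "a \<in> carrier G" "a \<star> h \<subseteq> k" "k \<in> H" using k unfolding N_def by blast
      have "(g \<otimes> a) \<star> h \<subseteq> g \<star> k" using image_mult[OF k(2) a(1) hV] a(2) by (metis image_mono)
      then show ?thesis unfolding N_def using a k H_act by blast
    qed
    show "j \<inter> k \<noteq> {}" if jk: "j \<in> N" "k \<in> N" for j k
    proof -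
      obtain a b where "a \<in> carrier G" "a \<star> h \<subseteq> j" "b \<in> carrier G" "b \<star> h \<subseteq> k" using jk unfolding N_def by blast
      then show ?thesis using pw[of a b] by blast
    qed
  qed
  then have "N = {}" using inv_filter_empty ess ne by blast
  moreover have "\<one> \<star> h \<subseteq> h" using image_one hV by simp
  then have "h \<in> N" unfolding N_def using h by blast
  ultimately show False by blast
qed

end

section \<open>Isometric ergodicity and countable targets\<close>

lemma pred_countable:
  assumes X: "countable X" and P: "\<And>i. i \<in> X \<Longrightarrow> Measurable.pred M (\<lambda>x. P x i)"
  shows "Measurable.pred M (\<lambda>x. \<exists>i\<in>X. P x i)" "Measurable.pred M (\<lambda>x. \<forall>i\<in>X. P x i)"
proof -
  have ex: "Measurable.pred M (\<lambda>x. \<exists>i\<in>X. Q x i)" if "\<And>i. i \<in> X \<Longrightarrow> Measurable.pred M (\<lambda>x. Q x i)" for Q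
  proof -
    have "{x \<in> space M. \<exists>i\<in>X. Q x i} = (\<Union>i\<in>X. {x \<in> space M. Q x i})" by auto
    also have "\<dots> \<in> sets M" by (rule sets.countable_UN''[OF X]) (use that in \<open>simp add: pred_def\<close>)
    finally show ?thesis by (simp add: pred_def)
  qed
  show "Measurable.pred M (\<lambda>x. \<exists>i\<in>X. P x i)" by (rule ex[OF P])
  have "Measurable.pred M (\<lambda>x. \<not> (\<exists>i\<in>X. \<not> P x i))" by (intro pred_intros_logic ex P)
  then show "Measurable.pred M (\<lambda>x. \<forall>i\<in>X. P x i)" by simp
qed

text \<open>The discrete metric on a countable set is separable and preserved by all permutations.
  The set is copied into the reals because \<open>isometrically_ergodic\<close> speaks of metric
  spaces carried by sets of reals.\<close>

lemma (in group) isometrically_ergodic_countable: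
  assumes erg: "isometrically_ergodic G \<alpha> \<nu>" and C: "countable C"
    and f: "\<And>z. z \<in> space \<nu> \<Longrightarrow> f z \<in> C" "\<And>c. c \<in> C \<Longrightarrow> {z \<in> space \<nu>. f z = c} \<in> sets \<nu>"
    and act: "\<And>g c. g \<in> carrier G \<Longrightarrow> c \<in> C \<Longrightarrow> \<beta> g c \<in> C" "\<And>c. c \<in> C \<Longrightarrow> \<beta> \<one> c = c"
      "\<And>g k c. g \<in> carrier G \<Longrightarrow> k \<in> carrier G \<Longrightarrow> c \<in> C \<Longrightarrow> \<beta> (g \<otimes> k) c = \<beta> g (\<beta> k c)"
    and eq: "\<And>g z. g \<in> carrier G \<Longrightarrow> z \<in> space \<nu> \<Longrightarrow> f (\<alpha> g z) = \<beta> g (f z)"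
  shows "\<exists>c\<in>C. AE z in \<nu>. f z = c"
proof -
  define \<iota> where "\<iota> c = real (to_nat_on C c)" for c
  have inj: "inj_on \<iota> C" using inj_on_to_nat_on[OF C] unfolding \<iota>_def inj_on_def by simp
  define M where "M = \<iota> ` C"
  define d where "d x y = (if x = y then 0 else 1 :: real)" for x y :: real
  define dec where "dec = inv_into C \<iota>"
  have dec: "dec (\<iota> c) = c" if "c \<in> C" for c unfolding dec_def using inj that by simp
  have decC: "dec x \<in> C" "\<iota> (dec x) = x" if "x \<in> M" for x
    using that dec unfolding M_def by auto
  \<comment> \<open>Restricted to \<open>M\<close>, because the elements of \<open>Bij M\<close> are
    extensional.\<close>
  define \<psi> where "\<psi> g = (\<lambda>x\<in>M. \<iota> (\<beta> g (dec x)))" for g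
  have \<psi>: "\<psi> g (\<iota> c) = \<iota> (\<beta> g c)" if "c \<in> C" for g c unfolding \<psi>_def M_def using that dec by simp
  have \<psi>M: "\<psi> g x \<in> M" if "g \<in> carrier G" "x \<in> M" for g x
    unfolding \<psi>_def using that act(1) decC(1) unfolding M_def by simp
  have \<psi>mult: "\<psi> (g \<otimes> k) x = \<psi> g (\<psi> k x)" if gk: "g \<in> carrier G" "k \<in> carrier G" and x: "x \<in> M" for g k x
  proof -
    obtain c where "c \<in> C" "x = \<iota> c" using x unfolding M_def by blast
    then show ?thesis using \<psi> act gk by simp
  qed
  have \<psi>one: "\<psi> \<one> x = x" if x: "x \<in> M" for x
  proof -
    obtain c where "c \<in> C" "x = \<iota> c" using x unfolding M_def by blast
    then show ?thesis using \<psi> act by simp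
  qed
  interpret Metric_space M d
    by unfold_locales (auto simp: d_def)
  have sep: "separable_space mtopology"
    unfolding separable_space_def
  proof (intro exI conjI)
    show "countable M" unfolding M_def using C by simp
    show "mtopology closure_of M = topspace mtopology" using closure_of_topspace[of mtopology] by simp
  qed simp
  have fM: "\<iota> (f z) \<in> M" if "z \<in> space \<nu>" for z using f(1)[OF that] unfolding M_def by blast
  have bij: "\<psi> g \<in> Bij M" if g: "g \<in> carrier G" for g
  proof -
    have "bij_betw (\<psi> g) M M"
    proof (rule bij_betwI[of _ _ _ "\<psi> (inv g)"])
      show "\<psi> g \<in> M \<rightarrow> M" "\<psi> (inv g) \<in> M \<rightarrow> M" using \<psi>M g by auto
      show "\<psi> (inv g) (\<psi> g x) = x" if "x \<in> M" for x using \<psi>mult[of "inv g" g x] \<psi>one g that by simp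
      show "\<psi> g (\<psi> (inv g) x) = x" if "x \<in> M" for x using \<psi>mult[of g "inv g" x] \<psi>one g that by simp
    qed
    then show ?thesis unfolding Bij_def \<psi>_def by simp
  qed
  have "group_action G M \<psi>" unfolding group_action_def group_hom_def group_hom_axioms_def
  proof (intro conjI group_BijGroup homI)
    show "Group.group G" by (rule is_group)
    show "\<psi> g \<in> carrier (BijGroup M)" if "g \<in> carrier G" for g using bij that by (simp add: BijGroup_def)
    show "\<psi> (g \<otimes> k) = \<psi> g \<otimes>\<^bsub>BijGroup M\<^esub> \<psi> k" if "g \<in> carrier G" "k \<in> carrier G" for g k
    proof -
      have "\<psi> (g \<otimes> k) = compose M (\<psi> g) (\<psi> k)"
      proof
        fix x show "\<psi> (g \<otimes> k) x = compose M (\<psi> g) (\<psi> k) x"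
          using \<psi>mult[OF that, of x] by (cases "x \<in> M") (simp_all add: compose_def, simp add: \<psi>_def)
      qed
      then show ?thesis using bij that by (simp add: BijGroup_def)
    qed
  qed
  moreover have "d (\<psi> g x) (\<psi> g y) = d x y" if "g \<in> carrier G" "x \<in> M" "y \<in> M" for g x y
  proof -
    have "\<psi> g x = \<psi> g y \<longleftrightarrow> x = y" using bij[OF that(1)] that unfolding Bij_def bij_betw_def by (auto dest: inj_onD)
    then show ?thesis unfolding d_def by simp
  qed
  moreover have "(\<lambda>z. \<iota> (f z)) \<in> \<nu> \<rightarrow>\<^sub>M top_borel mtopology"
    unfolding top_borel_def
  proof (rule measurable_measure_of)
    show "{U. openin mtopology U} \<subseteq> Pow (topspace mtopology)" using openin_subset by blast
    show "(\<lambda>z. \<iota> (f z)) \<in> space \<nu> \<rightarrow> topspace mtopology" using fM by simp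
    fix U
    have "(\<lambda>z. \<iota> (f z)) -` U \<inter> space \<nu> = (\<Union>c\<in>{c \<in> C. \<iota> c \<in> U}. {z \<in> space \<nu>. f z = c})" using f(1) by auto
    also have "\<dots> \<in> sets \<nu>" by (rule sets.countable_UN''[OF countable_subset[OF _ C]]) (use f(2) in auto)
    finally show "(\<lambda>z. \<iota> (f z)) -` U \<inter> space \<nu> \<in> sets \<nu>" .
  qed
  moreover have "AE z in \<nu>. \<iota> (f (\<alpha> g z)) = \<psi> g (\<iota> (f z))" if "g \<in> carrier G" for g
    by (rule AE_I2) (use eq that \<psi> f(1) in simp)
  ultimately obtain x where x: "x \<in> M" "AE z in \<nu>. \<iota> (f z) = x"
    using erg[unfolded isometrically_ergodic_def, rule_format, of M d \<psi> "\<lambda>z. \<iota> (f z)"] sep Metric_space_axioms by blast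
  have "AE z in \<nu>. f z = dec x" using x(2)
  proof (rule AE_mp[OF _ AE_I2])
    fix z assume "z \<in> space \<nu>"
    then show "\<iota> (f z) = x \<longrightarrow> f z = dec x" using dec f(1) by auto
  qed
  then show ?thesis using decC(1)[OF x(1)] by blast
qed

section \<open>The Roller boundary\<close>

context median_complex
begin

lemma descending_escape:
  assumes "\<And>n. x n \<in> H" "\<And>n::nat. x (Suc n) \<subset> x n" "v \<in> V" shows "\<exists>n. v \<notin> x n"
proof (rule ccontr)
  assume n: "\<not> ?thesis"
  obtain w where w: "w \<in> V" "w \<notin> x 0" using H_co_ne assms(1) by blast
  have anti: "x j \<subseteq> x i" if "i \<le> j" for i j by (rule lift_Suc_antimono_le[OF _ that]) (use assms in blast)
  have strict: "x j \<subset> x i" if "i < j" for i j 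
    using anti[of "Suc i" j] assms(2)[of i] that by (metis Suc_leI order_le_less_trans)
  have "inj x" using strict by (intro linorder_injI) auto
  moreover have "range x \<subseteq> {j \<in> H. v \<in> j \<and> w \<notin> j}"
  proof (rule image_subsetI)
    fix k show "x k \<in> {j \<in> H. v \<in> j \<and> w \<notin> j}" using assms(1)[of k] n w(2) anti[of 0 k] by auto
  qed
  ultimately show False using finite_sep[OF assms(3) w(1)] finite_subset finite_imageD by blast
qed

abbreviation "bd \<equiv> roller_boundary V E H"

lemma bd_closure: "\<xi> \<in> bd \<Longrightarrow> \<xi> \<in> roller_closure V E H"
  unfolding roller_boundary_def by blast

text \<open>Statements about finitely many half-spaces at \<open>\<xi>\<close> can be checked at a
  vertex.\<close>

lemma bd_finite:
  assumes "\<xi> \<in> bd" "finite F" "F \<subseteq> H" obtains u where "u \<in> V" "\<And>h. h \<in> F \<Longrightarrow> h \<in> \<xi> \<longleftrightarrow> u \<in> h"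
proof -
  obtain u where u: "u \<in> V" "Uv V E u \<inter> F = \<xi> \<inter> F" using bd_closure[OF assms(1)] assms(2,3) unfolding roller_closure_def by blast
  have "h \<in> \<xi> \<longleftrightarrow> u \<in> h" if "h \<in> F" for h
  proof -
    have "h \<in> \<xi> \<longleftrightarrow> h \<in> Uv V E u" using u(2) that by blast
    then show ?thesis using that assms(3) unfolding Uv_def by auto
  qed
  then show ?thesis using that u by blast
qed

lemma bd_H: "\<xi> \<in> bd \<Longrightarrow> h \<in> \<xi> \<Longrightarrow> h \<in> H"
  using bd_closure unfolding roller_closure_def by blast

lemma bd_compl: "\<xi> \<in> bd \<Longrightarrow> h \<in> H \<Longrightarrow> V - h \<in> \<xi> \<longleftrightarrow> h \<notin> \<xi>"
  by (rule bd_finite[of \<xi> "{h, V - h}"]) auto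

lemma bd_Int: "\<xi> \<in> bd \<Longrightarrow> h \<in> \<xi> \<Longrightarrow> k \<in> \<xi> \<Longrightarrow> h \<inter> k \<noteq> {}"
  by (rule bd_finite[of \<xi> "{h, k}"]) (use bd_H in auto)

lemma bd_up: "\<xi> \<in> bd \<Longrightarrow> h \<in> \<xi> \<Longrightarrow> k \<in> H \<Longrightarrow> h \<subseteq> k \<Longrightarrow> k \<in> \<xi>"
  by (rule bd_finite[of \<xi> "{h, k}"]) (use bd_H in auto)

abbreviation "M0 \<equiv> boundary_measurable V E"
definition "cyl h = {\<xi> \<in> bd. h \<in> \<xi>}"

lemma space_M0: "space M0 = bd"
  unfolding boundary_measurable_def by (subst space_measure_of) auto

lemma cyl_sets: "h \<in> H \<Longrightarrow> cyl h \<in> sets M0"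
  unfolding boundary_measurable_def cyl_def by (subst sets_measure_of) (auto intro!: sigma_sets.Basic)

text \<open>The two half-spaces meet because both contain \<open>\<xi>\<close>, their complements
  because both contain \<open>\<eta>\<close>; so only nesting can prevent transversality.\<close>

lemma between_transverse:
  assumes "\<xi> \<in> bd" "\<eta> \<in> bd" "h \<in> \<xi> - \<eta>" "k \<in> \<xi> - \<eta>" "\<not> h \<subseteq> k" "\<not> k \<subseteq> h"
  shows "transverse V h k"
proof -
  have H: "h \<in> H" "k \<in> H" using bd_H assms by blast+
  have "V - h \<in> \<eta>" "V - k \<in> \<eta>" using bd_compl[OF assms(2)] H assms by blast+
  then obtain w where "w \<in> (V - h) \<inter> (V - k)" using bd_Int[OF assms(2)] by blast
  moreover have "h \<inter> k \<noteq> {}" using bd_Int[OF assms(1)] assms by blast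
  ultimately show ?thesis using transverseI[OF H_sub[OF H(1)] H_sub[OF H(2)] _ assms(5,6), of w] by blast
qed

end

section \<open>The action on the Roller boundary and positivity of cylinders\<close>

context cube_action
begin

lemma act_roller_mem:
  assumes "g \<in> carrier G" "\<xi> \<subseteq> H" "h \<in> H" shows "h \<in> act_roller \<phi> g \<xi> \<longleftrightarrow> inv g \<star> h \<in> \<xi>"
proof
  assume "h \<in> act_roller \<phi> g \<xi>"
  then obtain k where k: "k \<in> \<xi>" "h = g \<star> k" unfolding act_roller_def by blast
  then have "k \<subseteq> V" using assms H_sub by blast
  then show "inv g \<star> h \<in> \<xi>" using k image_inv[OF assms(1)] by simp
next
  assume "inv g \<star> h \<in> \<xi>"
  then show "h \<in> act_roller \<phi> g \<xi>" using mem_image_H[OF assms(1,3)] unfolding act_roller_def by blast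
qed

lemma act_roller_H: "g \<in> carrier G \<Longrightarrow> \<xi> \<subseteq> H \<Longrightarrow> act_roller \<phi> g \<xi> \<subseteq> H"
  unfolding act_roller_def using H_act by blast

lemma act_roller_inv:
  assumes "g \<in> carrier G" "\<xi> \<subseteq> H" shows "act_roller \<phi> (inv g) (act_roller \<phi> g \<xi>) = \<xi>"
proof -
  have "inv g \<star> g \<star> h = h" if "h \<in> \<xi>" for h using image_inv[OF assms(1) H_sub[OF subsetD[OF assms(2) that]]] .
  then show ?thesis unfolding act_roller_def by (simp add: image_image)
qed

lemma act_roller_Uv:
  assumes "g \<in> carrier G" "u \<in> V" shows "act_roller \<phi> g (Uv V E u) = Uv V E (\<phi> g u)"
proof -
  have "h \<in> act_roller \<phi> g (Uv V E u) \<longleftrightarrow> h \<in> Uv V E (\<phi> g u)" if h: "h \<in> H" for h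
  proof -
    have "h \<in> act_roller \<phi> g (Uv V E u) \<longleftrightarrow> u \<in> inv g \<star> h"
      using act_roller_mem[OF assms(1) _ h, of "Uv V E u"] H_act_inv[OF assms(1) h] unfolding Uv_def by auto
    also have "\<dots> \<longleftrightarrow> \<phi> g u \<in> h" using mem_image[of "inv g" u h] assms H_sub[OF h] by simp
    finally show ?thesis using h unfolding Uv_def by simp
  qed
  moreover have "act_roller \<phi> g (Uv V E u) \<subseteq> H" by (rule act_roller_H[OF assms(1)]) (auto simp: Uv_def)
  moreover have "Uv V E (\<phi> g u) \<subseteq> H" by (auto simp: Uv_def)
  ultimately show ?thesis by blast
qed

lemma act_roller_bd:
  assumes g: "g \<in> carrier G" and x: "\<xi> \<in> bd" shows "act_roller \<phi> g \<xi> \<in> bd"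
proof -
  have xH: "\<xi> \<subseteq> H" using bd_H x by blast
  have "\<exists>u\<in>V. Uv V E u \<inter> F = act_roller \<phi> g \<xi> \<inter> F" if F: "finite F" "F \<subseteq> H" for F
  proof -
    obtain u where u: "u \<in> V" "\<And>h. h \<in> (\<lambda>h. inv g \<star> h) ` F \<Longrightarrow> h \<in> \<xi> \<longleftrightarrow> u \<in> h"
      using bd_finite[OF x, of "(\<lambda>h. inv g \<star> h) ` F"] F H_act_inv[OF g] by blast
    have "h \<in> Uv V E (\<phi> g u) \<longleftrightarrow> h \<in> act_roller \<phi> g \<xi>" if h: "h \<in> F" for h
    proof -
      have hH: "h \<in> H" using h F by blast
      have "h \<in> Uv V E (\<phi> g u) \<longleftrightarrow> u \<in> inv g \<star> h" 
        using mem_image[of "inv g" u h] g u(1) H_sub[OF hH] hH unfolding Uv_def by simp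
      also have "\<dots> \<longleftrightarrow> inv g \<star> h \<in> \<xi>" using u(2) h by blast
      finally show ?thesis using act_roller_mem[OF g xH hH] by simp
    qed
    then show ?thesis using act_V[OF g u(1)] by blast
  qed
  note fin = this
  have neq: "act_roller \<phi> g \<xi> \<noteq> Uv V E u \<inter> H" if u: "u \<in> V" for u
  proof
    assume "act_roller \<phi> g \<xi> = Uv V E u \<inter> H"
    then have "act_roller \<phi> g \<xi> = Uv V E u" unfolding Uv_def by blast
    then have "\<xi> = Uv V E (\<phi> (inv g) u)" using act_roller_inv[OF g xH] act_roller_Uv[of "inv g" u] g u by simp
    moreover have "Uv V E (\<phi> (inv g) u) = Uv V E (\<phi> (inv g) u) \<inter> H" unfolding Uv_def by blast
    ultimately show False using x act_V[of "inv g" u] g u unfolding roller_boundary_def by blast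
  qed
  show ?thesis unfolding roller_boundary_def
  proof (intro DiffI notI)
    show "act_roller \<phi> g \<xi> \<in> roller_closure V E H" unfolding roller_closure_def
      by (intro CollectI conjI allI impI act_roller_H[OF g xH]) (use fin in blast)
    assume "act_roller \<phi> g \<xi> \<in> {Uv V E v \<inter> H |v. v \<in> V}"
    then obtain u where "u \<in> V" "act_roller \<phi> g \<xi> = Uv V E u \<inter> H" by blast
    then show False using neq by simp
  qed
qed

lemma act_roller_cyl:
  assumes g: "g \<in> carrier G" and h: "h \<in> H" shows "act_roller \<phi> g ` cyl h = cyl (g \<star> h)"
proof (intro equalityI subsetI)
  fix \<xi> assume "\<xi> \<in> act_roller \<phi> g ` cyl h"
  then show "\<xi> \<in> cyl (g \<star> h)" using act_roller_bd[OF g] unfolding cyl_def act_roller_def by blast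
next
  fix \<xi> assume "\<xi> \<in> cyl (g \<star> h)"
  then have x: "\<xi> \<in> bd" "g \<star> h \<in> \<xi>" "\<xi> \<subseteq> H" unfolding cyl_def using bd_H by blast+
  have "act_roller \<phi> (inv g) \<xi> \<in> cyl h"
    using act_roller_bd[of "inv g", OF _ x(1)] act_roller_mem[of "inv g" \<xi> h] g h x unfolding cyl_def by simp
  moreover have "\<xi> = act_roller \<phi> g (act_roller \<phi> (inv g) \<xi>)" using act_roller_inv[of "inv g" \<xi>] g x(3) by simp
  ultimately show "\<xi> \<in> act_roller \<phi> g ` cyl h" by blast
qed

text \<open>The half-spaces of full measure form an invariant filter.\<close>

lemma cyl_pos:
  assumes ess: "essential G V E \<phi>" and ne: "nonelementary G V E \<phi>"
    and l: "prob_space l" "sets l = sets M0" "quasi_invariant G (act_roller \<phi>) l" and h: "h \<in> H"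
  shows "emeasure l (cyl h) > 0"
proof -
  interpret prob_space l by fact
  have sp: "space l = bd" using sets_eq_imp_space_eq[OF l(2)] space_M0 by simp
  have cs: "cyl h \<in> sets l" if "h \<in> H" for h using cyl_sets that l(2) by simp
  define N where "N = {h \<in> H. emeasure l (cyl (V - h)) = 0}"
  have "inv_filter N" unfolding inv_filter_def
  proof (intro conjI ballI impI)
    show "N \<subseteq> H" unfolding N_def by blast
    fix h assume h: "h \<in> N"
    then have hH: "h \<in> H" "emeasure l (cyl (V - h)) = 0" unfolding N_def by auto
    show "k \<in> N" if k: "k \<in> H" "h \<subseteq> k" for k
    proof -
      have "cyl (V - k) \<subseteq> cyl (V - h)" unfolding cyl_def using bd_compl bd_up k hH(1) by blast
      then have "emeasure l (cyl (V - k)) \<le> emeasure l (cyl (V - h))" by (rule emeasure_mono) (use cs hH in simp)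
      then show ?thesis unfolding N_def using hH k by simp
    qed
    show "g \<star> h \<in> N" if g: "g \<in> carrier G" for g
    proof (rule ccontr)
      have gh: "g \<star> h \<in> H" using H_act g hH by blast
      assume "g \<star> h \<notin> N"
      then have "emeasure l (cyl (V - g \<star> h)) > 0" unfolding N_def using gh by (simp add: zero_less_iff_neq_zero)
      then have "emeasure l (act_roller \<phi> (inv g) ` cyl (V - g \<star> h)) > 0"
        using l(3) cs[OF H_compl[OF gh]] g unfolding quasi_invariant_def by blast
      moreover have "inv g \<star> (V - g \<star> h) = V - h" using inv_image_compl[OF g gh] image_inv[OF g H_sub[OF hH(1)]] by simp
      ultimately show False using act_roller_cyl[of "inv g" "V - g \<star> h"] g gh hH by simp
    qed
    fix k assume k: "k \<in> N"
    then have kH: "k \<in> H" "emeasure l (cyl (V - k)) = 0" unfolding N_def by auto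
    show "h \<inter> k \<noteq> {}"
    proof
      assume "h \<inter> k = {}"
      then have "space l \<subseteq> cyl (V - h) \<union> cyl (V - k)" unfolding sp cyl_def using bd_compl bd_Int hH(1) kH(1) by blast
      then have "emeasure l (space l) \<le> emeasure l (cyl (V - h) \<union> cyl (V - k))" by (rule emeasure_mono) (use cs hH kH in simp)
      also have "\<dots> \<le> emeasure l (cyl (V - h)) + emeasure l (cyl (V - k))" by (rule emeasure_subadditive) (use cs hH kH in simp_all)
      finally show False using hH kH emeasure_space_1 by simp
    qed
  qed
  then have "N = {}" using inv_filter_empty ess ne by blast
  \<comment> \<open>\<open>h\<close> has positive measure because its complement is not in
    \<open>N\<close>.\<close>
  then have "emeasure l (cyl (V - (V - h))) \<noteq> 0" using H_compl[OF h] unfolding N_def by blast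
  then show ?thesis using H_dcompl[OF h] by (simp add: zero_less_iff_neq_zero)
qed

end

section \<open>Regularity of generic points\<close>

context irreducible_blocks
begin

definition "gap h h' = card {l \<in> H. h \<subseteq> l \<and> l \<subseteq> h'}"

text \<open>Only the gap between the outer two is bounded: the middle half-spaces will be made to
  descend, the inner ones follow by inclusion, and the bound drags the outer ones along.\<close>

definition "triple c B h' h k \<longleftrightarrow> B \<in> P \<and> h' \<in> B \<and> h \<in> B \<and> k \<in> B \<and> k \<subseteq> h \<and> h \<subseteq> h'
  \<and> strongly_separated V B k h \<and> strongly_separated V B h h' \<and> gap h h' \<le> c"

lemma gap_act:
  assumes g: "g \<in> carrier G" and h: "h \<in> H" "h' \<in> H" shows "gap (g \<star> h) (g \<star> h') = gap h h'"
proof -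
  have "{l \<in> H. g \<star> h \<subseteq> l \<and> l \<subseteq> g \<star> h'} = (\<lambda>l. g \<star> l) ` {l \<in> H. h \<subseteq> l \<and> l \<subseteq> h'}"
  proof (intro equalityI subsetI)
    fix l assume l: "l \<in> {l \<in> H. g \<star> h \<subseteq> l \<and> l \<subseteq> g \<star> h'}"
    then have lH: "l \<in> H" by blast
    have "h \<subseteq> inv g \<star> l" "inv g \<star> l \<subseteq> h'"
      using l mem_image_H[OF g lH] image_sub[OF g H_sub[OF h(1)] H_sub[OF H_act_inv[OF g lH]]] 
        image_sub[OF g H_sub[OF H_act_inv[OF g lH]] H_sub[OF h(2)]] by auto
    then show "l \<in> (\<lambda>l. g \<star> l) ` {l \<in> H. h \<subseteq> l \<and> l \<subseteq> h'}" using mem_image_H[OF g lH] H_act_inv[OF g lH] by blast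
  next
    fix l assume "l \<in> (\<lambda>l. g \<star> l) ` {l \<in> H. h \<subseteq> l \<and> l \<subseteq> h'}"
    then show "l \<in> {l \<in> H. g \<star> h \<subseteq> l \<and> l \<subseteq> g \<star> h'}" using H_act[OF g] by blast
  qed
  moreover have "inj_on (\<lambda>l. g \<star> l) {l \<in> H. h \<subseteq> l \<and> l \<subseteq> h'}" by (rule image_inj_H[OF g]) blast
  ultimately show ?thesis unfolding gap_def by (simp add: card_image)
qed

lemma triple_act:
  assumes g: "g \<in> carrier G" and t: "triple c B h' h k"
  shows "triple c ((\<lambda>l. g \<star> l) ` B) (g \<star> h') (g \<star> h) (g \<star> k)"
proof -
  have B: "B \<in> P" "h' \<in> B" "h \<in> B" "k \<in> B" using t unfolding triple_def by blast+
  note H = P_H[OF B(1)]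
  show ?thesis unfolding triple_def
    using t B block_act[OF g B(1)] strongly_separated_act[OF g B(1)] gap_act[OF g H[OF B(3)] H[OF B(2)]]
    unfolding triple_def by (simp add: image_mono)
qed

text \<open>There are finitely many blocks, so the sum of their individual bounds serves for
  all.\<close>

lemma ex_uniform_triple:
  assumes fl: flips shows "\<exists>c. \<forall>B\<in>P. \<exists>h' h k. triple c B h' h k"
proof -
  have "\<exists>c h' h k. triple c B h' h k" if "B \<in> P" for B
    using ex_triple[OF fl that] that unfolding triple_def by blast
  then obtain c where c: "\<And>B. B \<in> P \<Longrightarrow> \<exists>h' h k. triple (c B) B h' h k" by metis
  have "\<exists>h' h k. triple (\<Sum>B\<in>P. c B) B h' h k" if B: "B \<in> P" for B
  proof -
    have "c B \<le> (\<Sum>B\<in>P. c B)" by (rule member_le_sum[OF B]) (simp_all add: finite_P)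
    then show ?thesis using c[OF B] unfolding triple_def by (meson order_trans)
  qed
  then show ?thesis by blast
qed

text \<open>The bound on the gaps forces the outer half-spaces \<open>h'\<close> of the triples to shrink to \<open>\<xi>\<close> together with
  the middle ones.\<close>

lemma regular_if_descending:
  assumes xi: "\<xi> \<in> bd" "\<eta> \<in> bd" and B: "B \<in> P"
    and W: "W = {h. \<exists>h' k. triple c B h' h k \<and> {h', h, k} \<subseteq> \<xi> - \<eta>}" "W \<noteq> {}" "\<And>h. h \<in> W \<Longrightarrow> \<exists>j\<in>W. j \<subset> h"
  shows "\<xi> \<inter> B \<in> factor_regular V E B" "\<eta> \<inter> B \<noteq> \<xi> \<inter> B"
proof -
  obtain h0 where h0: "h0 \<in> W" using W(2) by blast
  have "\<exists>h. \<forall>n. h n \<in> W \<and> h (Suc n) \<subset> h n"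
    by (intro dependent_nat_choice) (use h0 W(3) in blast)+
  then obtain h :: "nat \<Rightarrow> 'a set" where h: "\<forall>n. h n \<in> W \<and> h (Suc n) \<subset> h n" by (elim exE)
  then have "\<forall>n. \<exists>h' k. triple c B h' (h n) k \<and> {h', h n, k} \<subseteq> \<xi> - \<eta>" unfolding W(1) by simp
  then obtain h' k where t: "\<And>n. triple c B (h' n) (h n) (k n)" and I: "\<And>n. {h' n, h n, k n} \<subseteq> \<xi> - \<eta>" by metis
  have inB: "h' n \<in> B" "h n \<in> B" "k n \<in> B" for n using t[of n] unfolding triple_def by simp_all
  note PH = P_H[OF B]
  have nest: "k n \<subseteq> h n" "h n \<subseteq> h' n" for n using t[of n] unfolding triple_def by simp_all
  have ss: "strongly_separated V B (k n) (h n)" "strongly_separated V B (h n) (h' n)" and gp: "gap (h n) (h' n) \<le> c" for n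
    using t[of n] unfolding triple_def by simp_all
  have In: "h' n \<in> \<xi> - \<eta>" "h n \<in> \<xi> - \<eta>" "k n \<in> \<xi> - \<eta>" for n using I[of n] by blast+
  have anti: "h j \<subseteq> h i" if "i \<le> j" for i j by (rule lift_Suc_antimono_le[OF _ that]) (use h in blast)
  have strict: "h j \<subset> h i" if "i < j" for i j 
    using anti[of "Suc i" j] h that by (metis Suc_leI order_le_less_trans)
  have esc: "\<exists>n. \<forall>m\<ge>n. v \<notin> h m" if "v \<in> V" for v
    using descending_escape[of h v] h PH inB that anti by (meson subsetD)
  have esc': "\<exists>n. \<forall>m\<ge>n. v \<notin> h' m" if v: "v \<in> V" for v
  proof -
    obtain m0 where m0: "\<And>m. m \<ge> m0 \<Longrightarrow> v \<notin> h m" using esc[OF v] by blast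
    \<comment> \<open>A shift by \<open>Suc c\<close> indices passes more half-spaces than fit into
      a gap.\<close>
    define s where "s = Suc c"
    have step: "h' (i + s) \<subset> h' i" if i: "i \<ge> m0" "v \<in> h' (i + s)" for i
    proof -
      have n1: "\<not> h' (i + s) \<subseteq> h i" using m0[OF i(1)] i(2) by blast
      \<comment> \<open>Otherwise the \<open>s + 1\<close> half-spaces \<open>h i\<close>, ...,
        \<open>h (i + s)\<close> would all lie between \<open>h (i + s)\<close> and
        \<open>h' (i + s)\<close>, more than the gap allows.\<close>
      have n2: "\<not> h i \<subseteq> h' (i + s)"
      proof
        assume sub: "h i \<subseteq> h' (i + s)"
        have "h ` {i..i+s} \<subseteq> {l \<in> H. h (i + s) \<subseteq> l \<and> l \<subseteq> h' (i + s)}"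
        proof
          fix l assume "l \<in> h ` {i..i+s}"
          then obtain x where "l = h x" "i \<le> x" "x \<le> i + s" by auto
          then show "l \<in> {l \<in> H. h (i + s) \<subseteq> l \<and> l \<subseteq> h' (i + s)}" 
            using anti[of i x] anti[of x "i + s"] sub PH[OF inB(2)] by auto
        qed
        then have "card (h ` {i..i+s}) \<le> gap (h (i + s)) (h' (i + s))"
          unfolding gap_def by (rule card_mono[OF finite_between[OF PH[OF inB(2)] PH[OF inB(1)]]])
        moreover have "inj_on h {i..i+s}" using strict by (intro linorder_inj_onI) auto
        then have "card (h ` {i..i+s}) = Suc s" by (simp add: card_image)
        ultimately show False using gp[of "i + s"] s_def by simp
      qed
      \<comment> \<open>Strong separation of \<open>h i\<close> and \<open>h' i\<close> forbids
        transversality to both, so \<open>h' (i + s)\<close> is nested with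
        \<open>h' i\<close>.\<close>
      have "transverse V (h' (i + s)) (h i)" using between_transverse[OF xi In(1) In(2) n1 n2] .
      then have "\<not> transverse V (h' (i + s)) (h' i)" using ss(2)[of i] inB(1) unfolding strongly_separated_def by blast
      then have "h' (i + s) \<subseteq> h' i \<or> h' i \<subseteq> h' (i + s)" using between_transverse[OF xi In(1) In(1)] by blast
      then show ?thesis using n2 nest(2)[of i] by blast
    qed
    \<comment> \<open>The descent of the outer half-spaces is known only in steps of length
      \<open>s\<close>, so escape is shown for each residue class.\<close>
    have "\<exists>q. v \<notin> h' (m0 + r + q * s)" for r
    proof (rule ccontr)
      assume n: "\<not> ?thesis"
      have "h' (m0 + r + Suc q * s) \<subset> h' (m0 + r + q * s)" for q
        using step[of "m0 + r + q * s"] n by (simp add: algebra_simps) (metis add.commute add.left_commute mult_Suc)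
      then show False using descending_escape[of "\<lambda>q. h' (m0 + r + q * s)" v] PH[OF inB(1)] v n by blast
    qed
    then obtain q where q: "\<And>r. v \<notin> h' (m0 + r + q r * s)" by metis
    \<comment> \<open>Once out, always out: if \<open>v\<close> returned at the next index of the
      class, the descent would put it into the present one.\<close>
    have q': "v \<notin> h' (m0 + r + p * s)" if "q r \<le> p" for r p
      using that
    proof (induction p rule: dec_induct)
      case (step p)
      have "m0 + r + Suc p * s = (m0 + r + p * s) + s" by simp
      then show ?case using \<open>\<And>i. m0 \<le> i \<Longrightarrow> v \<in> h' (i + s) \<Longrightarrow> h' (i + s) \<subset> h' i\<close>[of "m0 + r + p * s"] step(3) 
        by (metis (no_types, lifting) add.assoc le_add1 psubsetD)
    qed (rule q)
    define Q where "Q = (\<Sum>r<s. q r)"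
    have "v \<notin> h' m" if m: "m \<ge> m0 + Q * s" for m
    proof -
      define r where "r = (m - m0) mod s"
      define p where "p = (m - m0) div s"
      have "r < s" unfolding r_def s_def by simp
      then have "q r \<le> Q" unfolding Q_def by (intro member_le_sum) auto
      moreover have "Q \<le> p" unfolding p_def s_def using m s_def by (subst less_eq_div_iff_mult_less_eq) auto
      moreover have "m = m0 + r + p * s" using m unfolding r_def p_def by simp
      ultimately show ?thesis using q'[of r p] by simp
    qed
    then show ?thesis by blast
  qed
  have small: "\<exists>n. \<forall>m\<ge>n. k m \<subseteq> j \<and> strongly_separated V B (k m) j" if j: "j \<in> \<xi> \<inter> B" for j
  proof -
    have jH: "j \<in> H" using PH j by blast
    obtain y where y: "y \<in> j" "y \<in> V" using H_ne[OF jH] by blast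
    obtain x where x: "x \<notin> j" "x \<in> V" using H_co_ne[OF jH] by blast
    obtain n1 where n1: "\<forall>m\<ge>n1. y \<notin> h' m" using esc'[OF y(2)] by blast
    obtain n2 where n2: "\<forall>m\<ge>n2. x \<notin> h' m" using esc'[OF x(2)] by blast
    have "k m \<subseteq> j \<and> strongly_separated V B (k m) j" if m: "m \<ge> max n1 n2" for m
    proof -
      have yx: "y \<notin> h' m" "x \<notin> h' m" using n1 n2 m by auto
      \<comment> \<open>Since \<open>h' m\<close> misses a point of \<open>j\<close> and a point
        outside \<open>j\<close>, a member of \<open>\<xi>\<close> inside \<open>h' m\<close> is
        contained in \<open>j\<close> or transverse to \<open>j\<close>. Strong separation excludes
        transversality for both \<open>h m\<close> and \<open>h' m\<close>, whence
        \<open>h m \<subseteq> j\<close>.\<close>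
      have tr: "transverse V j u" if u: "u \<in> \<xi>" "u \<subseteq> h' m" "\<not> u \<subseteq> j" for u
      proof (rule transverseI[where v = x])
        show "j \<subseteq> V" "u \<subseteq> V" using H_sub jH bd_H[OF xi(1) u(1)] by blast+
        show "j \<inter> u \<noteq> {}" using bd_Int[OF xi(1)] j u by blast
        show "\<not> j \<subseteq> u" using y yx u by blast
        show "x \<notin> u" using yx u by blast
      qed (use u x in auto)
      have "\<not> (transverse V j (h m) \<and> transverse V j (h' m))" using ss(2)[of m] j unfolding strongly_separated_def by blast
      then have "h m \<subseteq> j" using tr[of "h m"] tr[of "h' m"] In[of m] nest(2)[of m] by blast
      then show ?thesis using strongly_separated_mono[OF ss(1) order_refl nest(1)] nest(1)[of m] by blast
    qed
    then show ?thesis by blast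
  qed
  have "\<xi> \<inter> B \<in> roller_boundary V E B" unfolding roller_boundary_def
  proof (intro DiffI notI)
    show "\<xi> \<inter> B \<in> roller_closure V E B" unfolding roller_closure_def
    proof (intro CollectI conjI allI impI)
      fix F assume F: "finite F \<and> F \<subseteq> B"
      then have "F \<subseteq> H" using PH by blast
      then obtain v where "v \<in> V" "Uv V E v \<inter> F = \<xi> \<inter> F" using bd_closure[OF xi(1)] F unfolding roller_closure_def by blast
      then show "\<exists>v\<in>V. Uv V E v \<inter> F = \<xi> \<inter> B \<inter> F" using F by blast
    qed simp
    assume "\<xi> \<inter> B \<in> {Uv V E v \<inter> B |v. v \<in> V}"
    then obtain v where v: "v \<in> V" "\<xi> \<inter> B = Uv V E v \<inter> B" by blast
    have "h n \<in> Uv V E v" for n using v(2) In(2)[of n] inB(2)[of n] by blast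
    then show False using esc[OF v(1)] unfolding Uv_def by blast
  qed
  moreover have "\<exists>k\<in>\<xi> \<inter> B. k \<subseteq> h1 \<inter> h2 \<and> strongly_separated V B k h1 \<and> strongly_separated V B k h2" 
    if h12: "h1 \<in> \<xi> \<inter> B" "h2 \<in> \<xi> \<inter> B" for h1 h2
  proof -
    obtain n1 where n1: "\<forall>m\<ge>n1. k m \<subseteq> h1 \<and> strongly_separated V B (k m) h1" using small[OF h12(1)] by blast
    obtain n2 where n2: "\<forall>m\<ge>n2. k m \<subseteq> h2 \<and> strongly_separated V B (k m) h2" using small[OF h12(2)] by blast
    show ?thesis using n1[rule_format, of "max n1 n2"] n2[rule_format, of "max n1 n2"] In(3)[of "max n1 n2"] inB(3)[of "max n1 n2"]
      by (intro bexI[of _ "k (max n1 n2)"]) auto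
  qed
  ultimately show "\<xi> \<inter> B \<in> factor_regular V E B" unfolding factor_regular_def by blast
  show "\<eta> \<inter> B \<noteq> \<xi> \<inter> B" using In(2)[of 0] inB(2)[of 0] by blast
qed

text \<open>Stated for two abstract maps, so that the coordinates of a pair can be used in either
  order: only the second map is shown to be regular. The hypothesis \<open>pos\<close> is what
  contradicts unwanted constant values supplied by ergodicity.\<close>

lemma regular_AE:
  assumes cV: "countable V" and fl: flips and erg: "isometrically_ergodic G \<alpha> \<nu>"
    and a: "a \<in> \<nu> \<rightarrow>\<^sub>M M0" and b: "b \<in> \<nu> \<rightarrow>\<^sub>M M0"
    and eq: "\<And>g z. g \<in> carrier G \<Longrightarrow> z \<in> space \<nu> \<Longrightarrow> a (\<alpha> g z) = act_roller \<phi> g (a z)"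
      "\<And>g z. g \<in> carrier G \<Longrightarrow> z \<in> space \<nu> \<Longrightarrow> b (\<alpha> g z) = act_roller \<phi> g (b z)"
    and pos: "\<And>h k. h \<in> H \<Longrightarrow> k \<in> H \<Longrightarrow> emeasure \<nu> {z \<in> space \<nu>. h \<in> a z \<and> k \<in> b z} > 0"
  shows "AE z in \<nu>. \<forall>B\<in>P. b z \<inter> B \<in> factor_regular V E B \<and> a z \<inter> B \<noteq> b z \<inter> B"
proof -
  note cH = countable_H[OF cV]
  have abd: "a z \<in> bd" and bbd: "b z \<in> bd" if "z \<in> space \<nu>" for z
    using measurable_space[OF a that] measurable_space[OF b that] space_M0 by auto
  have ma[measurable]: "Measurable.pred \<nu> (\<lambda>z. h \<in> a z)" and mb[measurable]: "Measurable.pred \<nu> (\<lambda>z. h \<in> b z)" if "h \<in> H" for h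
  proof -
    have "{z \<in> space \<nu>. h \<in> a z} = a -` cyl h \<inter> space \<nu>" "{z \<in> space \<nu>. h \<in> b z} = b -` cyl h \<inter> space \<nu>"
      using abd bbd unfolding cyl_def by auto
    then show "Measurable.pred \<nu> (\<lambda>z. h \<in> a z)" "Measurable.pred \<nu> (\<lambda>z. h \<in> b z)"
      unfolding pred_def using measurable_sets[OF a cyl_sets[OF that]] measurable_sets[OF b cyl_sets[OF that]] by simp_all
  qed
  define I where "I z = b z - a z" for z
  have mI: "Measurable.pred \<nu> (\<lambda>z. h \<in> I z)" if "h \<in> H" for h
    unfolding I_def Diff_iff using ma[OF that] mb[OF that] by (intro pred_intros_logic)
  have IH: "h \<in> H" if "h \<in> I z" "z \<in> space \<nu>" for h z using that bd_H[OF bbd] unfolding I_def by blast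
  have I_act: "h \<in> I (\<alpha> g z) \<longleftrightarrow> inv g \<star> h \<in> I z" if "g \<in> carrier G" "z \<in> space \<nu>" "h \<in> H" for g z h
    unfolding I_def Diff_iff eq(1)[OF that(1,2)] eq(2)[OF that(1,2)]
    using act_roller_mem[OF that(1) _ that(3)] bd_H abd[OF that(2)] bbd[OF that(2)] by (metis subsetI)
  have I_act': "g \<star> h \<in> I (\<alpha> g z) \<longleftrightarrow> h \<in> I z" if "g \<in> carrier G" "z \<in> space \<nu>" "h \<in> H" for g z h
    using I_act[OF that(1,2) H_act[OF that(1,3)]] image_inv[OF that(1) H_sub[OF that(3)]] by simp
  obtain c where c: "\<forall>B\<in>P. \<exists>h' h k. triple c B h' h k" using ex_uniform_triple[OF fl] by blast
  define mid where "mid B z = {h. \<exists>h' k. triple c B h' h k \<and> {h', h, k} \<subseteq> I z}" for B z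
  have tH: "h' \<in> H" "h \<in> H" "k \<in> H" "B \<in> P" "h \<in> B" if "triple c B h' h k" for B h' h k 
    using that P_H unfolding triple_def by blast+
  have mid_H: "h \<in> H" "h \<in> B" "B \<in> P" if hm: "h \<in> mid B z" for h B z
  proof -
    obtain h' k where "triple c B h' h k" using hm unfolding mid_def by blast
    then show "h \<in> H" "h \<in> B" "B \<in> P" using tH by blast+
  qed
  have mid_act_sub: "g \<star> h \<in> mid ((\<lambda>l. g \<star> l) ` B) (\<alpha> g z)" if g: "g \<in> carrier G" "z \<in> space \<nu>" "h \<in> mid B z" for g z h B
  proof -
    obtain h' k where t: "triple c B h' h k" "{h', h, k} \<subseteq> I z" using g(3) unfolding mid_def by blast
    have "{g \<star> h', g \<star> h, g \<star> k} \<subseteq> I (\<alpha> g z)" using t(2) I_act'[OF g(1,2)] tH[OF t(1)] by simp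
    then show ?thesis using triple_act[OF g(1) t(1)] unfolding mid_def by blast
  qed
  have mid_act: "h \<in> mid ((\<lambda>l. g \<star> l) ` B) (\<alpha> g z) \<longleftrightarrow> inv g \<star> h \<in> mid B z" 
    if g: "g \<in> carrier G" "z \<in> space \<nu>" "h \<in> H" "B \<in> P" for g z h B
  proof
    assume "inv g \<star> h \<in> mid B z"
    then show "h \<in> mid ((\<lambda>l. g \<star> l) ` B) (\<alpha> g z)" using mid_act_sub[OF g(1,2)] mem_image_H[OF g(1,3)] by metis
  next
    assume "h \<in> mid ((\<lambda>l. g \<star> l) ` B) (\<alpha> g z)"
    then obtain h' k where t: "triple c ((\<lambda>l. g \<star> l) ` B) h' h k" "{h', h, k} \<subseteq> I (\<alpha> g z)" unfolding mid_def by blast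
    have "(\<lambda>l. inv g \<star> l) ` (\<lambda>l. g \<star> l) ` B = B"
    proof -
      have "inv g \<star> g \<star> l = l" if "l \<in> B" for l using image_inv[OF g(1) H_sub[OF P_H[OF g(4) that]]] .
      then show ?thesis by (simp add: image_image)
    qed
    then have "triple c B (inv g \<star> h') (inv g \<star> h) (inv g \<star> k)" using triple_act[OF _ t(1), of "inv g"] g(1) by simp
    moreover have "{inv g \<star> h', inv g \<star> h, inv g \<star> k} \<subseteq> I z" using t(2) I_act[OF g(1,2)] tH[OF t(1)] by simp
    ultimately show "inv g \<star> h \<in> mid B z" unfolding mid_def by blast
  qed
  have mmid: "Measurable.pred \<nu> (\<lambda>z. h \<in> mid B z)" for h B
  proof -
    have "h \<in> mid B z \<longleftrightarrow> (\<exists>h'\<in>H. \<exists>k\<in>H. triple c B h' h k \<and> h' \<in> I z \<and> h \<in> I z \<and> k \<in> I z)" for z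
      unfolding mid_def using tH by auto blast
    moreover have "Measurable.pred \<nu> (\<lambda>z. \<exists>h'\<in>H. \<exists>k\<in>H. triple c B h' h k \<and> h' \<in> I z \<and> h \<in> I z \<and> k \<in> I z)"
    proof (intro pred_countable cH)
      fix h' k assume H: "h' \<in> H" "k \<in> H"
      show "Measurable.pred \<nu> (\<lambda>z. triple c B h' h k \<and> h' \<in> I z \<and> h \<in> I z \<and> k \<in> I z)"
      proof (cases "triple c B h' h k")
        case True
        then show ?thesis using mI H tH[OF True] by (intro pred_intros_logic) auto
      qed simp
    qed
    ultimately show ?thesis by simp
  qed
  \<comment> \<open>The blocks in which some triple separates the two points. As the group may
    permute blocks, constancy is obtained for the set of all such blocks at once.\<close>
  define f1 where "f1 z = {B \<in> P. mid B z \<noteq> {}}" for z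
  define gB where "gB g B = (\<lambda>l. g \<star> l) ` B" for g and B :: "'a set set"
  have gB_one: "gB \<one> B = B" if "B \<in> P" for B
  proof -
    have "\<one> \<star> l = l" if "l \<in> B" for l using image_one[OF H_sub[OF P_H[OF \<open>B \<in> P\<close> that]]] .
    then show ?thesis unfolding gB_def by simp
  qed
  have gB_mult: "gB (g \<otimes> k) B = gB g (gB k B)" if "g \<in> carrier G" "k \<in> carrier G" "B \<in> P" for g k B
  proof -
    have "(g \<otimes> k) \<star> l = g \<star> k \<star> l" if "l \<in> B" for l using image_mult[OF \<open>g \<in> carrier G\<close> \<open>k \<in> carrier G\<close> H_sub[OF P_H[OF \<open>B \<in> P\<close> that]]] .
    then show ?thesis unfolding gB_def by (simp add: image_image)
  qed
  have mf1: "Measurable.pred \<nu> (\<lambda>z. mid B z \<noteq> {})" for B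
  proof -
    have "mid B z \<noteq> {} \<longleftrightarrow> (\<exists>h\<in>H. h \<in> mid B z)" for z using mid_H by blast
    moreover have "Measurable.pred \<nu> (\<lambda>z. \<exists>h\<in>H. h \<in> mid B z)" by (intro pred_countable cH mmid)
    ultimately show ?thesis by simp
  qed
  have "\<exists>X\<in>Pow P. AE z in \<nu>. f1 z = X"
  proof (rule isometrically_ergodic_countable[OF erg, of _ _ "\<lambda>g X. gB g ` X"])
    show "countable (Pow P)" using finite_P by (simp add: countable_finite)
    show "f1 z \<in> Pow P" for z unfolding f1_def by blast
    show "{z \<in> space \<nu>. f1 z = X} \<in> sets \<nu>" if "X \<in> Pow P" for X
    proof -
      have "f1 z = X \<longleftrightarrow> (\<forall>B\<in>P. mid B z \<noteq> {} \<longleftrightarrow> B \<in> X)" for z using that unfolding f1_def by blast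
      moreover have "Measurable.pred \<nu> (\<lambda>z. \<forall>B\<in>P. mid B z \<noteq> {} \<longleftrightarrow> B \<in> X)"
        by (intro pred_countable countable_finite[OF finite_P] measurable_compose[OF mf1]) simp
      ultimately show ?thesis by (simp add: pred_def)
    qed
    show "gB g ` X \<in> Pow P" if "g \<in> carrier G" "X \<in> Pow P" for g X 
      using block_act[OF that(1)] that(2) unfolding gB_def by blast
    show "gB \<one> ` X = X" if "X \<in> Pow P" for X using gB_one that by force
    show "gB (g \<otimes> k) ` X = gB g ` gB k ` X" if "g \<in> carrier G" "k \<in> carrier G" "X \<in> Pow P" for g k X
      unfolding image_image by (rule image_cong[OF refl]) (use gB_mult that in blast)
    show "f1 (\<alpha> g z) = gB g ` f1 z" if g: "g \<in> carrier G" "z \<in> space \<nu>" for g z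
    proof (intro equalityI subsetI)
      fix B assume "B \<in> gB g ` f1 z"
      then obtain B0 h where "B0 \<in> P" "h \<in> mid B0 z" "B = gB g B0" unfolding f1_def by blast
      then show "B \<in> f1 (\<alpha> g z)" using mid_act_sub[OF g] block_act[OF g(1)] unfolding f1_def gB_def by blast
    next
      fix B assume "B \<in> f1 (\<alpha> g z)"
      then obtain h where h: "B \<in> P" "h \<in> mid B (\<alpha> g z)" unfolding f1_def by blast
      define B0 where "B0 = gB (inv g) B"
      have B0: "B0 \<in> P" unfolding B0_def gB_def using block_act h(1) g(1) by simp
      have BB: "B = gB g B0" unfolding B0_def using gB_mult[of g "inv g" B] gB_one g(1) h(1) by simp
      then have "inv g \<star> h \<in> mid B0 z" using mid_act[OF g _ B0, of h] h mid_H(1) unfolding gB_def by blast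
      then show "B \<in> gB g ` f1 z" using B0 BB unfolding f1_def by blast
    qed
  qed
  then obtain X where X: "X \<subseteq> P" "AE z in \<nu>. f1 z = X" by blast
  have "B \<in> X" if B: "B \<in> P" for B
  proof (rule ccontr)
    assume nX: "B \<notin> X"
    obtain h' h k where t: "triple c B h' h k" using c B by blast
    note H = tH[OF t]
    have nest: "k \<subseteq> h" "h \<subseteq> h'" using t unfolding triple_def by blast+
    \<comment> \<open>On the excluded event the whole triple separates \<open>a z\<close> from
      \<open>b z\<close>, so \<open>B\<close> would belong to \<open>X\<close>; but the event has
      positive measure.\<close>
    have "AE z in \<nu>. \<not> (V - h' \<in> a z \<and> k \<in> b z)" using X(2)
    proof (rule AE_mp[OF _ AE_I2], intro impI notI)
      fix z assume z: "z \<in> space \<nu>" "f1 z = X" "V - h' \<in> a z \<and> k \<in> b z"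
      have "{h', h, k} \<subseteq> b z" using bd_up[OF bbd[OF z(1)]] z(3) H nest by blast
      moreover have "h' \<notin> a z" using bd_compl[OF abd[OF z(1)] H(1)] z(3) by blast
      then have "{h', h, k} \<inter> a z = {}" using bd_up[OF abd[OF z(1)]] H nest by blast
      ultimately have "h \<in> mid B z" using t unfolding mid_def I_def by blast
      then show False using nX z(2) B unfolding f1_def by blast
    qed
    then have "emeasure \<nu> {z \<in> space \<nu>. V - h' \<in> a z \<and> k \<in> b z} = 0"
      by (subst AE_iff_measurable[symmetric, where P = "\<lambda>z. \<not> (V - h' \<in> a z \<and> k \<in> b z)"]) 
        (use ma mb H in \<open>auto simp: pred_def[symmetric]\<close>)
    then show False using pos[of "V - h'" k] H by simp
  qed
  then have AE1: "AE z in \<nu>. \<forall>B\<in>P. mid B z \<noteq> {}" using X(2) unfolding f1_def by (auto elim!: AE_mp)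
  define Mid where "Mid z = (\<Union>B\<in>P. mid B z)" for z
  \<comment> \<open>Minimal members are pairwise transverse, so there are finitely many of them, and
    the values of \<open>f2\<close> lie in a countable set.\<close>
  define f2 where "f2 z = {h \<in> Mid z. \<not> (\<exists>j\<in>Mid z. j \<subset> h)}" for z
  have Mid_H: "Mid z \<subseteq> H" for z unfolding Mid_def using mid_H by blast
  have mMid: "Measurable.pred \<nu> (\<lambda>z. h \<in> Mid z)" for h
    unfolding Mid_def UN_iff using mmid countable_finite[OF finite_P] by (intro pred_countable) auto
  have mf2: "Measurable.pred \<nu> (\<lambda>z. h \<in> f2 z)" for h
  proof -
    have "h \<in> f2 z \<longleftrightarrow> h \<in> Mid z \<and> \<not> (\<exists>j\<in>H. j \<in> Mid z \<and> j \<subset> h)" for z unfolding f2_def using Mid_H by blast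
    moreover have "Measurable.pred \<nu> (\<lambda>z. h \<in> Mid z \<and> \<not> (\<exists>j\<in>H. j \<in> Mid z \<and> j \<subset> h))"
      by (intro pred_intros_logic pred_countable cH mMid) simp_all
    ultimately show ?thesis by simp
  qed
  have Mid_act: "h \<in> Mid (\<alpha> g z) \<longleftrightarrow> inv g \<star> h \<in> Mid z" if g: "g \<in> carrier G" "z \<in> space \<nu>" "h \<in> H" for g z h
  proof
    assume "h \<in> Mid (\<alpha> g z)"
    then obtain B where B: "B \<in> P" "h \<in> mid B (\<alpha> g z)" unfolding Mid_def by blast
    define B0 where "B0 = gB (inv g) B"
    have B0: "B0 \<in> P" unfolding B0_def gB_def using block_act B(1) g(1) by simp
    have BB: "B = gB g B0" unfolding B0_def using gB_mult[of g "inv g" B] gB_one g(1) B(1) by simp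
    then have "inv g \<star> h \<in> mid B0 z" using mid_act[OF g B0] B unfolding gB_def by blast
    then show "inv g \<star> h \<in> Mid z" using B0 unfolding Mid_def by blast
  next
    assume "inv g \<star> h \<in> Mid z"
    then obtain B where B: "B \<in> P" "inv g \<star> h \<in> mid B z" unfolding Mid_def by blast
    then have "h \<in> mid (gB g B) (\<alpha> g z)" using mid_act[OF g B(1)] unfolding gB_def by blast
    moreover have "gB g B \<in> P" using block_act[OF g(1) B(1)] unfolding gB_def .
    ultimately show "h \<in> Mid (\<alpha> g z)" unfolding Mid_def by blast
  qed
  define F where "F = {X. X \<subseteq> H \<and> finite X}"
  have "\<exists>X\<in>F. AE z in \<nu>. f2 z = X"
  proof (rule isometrically_ergodic_countable[OF erg, of _ _ gB])
    have "F = {X. finite X \<and> X \<subseteq> H}" unfolding F_def by blast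
    then show "countable F" using countable_Collect_finite_subset[OF cH] by simp
    show "f2 z \<in> F" if z: "z \<in> space \<nu>" for z
    proof -
      have f2I: "f2 z \<subseteq> b z - a z" unfolding f2_def Mid_def mid_def I_def by blast
      have "transverse_family (f2 z)" unfolding transverse_family_def
      proof (intro conjI ballI impI)
        show "f2 z \<subseteq> H" unfolding f2_def using Mid_H by blast
        fix h k assume hk: "h \<in> f2 z" "k \<in> f2 z" "h \<noteq> k"
        then have "\<not> h \<subseteq> k" "\<not> k \<subseteq> h" unfolding f2_def by blast+
        then show "transverse V h k" 
          using between_transverse[OF bbd[OF z] abd[OF z] subsetD[OF f2I hk(1)] subsetD[OF f2I hk(2)]] by blast
      qed
      then have "finite (f2 z)" using infinite_not_transverse_family by blast
      moreover have "f2 z \<subseteq> H" unfolding f2_def using Mid_H by blast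
      ultimately show ?thesis unfolding F_def by simp
    qed
    show "{z \<in> space \<nu>. f2 z = X} \<in> sets \<nu>" if "X \<in> F" for X
    proof -
      have "f2 z = X \<longleftrightarrow> (\<forall>h\<in>H. h \<in> f2 z \<longleftrightarrow> h \<in> X)" for z using that Mid_H[of z] unfolding f2_def F_def by blast
      moreover have "Measurable.pred \<nu> (\<lambda>z. \<forall>h\<in>H. h \<in> f2 z \<longleftrightarrow> h \<in> X)"
        by (intro pred_countable pred_intros_logic cH mf2) simp_all
      ultimately show ?thesis by (simp add: pred_def)
    qed
    show "gB g X \<in> F" if "g \<in> carrier G" "X \<in> F" for g X using that H_act unfolding F_def gB_def by blast
    show "gB \<one> X = X" if "X \<in> F" for X
    proof -
      have XH: "X \<subseteq> H" using \<open>X \<in> F\<close> unfolding F_def by blast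
      have "\<one> \<star> l = l" if "l \<in> X" for l using image_one[OF H_sub[OF subsetD[OF XH that]]] .
      then show ?thesis unfolding gB_def by simp
    qed
    show "gB (g \<otimes> k) X = gB g (gB k X)" if "g \<in> carrier G" "k \<in> carrier G" "X \<in> F" for g k X
    proof -
      have XH: "X \<subseteq> H" using \<open>X \<in> F\<close> unfolding F_def by blast
      have "(g \<otimes> k) \<star> l = g \<star> k \<star> l" if "l \<in> X" for l 
        using image_mult[OF \<open>g \<in> carrier G\<close> \<open>k \<in> carrier G\<close> H_sub[OF subsetD[OF XH that]]] .
      then show ?thesis unfolding gB_def by (simp add: image_image)
    qed
    show "f2 (\<alpha> g z) = gB g (f2 z)" if g: "g \<in> carrier G" "z \<in> space \<nu>" for g z
    proof -
      have *: "h \<in> f2 (\<alpha> g z) \<longleftrightarrow> inv g \<star> h \<in> f2 z" if h: "h \<in> H" for h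
      proof -
        have "(\<exists>j\<in>Mid (\<alpha> g z). j \<subset> h) \<longleftrightarrow> (\<exists>j\<in>Mid z. j \<subset> inv g \<star> h)"
        proof
          assume "\<exists>j\<in>Mid (\<alpha> g z). j \<subset> h"
          then obtain j where j: "j \<in> Mid (\<alpha> g z)" "j \<subset> h" "j \<in> H" using Mid_H by blast
          then have "inv g \<star> j \<subset> inv g \<star> h" using image_psub[of "inv g" j h] g(1) H_sub h by simp
          then show "\<exists>j\<in>Mid z. j \<subset> inv g \<star> h" using Mid_act[OF g j(3)] j(1) by blast
        next
          assume "\<exists>j\<in>Mid z. j \<subset> inv g \<star> h"
          then obtain j where j: "j \<in> Mid z" "j \<subset> inv g \<star> h" "j \<in> H" using Mid_H by blast
          then have "g \<star> j \<subset> g \<star> inv g \<star> h" using image_psub[OF g(1), of j "inv g \<star> h"] H_sub H_act_inv[OF g(1) h] by simp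
          then have "g \<star> j \<subset> h" using mem_image_H[OF g(1) h] by simp
          moreover have "g \<star> j \<in> Mid (\<alpha> g z)" 
            using Mid_act[OF g H_act[OF g(1) j(3)]] image_inv[OF g(1) H_sub[OF j(3)]] j(1) by simp
          ultimately show "\<exists>j\<in>Mid (\<alpha> g z). j \<subset> h" by blast
        qed
        then show ?thesis unfolding f2_def using Mid_act[OF g h] by blast
      qed
      have f2H: "f2 z \<subseteq> H" for z unfolding f2_def using Mid_H by blast
      show ?thesis
      proof (intro equalityI subsetI)
        fix h assume h: "h \<in> f2 (\<alpha> g z)"
        then have "h \<in> H" using f2H by blast
        then show "h \<in> gB g (f2 z)" using *[of h] h mem_image_H[OF g(1), of h] unfolding gB_def by blast
      next
        fix h assume "h \<in> gB g (f2 z)"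
        then obtain l where l: "l \<in> f2 z" "h = g \<star> l" unfolding gB_def by blast
        then have lH: "l \<in> H" using f2H by blast
        then show "h \<in> f2 (\<alpha> g z)" using *[OF H_act[OF g(1) lH]] l image_inv[OF g(1) H_sub[OF lH]] by simp
      qed
    qed
  qed
  then obtain Z where Z: "Z \<in> F" "AE z in \<nu>. f2 z = Z" by blast
  have "Z = {}"
  proof (rule ccontr)
    assume "Z \<noteq> {}"
    then obtain h where h: "h \<in> Z" "h \<in> H" using Z(1) unfolding F_def by blast
    \<comment> \<open>A fixed \<open>h\<close> in \<open>Z\<close> would almost surely contain
      \<open>b z\<close>, yet both points lie in its complement on a set of positive
      measure.\<close>
    have "AE z in \<nu>. \<not> (V - h \<in> a z \<and> V - h \<in> b z)" using Z(2)
    proof (rule AE_mp[OF _ AE_I2], intro impI notI)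
      fix z assume z: "z \<in> space \<nu>" "f2 z = Z" "V - h \<in> a z \<and> V - h \<in> b z"
      have "h \<in> b z" using h z(2) unfolding f2_def Mid_def mid_def I_def by blast
      then show False using bd_compl[OF bbd[OF z(1)] h(2)] z(3) by blast
    qed
    then have "emeasure \<nu> {z \<in> space \<nu>. V - h \<in> a z \<and> V - h \<in> b z} = 0"
      by (subst AE_iff_measurable[symmetric, where P = "\<lambda>z. \<not> (V - h \<in> a z \<and> V - h \<in> b z)"]) 
        (use ma mb h in \<open>auto simp: pred_def[symmetric]\<close>)
    then show False using pos[of "V - h" "V - h"] h by simp
  qed
  then have "AE z in \<nu>. f2 z = {}" using Z(2) by simp
  then show ?thesis using AE1
  proof (rule AE_mp[OF _ AE_mp[OF _ AE_I2]], intro impI ballI)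
    fix z B assume z: "z \<in> space \<nu>" and 1: "\<forall>B\<in>P. mid B z \<noteq> {}" and 2: "f2 z = {}" and B: "B \<in> P"
    have D: "mid B z = {h. \<exists>h' k. triple c B h' h k \<and> {h', h, k} \<subseteq> b z - a z}" unfolding mid_def I_def by blast
    have desc: "\<exists>j\<in>mid B z. j \<subset> h" if h: "h \<in> mid B z" for h
    proof -
      have "h \<in> Mid z" using h B unfolding Mid_def by blast
      then obtain j where j: "j \<in> Mid z" "j \<subset> h" using 2 unfolding f2_def by blast
      obtain B' where B': "B' \<in> P" "j \<in> mid B' z" using j(1) unfolding Mid_def by blast
      \<comment> \<open>A smaller member of \<open>Mid z\<close> is nested with \<open>h\<close>,
        hence belongs to the same block.\<close>
      have "j \<in> B" using nested_block[OF B mid_H(2)[OF h] mid_H(1)[OF B'(2)]] nestedI(3) j(2) by blast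
      then have "B' = B" using P_disj[OF B'(1) B mid_H(2)[OF B'(2)]] by blast
      then show ?thesis using B' j by blast
    qed
    show "b z \<inter> B \<in> factor_regular V E B \<and> a z \<inter> B \<noteq> b z \<inter> B"
      using regular_if_descending[OF bbd[OF z] abd[OF z] B D _ desc] 1 B by blast
  qed
qed

text \<open>Restriction to a block stays in the closure, so only the difference from every vertex
  and the separation property remain to be expressed, and their quantifiers run over countable
  sets.\<close>

lemma regular_boundary_sets:
  assumes cV: "countable V" shows "regular_boundary V E P \<in> sets M0"
proof -
  note cH = countable_H[OF cV]
  have m: "Measurable.pred M0 (\<lambda>\<xi>. h \<in> \<xi>)" if "h \<in> H" for h
    using cyl_sets[OF that] unfolding pred_def space_M0 cyl_def .
  have cB: "countable B" if "B \<in> P" for B using cH P_H[OF that] by (meson countable_subset subsetI)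
  have ch: "\<xi> \<inter> B \<in> factor_regular V E B \<longleftrightarrow> (\<forall>v\<in>V. \<exists>h\<in>B. \<not> (h \<in> \<xi> \<longleftrightarrow> v \<in> h)) \<and>
      (\<forall>h1\<in>B. \<forall>h2\<in>B. h1 \<in> \<xi> \<longrightarrow> h2 \<in> \<xi> \<longrightarrow> (\<exists>k\<in>B. k \<in> \<xi> \<and> k \<subseteq> h1 \<inter> h2 \<and> 
        strongly_separated V B k h1 \<and> strongly_separated V B k h2))" if x: "\<xi> \<in> bd" and B: "B \<in> P" for \<xi> B
  proof -
    have BH: "B \<subseteq> H" using P_H[OF B] by blast
    have cl: "\<xi> \<inter> B \<in> roller_closure V E B" unfolding roller_closure_def
    proof (intro CollectI conjI allI impI)
      fix F assume F: "finite F \<and> F \<subseteq> B"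
      then have "F \<subseteq> H" using BH by blast
      then obtain v where "v \<in> V" "Uv V E v \<inter> F = \<xi> \<inter> F" using bd_closure[OF x] F unfolding roller_closure_def by blast
      then show "\<exists>v\<in>V. Uv V E v \<inter> F = \<xi> \<inter> B \<inter> F" using F by blast
    qed simp
    have "\<xi> \<inter> B = Uv V E v \<inter> B \<longleftrightarrow> (\<forall>h\<in>B. h \<in> \<xi> \<longleftrightarrow> v \<in> h)" for v
      using BH unfolding Uv_def by blast
    then have "\<xi> \<inter> B \<in> roller_boundary V E B \<longleftrightarrow> (\<forall>v\<in>V. \<exists>h\<in>B. \<not> (h \<in> \<xi> \<longleftrightarrow> v \<in> h))"
      unfolding roller_boundary_def using cl by auto
    then show ?thesis unfolding factor_regular_def by blast
  qed
  have "regular_boundary V E P = {\<xi> \<in> space M0. \<forall>B\<in>P. (\<forall>v\<in>V. \<exists>h\<in>B. \<not> (h \<in> \<xi> \<longleftrightarrow> v \<in> h)) \<and>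
      (\<forall>h1\<in>B. \<forall>h2\<in>B. h1 \<in> \<xi> \<longrightarrow> h2 \<in> \<xi> \<longrightarrow> (\<exists>k\<in>B. k \<in> \<xi> \<and> k \<subseteq> h1 \<inter> h2 \<and> 
        strongly_separated V B k h1 \<and> strongly_separated V B k h2))}"
    unfolding regular_boundary_def space_M0 by (intro Collect_cong conj_cong ball_cong refl ch)
  also have "\<dots> \<in> sets M0"
    unfolding pred_def[symmetric] using countable_finite[OF finite_P]
    by (intro pred_countable pred_intros_logic m cV cB) (auto intro: P_H)
  finally show ?thesis .
qed

end

theorem theorem7p12:
  fixes G :: "('g, 'b) monoid_scheme"
    and V :: "'a set" and E :: "'a \<Rightarrow> 'a \<Rightarrow> bool"
    and \<phi> :: "'g \<Rightarrow> 'a \<Rightarrow> 'a"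
    and lm lp :: "'a set set measure"
  assumes "group G" and "countable (carrier G)"
    and "median_graph V E" and "countable V" and "finite_dimensional V E"
    and "aut_action G V E \<phi>"
    and "nonelementary G V E \<phi>" and "essential G V E \<phi>"
    and "prob_space lm" and "sets lm = sets (boundary_measurable V E)"
    and "prob_space lp" and "sets lp = sets (boundary_measurable V E)"
    and "quasi_invariant G (act_roller \<phi>) lm" and "quasi_invariant G (act_roller \<phi>) lp"
    and "isometrically_ergodic G (\<lambda>g z. (act_roller \<phi> g (fst z), act_roller \<phi> g (snd z))) (lm \<Otimes>\<^sub>M lp)"
    and "irreducible_decomposition V E P"
  shows "emeasure (lm \<Otimes>\<^sub>M lp) (regular_boundary V E P \<times> regular_boundary V E P) = 1
     \<and> emeasure (lm \<Otimes>\<^sub>M lp) (fat_diagonal V E P) = 0"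
proof -
  interpret irreducible_blocks V E G \<phi> P
    by (intro irreducible_blocks.intro cube_action.intro fin_dim_complex.intro median_complex.intro
        fin_dim_complex_axioms.intro cube_action_axioms.intro irreducible_blocks_axioms.intro assms)
  interpret L: pair_prob_space lm lp
    by (intro pair_prob_space.intro pair_sigma_finite.intro prob_space_imp_sigma_finite assms)
  let ?\<nu> = "lm \<Otimes>\<^sub>M lp"
  have sp: "space lm = bd" "space lp = bd" using sets_eq_imp_space_eq assms(10,12) space_M0 by metis+
  have fl: flips by (rule flips[OF assms(8,7)])
  have m1: "fst \<in> ?\<nu> \<rightarrow>\<^sub>M M0" using measurable_fst measurable_cong_sets[OF refl assms(10)] by blast
  have m2: "snd \<in> ?\<nu> \<rightarrow>\<^sub>M M0" using measurable_snd measurable_cong_sets[OF refl assms(12)] by blast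
  have pos: "emeasure ?\<nu> (cyl h \<times> cyl k) > 0" if "h \<in> H" "k \<in> H" for h k
  proof -
    have "emeasure ?\<nu> (cyl h \<times> cyl k) = emeasure lm (cyl h) * emeasure lp (cyl k)"
      by (rule L.M2.emeasure_pair_measure_Times) (use cyl_sets that assms(10,12) in auto)
    then show ?thesis using cyl_pos[OF assms(8,7,9,10,13) that(1)] cyl_pos[OF assms(8,7,11,12,14) that(2)]
      by (simp add: ennreal_zero_less_mult_iff)
  qed
  have A1: "AE z in ?\<nu>. \<forall>B\<in>P. snd z \<inter> B \<in> factor_regular V E B \<and> fst z \<inter> B \<noteq> snd z \<inter> B"
  proof (rule regular_AE[OF assms(4) fl assms(15) m1 m2])
    fix h k assume hk: "h \<in> H" "k \<in> H"
    have "{z \<in> space ?\<nu>. h \<in> fst z \<and> k \<in> snd z} = cyl h \<times> cyl k" unfolding space_pair_measure sp cyl_def by auto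
    then show "emeasure ?\<nu> {z \<in> space ?\<nu>. h \<in> fst z \<and> k \<in> snd z} > 0" using pos[OF hk] by simp
  qed simp_all
  \<comment> \<open>Exchanging the coordinates makes the first point regular as well.\<close>
  have A2: "AE z in ?\<nu>. \<forall>B\<in>P. fst z \<inter> B \<in> factor_regular V E B \<and> snd z \<inter> B \<noteq> fst z \<inter> B"
  proof (rule regular_AE[OF assms(4) fl assms(15) m2 m1])
    fix h k assume hk: "h \<in> H" "k \<in> H"
    have "{z \<in> space ?\<nu>. h \<in> snd z \<and> k \<in> fst z} = cyl k \<times> cyl h" unfolding space_pair_measure sp cyl_def by auto
    then show "emeasure ?\<nu> {z \<in> space ?\<nu>. h \<in> snd z \<and> k \<in> fst z} > 0" using pos[OF hk(2,1)] by simp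
  qed simp_all
  let ?R = "regular_boundary V E P"
  have R: "?R \<in> sets lm" "?R \<in> sets lp" using regular_boundary_sets[OF assms(4)] assms(10,12) by simp_all
  have "AE z in ?\<nu>. z \<in> ?R \<times> ?R" using A1 A2
  proof (rule AE_mp[OF _ AE_mp[OF _ AE_I2]], intro impI)
    fix z assume z: "z \<in> space ?\<nu>" "\<forall>B\<in>P. fst z \<inter> B \<in> factor_regular V E B \<and> snd z \<inter> B \<noteq> fst z \<inter> B"
      "\<forall>B\<in>P. snd z \<inter> B \<in> factor_regular V E B \<and> fst z \<inter> B \<noteq> snd z \<inter> B"
    then show "z \<in> ?R \<times> ?R" unfolding regular_boundary_def space_pair_measure sp by (simp add: mem_Times_iff)
  qed
  then have "emeasure ?\<nu> (?R \<times> ?R) = 1" 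
    by (intro L.emeasure_eq_1_AE) (use R in simp_all)
  moreover have "emeasure ?\<nu> (fat_diagonal V E P) = 0"
  \<comment> \<open>For a measurable fat diagonal the second half of \<open>A1\<close> says that
    almost every pair avoids it; for a set that is not measurable \<open>emeasure\<close> takes the
    value 0.\<close>
  proof (cases "fat_diagonal V E P \<in> sets ?\<nu>")
    case True
    have "AE z in ?\<nu>. z \<notin> fat_diagonal V E P" using A1
      by (rule AE_mp[OF _ AE_I2]) (auto simp: fat_diagonal_def)
    then show ?thesis using True by (simp add: AE_iff_null_sets null_setsD1)
  next
    case False
    then show ?thesis by (rule emeasure_notin_sets)
  qed
  ultimately show ?thesis by blast
qed

end
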